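(* Any $(K,C)$-quasi-isometry $\varphi$ of the Diestel-Leader graph $DL(m,n)$ is within bounded distance from a height respecting quasi-isometry $\hat\varphi$, i.e. $\sup_{p}d(\varphi(p),\hat\varphi(p))<\infty$. Furthermore, the bound is uniform in $K$ and $C$.
   Context: Diestel-Leader graphs: for positive integers $m,n$, let $T_{m+1}$ and $T_{n+1}$ be regular trees of valence $m+1$ and $n+1$. Choose an end of each tree; this orients the edges so that each vertex of $T_{m+1}$ (resp. $T_{n+1}$) has $m$ (resp. $n$) edges pointing away from it and one edge pointing toward it. Let $f_m,f_n$ be the Busemann (height) functions on $T_{m+1},T_{n+1}$ for the chosen ends, integer valued on vertices and changing by exactly $1$ along each edge. $DL(m,n)$ is the subset of $T_{m+1}\times T_{n+1}$ consisting of $(x,y)$ with $f_m(x)+f_n(y)=0$; it is a graph with vertices the pairs of vertices $(v_1,v_2)$ with $f_m(v_1)+f_n(v_2)=0$, with $(v_1,v_2)$ and $(w_1,w_2)$ joined by an edge when $v_1,w_1$ are adjacent in $T_{m+1}$ and $v_2,w_2$ are adjacent in $T_{n+1}$. It carries the path metric with edges of length one. The height function on $DL(m,n)$ is $h((x,y))=f_m(x)=-f_n(y)$. A map $f:X\to Y$ between metric spaces is a $(K,C)$-quasi-isometry ($K\ge 1$, $C\ge 0$) if $\frac1K d_X(x_1,x_2)-C\le d_Y(f(x_1),f(x_2))\le K d_X(x_1,x_2)+C$ for all $x_1,x_2\in X$, and the $C$-neighborhood of $f(X)$ is all of $Y$. A quasi-isometry is height respecting if it permutes the level sets of $h$ to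 within bounded distance: there is a constant $B$ such that the image of every level set of $h$ is within Hausdorff distance $B$ of a level set of $h$. "The bound is uniform in $K$ and $C$" means that, for the fixed graph $DL(m,n)$, it depends only on $K$ and $C$.
   Formalization: The case where exactly one of m, n equals 1 is excluded: there DL(m,n) is a regular tree of valence at least 3, and an isometry moving the chosen end is not within bounded distance of any height respecting quasi-isometry. *)

theory Defs
  imports "HOL-Analysis.Analysis" "Graph_Theory.Graph_Theory"
begin

section \<open>Coarse geometry\<close>

text \<open>A metric space is given by a carrier and a distance function. The coarse surjectivity
  condition uses closed neighbourhoods, so that \<open>C = 0\<close> means surjectivity.\<close>

definition quasi_isometry ::
  "real \<Rightarrow> real \<Rightarrow> 'p set \<Rightarrow> ('p \<Rightarrow> 'p \<Rightarrow> real) \<Rightarrow> 'q set \<Rightarrow> ('q \<Rightarrow> 'q \<Rightarrow> real) \<Rightarrow> ('p \<Rightarrow> 'q) \<Rightarrow> bool"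
  where
  "quasi_isometry K C X dX Y dY \<phi> \<longleftrightarrow>
     K \<ge> 1 \<and> C \<ge> 0 \<and> \<phi> \<in> X \<rightarrow> Y \<and>
     (\<forall>x1\<in>X. \<forall>x2\<in>X. 1 / K * dX x1 x2 - C \<le> dY (\<phi> x1) (\<phi> x2) \<and>
                      dY (\<phi> x1) (\<phi> x2) \<le> K * dX x1 x2 + C) \<and>
     (\<forall>y\<in>Y. \<exists>x\<in>X. dY y (\<phi> x) \<le> C)"

definition hausdorff_dist :: "('p \<Rightarrow> 'p \<Rightarrow> real) \<Rightarrow> 'p set \<Rightarrow> 'p set \<Rightarrow> ennreal" where
  "hausdorff_dist d A B =
     max (SUP a\<in>A. INF b\<in>B. ennreal (d a b)) (SUP b\<in>B. INF a\<in>A. ennreal (d b a))"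

definition level_set :: "'p set \<Rightarrow> ('p \<Rightarrow> real) \<Rightarrow> real \<Rightarrow> 'p set" where
  "level_set X h t = {p \<in> X. h p = t}"

definition height_respecting ::
  "'p set \<Rightarrow> ('p \<Rightarrow> 'p \<Rightarrow> real) \<Rightarrow> ('p \<Rightarrow> real) \<Rightarrow> ('p \<Rightarrow> 'p) \<Rightarrow> bool" where
  "height_respecting X d h \<phi> \<longleftrightarrow>
     (\<exists>B::real. \<forall>t. \<exists>s. hausdorff_dist d (\<phi> ` level_set X h t) (level_set X h s) \<le> ennreal B)"


section \<open>Regular trees, ends and Busemann functions\<close>

text \<open>An undirected simple graph is a symmetric loop-free digraph. The library notion
  \<open>forest\<close> is not usable for such digraphs, since it counts the closed walk \<open>u, v, u\<close> along
  a single edge as a cycle; undirected cycles are those of length at least 3.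
  The valence of a vertex is its out-degree.\<close>

definition regular_tree :: "nat \<Rightarrow> 'a pair_pre_digraph \<Rightarrow> bool" where
  "regular_tree d T \<longleftrightarrow>
     pair_bidirected_digraph T \<and>
     Digraph_Component.connected (with_proj T) \<and>
     \<not> (\<exists>c. pre_digraph.cycle (with_proj T) c \<and> length c \<ge> 3) \<and>
     (\<forall>v\<in>pverts T. out_degree (with_proj T) v = d)"

definition graph_dist :: "'a pair_pre_digraph \<Rightarrow> 'a \<Rightarrow> 'a \<Rightarrow> ereal" where
  "graph_dist T u v = wf_digraph.\<mu> (with_proj T) (\<lambda>_. 1) u v"

definition ray :: "'a pair_pre_digraph \<Rightarrow> (nat \<Rightarrow> 'a) \<Rightarrow> bool" where
  "ray T r \<longleftrightarrow> inj r \<and> range r \<subseteq> pverts T \<and> (\<forall>k. (r k, r (Suc k)) \<in> parcs T)"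

text \<open>Two rays in a tree have the same end iff they eventually coincide, up to a shift
  of the parameter.\<close>

definition tree_ends :: "'a pair_pre_digraph \<Rightarrow> (nat \<Rightarrow> 'a) set set" where
  "tree_ends T = {r. ray T r} //
     {(r, s). ray T r \<and> ray T s \<and> (\<exists>i j. \<forall>k. r (i + k) = s (j + k))}"

text \<open>Busemann functions of an end are determined up to an additive integer constant,
  corresponding to the choice of the ray \<open>r\<close>. With this sign, an edge pointing away from
  the end goes from height \<open>k\<close> to height \<open>k + 1\<close>.\<close>

definition busemann :: "'a pair_pre_digraph \<Rightarrow> (nat \<Rightarrow> 'a) set \<Rightarrow> ('a \<Rightarrow> int) \<Rightarrow> bool" where
  "busemann T \<omega> f \<longleftrightarrow>
     (\<exists>r\<in>\<omega>. \<forall>v\<in>pverts T.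
        (\<lambda>k. graph_dist T v (r k) - ereal (real k)) \<longlonglongrightarrow> ereal (of_int (f v)))"


section \<open>Metric realisation of a tree\<close>

text \<open>A point of the metric tree is given by its barycentric coordinates: \<open>edge_pt u v t\<close>
  is the point at distance \<open>t\<close> from \<open>u\<close> on the edge from \<open>u\<close> to \<open>v\<close>, and the vertex \<open>u\<close>
  itself if \<open>u = v\<close>.\<close>

definition edge_pt :: "'a \<Rightarrow> 'a \<Rightarrow> real \<Rightarrow> 'a \<Rightarrow> real" where
  "edge_pt u v t = (\<lambda>w. (if w = u then 1 - t else 0) + (if w = v then t else 0))"

definition realisation :: "'a pair_pre_digraph \<Rightarrow> ('a \<Rightarrow> real) set" where
  "realisation T = {edge_pt u v t | u v t.
     u \<in> pverts T \<and> v \<in> pverts T \<and> (u = v \<or> (u, v) \<in> parcs T) \<and> 0 \<le> t \<and> t \<le> 1}"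

text \<open>The affine extension of a function on the vertices to the realisation.\<close>

definition affine_ext :: "('a \<Rightarrow> int) \<Rightarrow> ('a \<Rightarrow> real) \<Rightarrow> real" where
  "affine_ext f x = (\<Sum>v | x v \<noteq> 0. x v * of_int (f v))"


section \<open>Diestel-Leader graphs\<close>

definition DL_graph ::
  "'a pair_pre_digraph \<Rightarrow> 'b pair_pre_digraph \<Rightarrow> ('a \<Rightarrow> int) \<Rightarrow> ('b \<Rightarrow> int) \<Rightarrow> ('a \<times> 'b) pair_pre_digraph"
  where
  "DL_graph S T f g =
     (let V = {(v1, v2). v1 \<in> pverts S \<and> v2 \<in> pverts T \<and> f v1 + g v2 = 0} in
      \<lparr>pverts = V,
       parcs = {((v1, v2), (w1, w2)).
         (v1, v2) \<in> V \<and> (w1, w2) \<in> V \<and> (v1, w1) \<in> parcs S \<and> (v2, w2) \<in> parcs T}\<rparr>)"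

definition DL_space ::
  "'a pair_pre_digraph \<Rightarrow> 'b pair_pre_digraph \<Rightarrow> ('a \<Rightarrow> int) \<Rightarrow> ('b \<Rightarrow> int) \<Rightarrow>
   (('a \<Rightarrow> real) \<times> ('b \<Rightarrow> real)) set" where
  "DL_space S T f g =
     {(x, y). x \<in> realisation S \<and> y \<in> realisation T \<and> affine_ext f x + affine_ext g y = 0}"

definition DL_height :: "('a \<Rightarrow> int) \<Rightarrow> ('a \<Rightarrow> real) \<times> ('b \<Rightarrow> real) \<Rightarrow> real" where
  "DL_height f p = affine_ext f (fst p)"

text \<open>\<open>DL_path S T f g p q l\<close>: there is a piecewise linear path of length \<open>l\<close> from \<open>p\<close> to \<open>q\<close>
  in the space, each piece running inside one edge of the graph, all edges having length one.
  The edge from \<open>(v1, v2)\<close> to \<open>(w1, w2)\<close> is the diagonal segment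
  \<open>t \<mapsto> (edge_pt v1 w1 t, edge_pt v2 w2 t)\<close>.\<close>

inductive DL_path ::
  "'a pair_pre_digraph \<Rightarrow> 'b pair_pre_digraph \<Rightarrow> ('a \<Rightarrow> int) \<Rightarrow> ('b \<Rightarrow> int) \<Rightarrow>
   ('a \<Rightarrow> real) \<times> ('b \<Rightarrow> real) \<Rightarrow> ('a \<Rightarrow> real) \<times> ('b \<Rightarrow> real) \<Rightarrow> real \<Rightarrow> bool"
  for S T f g where
  refl: "p \<in> DL_space S T f g \<Longrightarrow> DL_path S T f g p p 0"
| step: "\<lbrakk>DL_path S T f g p (edge_pt v1 w1 s, edge_pt v2 w2 s) l;
          ((v1, v2), (w1, w2)) \<in> parcs (DL_graph S T f g); s \<in> {0..1}; t \<in> {0..1}\<rbrakk>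
         \<Longrightarrow> DL_path S T f g p (edge_pt v1 w1 t, edge_pt v2 w2 t) (l + \<bar>s - t\<bar>)"

definition DL_dist ::
  "'a pair_pre_digraph \<Rightarrow> 'b pair_pre_digraph \<Rightarrow> ('a \<Rightarrow> int) \<Rightarrow> ('b \<Rightarrow> int) \<Rightarrow>
   ('a \<Rightarrow> real) \<times> ('b \<Rightarrow> real) \<Rightarrow> ('a \<Rightarrow> real) \<times> ('b \<Rightarrow> real) \<Rightarrow> real" where
  "DL_dist S T f g p q = Inf {l. DL_path S T f g p q l}"

end

(* Every quasi-isometry \<phi> of DL(m,n) is itself height respecting. If m = n = 1, level sets are points.
   Otherwise let \<kappa> be the infimum of the slopes such that, for all \<phi> with the given constants, the
   average of dd (\<phi> w) (\<phi> v) over the points v at distance l vertically above (or below) w is at most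
   \<kappa> l + O(1); here dd is twice the distance plus the height difference. By subadditivity there are
   tall trees that almost attain \<kappa>, and subdividing such a tree into three layers shows that the middle
   layer is mapped almost vertically. Comparing the tops and bottoms of the box over an almost extremal
   tree, the whole box is mapped to points whose tops and bottoms have height difference about
   \<kappa> l / 3, i.e. almost by a homothety. If \<kappa> > 3, the image of the box is too large to be coarsely
   covered by the points of the box, so \<kappa> \<le> 3. Conversely, in the direction of
   larger branching max m n, exponential growth forces the average of dd to be at least (3 - o(1)) l,
   since most image points are at distance about l. So every tall box is almost extremal: vertical
   segments of length l are mapped to height differences of at least l / 2, with a sign that is the same
   everywhere. Finally, two points of one level whose images differed much in height would force
   exponentially many points into a neighbourhood of one vertical segment, which grows only linearly. *)

theory Submission
  imports Defs "HOL-Real_Asymp.Real_Asymp"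
begin

section \<open>Box spaces\<close>

definition up_tree ::
  "'z set \<Rightarrow> ('z \<Rightarrow> real) \<Rightarrow> ('z \<Rightarrow> 'z \<Rightarrow> real) \<Rightarrow> ('z \<Rightarrow> 'z \<Rightarrow> real) \<Rightarrow> nat \<Rightarrow> 'z \<Rightarrow> 'z set" where
  "up_tree X h b c r z = {v \<in> X. h v = h z + real r \<and> b z v = h z \<and> c z v = h v}"

definition box_dist :: "('z \<Rightarrow> 'z \<Rightarrow> real) \<Rightarrow> ('z \<Rightarrow> 'z \<Rightarrow> real) \<Rightarrow> 'z \<Rightarrow> 'z \<Rightarrow> real" where
  "box_dist b c z w = c z w - b z w"

definition tilt ::
  "('z \<Rightarrow> real) \<Rightarrow> ('z \<Rightarrow> 'z \<Rightarrow> real) \<Rightarrow> ('z \<Rightarrow> 'z \<Rightarrow> real) \<Rightarrow> 'z \<Rightarrow> 'z \<Rightarrow> real" where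
  "tilt h b c z w = c z w - b z w - \<bar>h z - h w\<bar>"

definition mixed_dist ::
  "('z \<Rightarrow> real) \<Rightarrow> ('z \<Rightarrow> 'z \<Rightarrow> real) \<Rightarrow> ('z \<Rightarrow> 'z \<Rightarrow> real) \<Rightarrow> 'z \<Rightarrow> 'z \<Rightarrow> real" where
  "mixed_dist h b c z w = 4 * (c z w - b z w) - \<bar>h z - h w\<bar>"

lemma flip_simps [simp]:
  "box_dist (\<lambda>z w. - c z w) (\<lambda>z w. - b z w) = box_dist b c"
  "tilt (\<lambda>z. - h z) (\<lambda>z w. - c z w) (\<lambda>z w. - b z w) = tilt h b c"
  "mixed_dist (\<lambda>z. - h z) (\<lambda>z w. - c z w) (\<lambda>z w. - b z w) = mixed_dist h b c"
  by (auto simp: fun_eq_iff box_dist_def tilt_def mixed_dist_def)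

text \<open>The vertex set of a Diestel-Leader graph, seen through three functions: \<open>h\<close> is the height,
  \<open>b z w\<close> the height at which the first coordinates of \<open>z\<close> and \<open>w\<close> meet on their way down, and
  \<open>c z w\<close> the height at which the second coordinates meet on their way up. The combinatorial
  distance is \<open>2 * (c z w - b z w) - \<bar>h z - h w\<bar>\<close>, so \<open>mixed_dist\<close> is twice the distance plus
  \<open>\<bar>h z - h w\<bar>\<close> and satisfies the triangle inequality. All notions are invariant under exchanging
  the two trees, which replaces \<open>h, b, c\<close> by \<open>-h, -c, -b\<close>; \<open>M\<close> is the growth rate.\<close>

locale box_space =
  fixes X :: "'z set" and h :: "'z \<Rightarrow> real" and b c :: "'z \<Rightarrow> 'z \<Rightarrow> real" and m n M :: nat
  assumes m_ge_2: "2 \<le> m" and n_ge_2: "2 \<le> n" and m_le_M: "m \<le> M" and n_le_M: "n \<le> M"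
    and nonempty: "X \<noteq> {}"
    and b_le: "\<And>z w. z \<in> X \<Longrightarrow> w \<in> X \<Longrightarrow> b z w \<le> h z"
    and b_sym: "\<And>z w. z \<in> X \<Longrightarrow> w \<in> X \<Longrightarrow> b z w = b w z"
    and b_refl: "\<And>z. z \<in> X \<Longrightarrow> b z z = h z"
    and b_ultra: "\<And>z w u. z \<in> X \<Longrightarrow> w \<in> X \<Longrightarrow> u \<in> X \<Longrightarrow> min (b z w) (b w u) \<le> b z u"
    and c_ge: "\<And>z w. z \<in> X \<Longrightarrow> w \<in> X \<Longrightarrow> h z \<le> c z w"
    and c_sym: "\<And>z w. z \<in> X \<Longrightarrow> w \<in> X \<Longrightarrow> c z w = c w z"
    and c_refl: "\<And>z. z \<in> X \<Longrightarrow> c z z = h z"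
    and c_ultra: "\<And>z w u. z \<in> X \<Longrightarrow> w \<in> X \<Longrightarrow> u \<in> X \<Longrightarrow> c z u \<le> max (c z w) (c w u)"
    and separated: "\<And>z w. z \<in> X \<Longrightarrow> w \<in> X \<Longrightarrow> b z w = h z \<Longrightarrow> c z w = h z \<Longrightarrow> z = w"
    and h_int: "\<And>z. z \<in> X \<Longrightarrow> h z \<in> \<int>"
    and join: "\<And>w p k. w \<in> X \<Longrightarrow> p \<in> X \<Longrightarrow> k \<in> \<int> \<Longrightarrow> h w \<le> k \<Longrightarrow> k \<le> h p \<Longrightarrow>
      \<exists>g\<in>X. h g = k \<and> b g p = k \<and> c g w = k"
    and card_up: "\<And>z r. z \<in> X \<Longrightarrow> card (up_tree X h b c r z) = m ^ r"
    and card_down: "\<And>z r. z \<in> X \<Longrightarrow>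
      card (up_tree X (\<lambda>z. - h z) (\<lambda>z w. - c z w) (\<lambda>z w. - b z w) r z) = n ^ r"
    and card_ball: "\<And>z r. z \<in> X \<Longrightarrow> finite {w \<in> X. box_dist b c z w \<le> real r} \<and>
      card {w \<in> X. box_dist b c z w \<le> real r} \<le> (r + 1)\<^sup>2 * M ^ r"
begin

abbreviation U :: "nat \<Rightarrow> 'z \<Rightarrow> 'z set" where "U \<equiv> up_tree X h b c"
abbreviation D :: "nat \<Rightarrow> 'z \<Rightarrow> 'z set" where
  "D \<equiv> up_tree X (\<lambda>z. - h z) (\<lambda>z w. - c z w) (\<lambda>z w. - b z w)"
abbreviation rho :: "'z \<Rightarrow> 'z \<Rightarrow> real" where "rho \<equiv> box_dist b c"
abbreviation nu :: "'z \<Rightarrow> 'z \<Rightarrow> real" where "nu \<equiv> tilt h b c"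
abbreviation dd :: "'z \<Rightarrow> 'z \<Rightarrow> real" where "dd \<equiv> mixed_dist h b c"

lemma flip: "box_space X (\<lambda>z. - h z) (\<lambda>z w. - c z w) (\<lambda>z w. - b z w) n m M"
proof
  fix w p k assume *: "w \<in> X" "p \<in> X" "k \<in> \<int>" "- h w \<le> k" "k \<le> - h p"
  then obtain g where "g \<in> X" "h g = - k" "b g w = - k" "c g p = - k"
    using join[of p w "- k"] by auto
  then show "\<exists>g\<in>X. - h g = k \<and> - c g p = k \<and> - b g w = k"
    by (intro bexI[of _ g]) auto
next
  fix z w u assume "z \<in> X" "w \<in> X" "u \<in> X"
  then show "min (- c z w) (- c w u) \<le> - c z u" "- b z u \<le> max (- b z w) (- b w u)"
    using b_ultra[of z w u] c_ultra[of z w u] by linarith+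
qed (use m_ge_2 n_ge_2 m_le_M n_le_M nonempty b_le b_sym b_refl c_ge c_sym c_refl
      separated h_int card_up card_down card_ball in simp_all)

lemma bc:
  assumes "z \<in> X" "w \<in> X"
  shows "b z w \<le> h z" "b z w \<le> h w" "h z \<le> c z w" "h w \<le> c z w" "b w z = b z w" "c w z = c z w"
  using assms b_le[of z w] b_le[of w z] c_ge[of z w] c_ge[of w z] b_sym[of z w] c_sym[of z w] by auto

lemma up_iff: "z \<in> X \<Longrightarrow> v \<in> U r z \<longleftrightarrow> v \<in> X \<and> h v = h z + real r \<and> b z v = h z \<and> c z v = h v"
  by (auto simp: up_tree_def)

lemma down_iff: "z \<in> X \<Longrightarrow> v \<in> D r z \<longleftrightarrow> v \<in> X \<and> h v = h z - real r \<and> b z v = h v \<and> c z v = h z"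
  by (auto simp: up_tree_def)

lemma finite_up: "z \<in> X \<Longrightarrow> finite (U r z)"
  using card_up[of z r] m_ge_2 by (intro card_ge_0_finite) auto

lemma finite_down: "z \<in> X \<Longrightarrow> finite (D r z)"
  using card_down[of z r] n_ge_2 by (intro card_ge_0_finite) auto

lemma up_sub: "U r z \<subseteq> X" "D r z \<subseteq> X" by (auto simp: up_tree_def)

lemma up_down: "z \<in> X \<Longrightarrow> v \<in> X \<Longrightarrow> v \<in> U r z \<longleftrightarrow> z \<in> D r v"
  using bc[of z v] by (auto simp: up_iff down_iff)

lemma up_ne: "z \<in> X \<Longrightarrow> U r z \<noteq> {}"
  using card_up[of z r] m_ge_2 by auto

lemma down_ne: "z \<in> X \<Longrightarrow> D r z \<noteq> {}"
  using card_down[of z r] n_ge_2 by auto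

lemma ultra_cases:
  assumes "z \<in> X" "w \<in> X" "u \<in> X"
  shows "b z w \<le> b z u \<or> b w u \<le> b z u" "c z u \<le> c z w \<or> c z u \<le> c w u"
  using b_ultra[OF assms] c_ultra[OF assms] by linarith+

lemma eq_if:
  assumes "z \<in> X" "w \<in> X" "h z = h w" "h z \<le> b z w" "c z w \<le> h z" shows "z = w"
  using assms bc[OF assms(1,2)] by (intro separated) linarith+

lemma up_trans:
  assumes "z \<in> X" "w \<in> U r z" "v \<in> U s w" shows "v \<in> U (r + s) z"
proof -
  have X: "w \<in> X" "v \<in> X" using assms up_sub by blast+
  have "h w = h z + real r" "b z w = h z" "c z w = h w" "h v = h w + real s" "b w v = h w" "c w v = h v"
    using assms(2,3) unfolding up_iff[OF assms(1)] up_iff[OF X(1)] by simp_all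
  then show ?thesis
    using X(2) ultra_cases(1)[OF assms(1) X] ultra_cases(2)[OF assms(1) X] bc[OF assms(1) X(2)]
    unfolding up_iff[OF assms(1)] of_nat_add by linarith
qed

lemma up_split:
  assumes "z \<in> X" "v \<in> U (r + s) z" obtains w where "w \<in> U r z" "v \<in> U s w"
proof -
  have v: "v \<in> X" using assms up_sub by blast
  have vz: "h v = h z + real r + real s" "b z v = h z" "c z v = h v"
    using assms(2) unfolding up_iff[OF assms(1)] by simp_all
  then obtain w where w: "w \<in> X" "h w = h z + real r" "b w v = h z + real r" "c w z = h z + real r"
    using join[OF assms(1) v, of "h z + real r"] h_int[OF assms(1)] by force
  have "w \<in> U r z"
    using w vz ultra_cases(1)[OF assms(1) v w(1)] bc[OF assms(1) w(1)] bc[OF v w(1)]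
    unfolding up_iff[OF assms(1)] by linarith
  moreover have "v \<in> U s w"
    using w v vz ultra_cases(2)[OF w(1) assms(1) v] bc[OF w(1) v]
    unfolding up_iff[OF w(1)] by linarith
  ultimately show ?thesis using that by blast
qed

lemma up_disj:
  assumes "z \<in> X" "w \<in> U r z" "w' \<in> U r z" "v \<in> U s w" "v \<in> U s w'" shows "w = w'"
proof -
  have X: "w \<in> X" "w' \<in> X" "v \<in> X" using assms up_sub by blast+
  have *: "h w = h z + real r" "b w v = h w" "c z w = h w" "h w' = h z + real r" "b w' v = h w'" "c z w' = h w'"
    using assms(2-5) unfolding up_iff[OF assms(1)] up_iff[OF X(1)] up_iff[OF X(2)] by blast+
  have "h w \<le> b w w'"
    using ultra_cases(1)[OF X(1,3,2)] * bc(5)[OF X(2,3)] by linarith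
  moreover have "c w w' \<le> h w"
    using ultra_cases(2)[OF X(1) assms(1) X(2)] * bc(6)[OF assms(1) X(1)] by linarith
  ultimately show ?thesis using eq_if[OF X(1,2)] *(1,4) by simp
qed

lemma up_UN:
  assumes "z \<in> X" shows "U (r + s) z = (\<Union>w\<in>U r z. U s w)"
proof (intro set_eqI iffI)
  fix v assume "v \<in> U (r + s) z"
  then obtain w where "w \<in> U r z" "v \<in> U s w" by (rule up_split[OF assms])
  then show "v \<in> (\<Union>w\<in>U r z. U s w)" by blast
next
  fix v assume "v \<in> (\<Union>w\<in>U r z. U s w)"
  then obtain w where "w \<in> U r z" "v \<in> U s w" by blast
  then show "v \<in> U (r + s) z" by (rule up_trans[OF assms])
qed

lemma sum_up:
  assumes "z \<in> X"
  shows "(\<Sum>v\<in>U (r + s) z. g v) = (\<Sum>w\<in>U r z. \<Sum>v\<in>U s w. g v)"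
  unfolding up_UN[OF assms]
proof (rule sum.UNION_disjoint)
  show "finite (U r z)" by (rule finite_up[OF assms])
  show "\<forall>i\<in>U r z. finite (U s i)" using finite_up up_sub by blast
  show "\<forall>i\<in>U r z. \<forall>j\<in>U r z. i \<noteq> j \<longrightarrow> U s i \<inter> U s j = {}"
    using up_disj[OF assms] by blast
qed

lemma dd_tri:
  assumes "z \<in> X" "w \<in> X" "u \<in> X" shows "dd z u \<le> dd z w + dd w u"
  unfolding mixed_dist_def using b_ultra[OF assms] c_ultra[OF assms] bc(1-4)[OF assms(1,2)] bc(1-4)[OF assms(2,3)]
  by argo

lemma rho_ge: "z \<in> X \<Longrightarrow> w \<in> X \<Longrightarrow> \<bar>h z - h w\<bar> \<le> rho z w"
  using bc[of z w] unfolding box_dist_def by linarith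

lemma rho_tri:
  assumes "z \<in> X" "w \<in> X" "u \<in> X" shows "rho z u \<le> rho z w + rho w u"
  unfolding box_dist_def using ultra_cases[OF assms] bc[OF assms(1,2)] bc[OF assms(2,3)] bc[OF assms(1,3)]
  by (elim disjE) linarith+

lemma rho_sym: "z \<in> X \<Longrightarrow> w \<in> X \<Longrightarrow> rho z w = rho w z"
  using bc[of z w] unfolding box_dist_def by simp

lemma nu_nonneg: "z \<in> X \<Longrightarrow> w \<in> X \<Longrightarrow> 0 \<le> nu z w"
  using rho_ge[of z w] unfolding box_dist_def tilt_def by simp

lemma dd_eq: "dd z w = 3 * \<bar>h z - h w\<bar> + 4 * nu z w" "dd z w = 3 * rho z w + nu z w"
  unfolding box_dist_def tilt_def mixed_dist_def by simp_all

lemma dd_le: "z \<in> X \<Longrightarrow> w \<in> X \<Longrightarrow> dd z w \<le> 4 * rho z w"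
  unfolding box_dist_def mixed_dist_def by simp

lemma up_common:
  assumes "z \<in> X" "w \<in> X" "h z = h w" "h z \<le> b z w" "c z w \<le> h z + real r"
  shows "U r z = U r w"
proof -
  have *: "u \<in> U r w" if "z \<in> X" "w \<in> X" "h z = h w" "h z \<le> b z w" "c z w \<le> h z + real r" "u \<in> U r z" for z w u
  proof -
    have uX: "u \<in> X" using that up_sub by blast
    have u: "h u = h z + real r" "b z u = h z" "c z u = h u"
      using that(6) unfolding up_iff[OF that(1)] by blast+
    have "h w \<le> b w u" using ultra_cases(1)[OF that(2,1) uX] u that(3,4) bc(5)[OF that(1,2)] by linarith
    moreover have "c w u \<le> h u" using ultra_cases(2)[OF that(2,1) uX] u that(3,5) bc(6)[OF that(1,2)] by linarith
    ultimately show ?thesis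
      using uX u(1) that(3) bc(1,4)[OF that(2) uX] unfolding up_iff[OF that(2)] by linarith
  qed
  show ?thesis using *[OF assms] *[OF assms(2,1)] assms bc(5,6)[OF assms(1,2)] by auto
qed

lemma down_tops:
  assumes "w \<in> X" "v \<in> U l w" "p \<in> D l v" shows "U l p = U l w"
proof (rule up_common)
  show X: "p \<in> X" "w \<in> X" using assms up_sub by blast+
  have v: "v \<in> X" using assms up_sub by blast
  have *: "h v = h p + real l" "b p v = h p" "c p v = h v" "h v = h w + real l" "b w v = h w" "c w v = h v"
    using assms(2) up_down[OF X(1) v, of l] assms(3) unfolding up_iff[OF X(1)] up_iff[OF X(2)] by blast+
  show "h p = h w" using *(1,4) by simp
  show "h p \<le> b p w" using ultra_cases(1)[OF X(1) v X(2)] * bc(5)[OF X(2) v] by linarith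
  show "c p w \<le> h p + real l" using ultra_cases(2)[OF X(1) v X(2)] * bc(6)[OF X(2) v] by linarith
qed

lemma connect:
  assumes "z \<in> X" "w \<in> X"
  obtains r s t u v x where "u \<in> D r z" "v \<in> D s w" "x \<in> U t u" "x \<in> U t v"
    "real r \<le> rho z w + 1" "real s \<le> rho z w + 1" "real t \<le> rho z w + 2"
proof -
  define k where "k = \<lfloor>b z w\<rfloor>"
  obtain iz iw where i: "h z = of_int iz" "h w = of_int iw" using h_int assms by (metis Ints_cases)
  have k: "real_of_int k \<le> b z w" "b z w < real_of_int k + 1" by (simp_all add: k_def)
  have kz: "k \<le> iz" "k \<le> iw" using k bc[OF assms] i by linarith+
  obtain u where u: "u \<in> D (nat (iz - k)) z" using down_ne assms by blast
  obtain v where v: "v \<in> D (nat (iw - k)) w" using down_ne assms by blast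
  have X: "u \<in> X" "v \<in> X" using u v up_sub by blast+
  have hu: "h u = k" "b z u = k" "c z u = h z" using u assms i kz by (auto simp: down_iff)
  have hv: "h v = k" "b w v = k" "c w v = h w" using v assms i kz by (auto simp: down_iff)
  have "k \<le> b u v"
    using ultra_cases(1)[OF X(1) assms(1) X(2)] ultra_cases(1)[OF assms X(2)] k hu hv bc[OF X(1) assms(1)] by linarith
  moreover define t where "t = nat \<lceil>c u v - h u\<rceil>"
  have t: "c u v \<le> h u + real t" "real t < c u v - h u + 1"
    using bc(3)[OF X] unfolding t_def by linarith+
  ultimately have "U t u = U t v" using up_common[OF X] hu hv by auto
  moreover have "c u v \<le> c z w"
    using ultra_cases(2)[OF X(1) assms(1) X(2)] ultra_cases(2)[OF assms X(2)] hu hv bc[OF X(1) assms(1)]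
      bc[OF assms] by linarith
  then have "real t \<le> rho z w + 2" using t k hu unfolding box_dist_def by linarith
  moreover have "real (nat (iz - k)) \<le> rho z w + 1" "real (nat (iw - k)) \<le> rho z w + 1"
    using kz i k bc[OF assms] unfolding box_dist_def by linarith+
  ultimately show ?thesis using that[OF u v] up_ne[OF X(1)] by blast
qed

end

definition quasi_iso :: "real \<Rightarrow> 'z set \<Rightarrow> ('z \<Rightarrow> 'z \<Rightarrow> real) \<Rightarrow> 'y set \<Rightarrow> ('y \<Rightarrow> 'y \<Rightarrow> real) \<Rightarrow> ('z \<Rightarrow> 'y) \<Rightarrow> bool" where
  "quasi_iso L X d Y d' \<phi> \<longleftrightarrow> L \<ge> 1 \<and> \<phi> \<in> X \<rightarrow> Y \<and>
     (\<forall>z\<in>X. \<forall>w\<in>X. d' (\<phi> z) (\<phi> w) \<le> L * d z w + L \<and> d z w \<le> L * d' (\<phi> z) (\<phi> w) + L) \<and>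
     (\<forall>y\<in>Y. \<exists>z\<in>X. d' y (\<phi> z) \<le> L)"

section \<open>Images of tall trees\<close>

lemma markov_count:
  assumes "finite A" "\<And>x. x \<in> A \<Longrightarrow> 0 \<le> g x" "\<And>x. x \<in> A \<Longrightarrow> P x \<Longrightarrow> t \<le> g x"
  shows "t * real (card {x \<in> A. P x}) \<le> sum g A"
proof -
  have "t * real (card {x \<in> A. P x}) = (\<Sum>x\<in>{x \<in> A. P x}. t)" by simp
  also have "\<dots> \<le> (\<Sum>x\<in>{x \<in> A. P x}. g x)" by (rule sum_mono) (use assms in auto)
  also have "\<dots> \<le> sum g A" by (rule sum_mono2) (use assms in auto)
  finally show ?thesis .
qed

lemma exists_le_average:
  fixes g :: "'i \<Rightarrow> real"
  assumes "finite A" "A \<noteq> {}" "sum g A \<le> B * real (card A)"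
  obtains x where "x \<in> A" "g x \<le> B"
proof -
  have "\<exists>x\<in>A. g x \<le> B"
  proof (rule ccontr)
    assume "\<not> ?thesis"
    then have "(\<Sum>x\<in>A. B) < sum g A" using assms by (intro sum_strict_mono) auto
    then show False using assms(3) by (simp add: mult.commute)
  qed
  then show ?thesis using that by blast
qed

definition ball_bound :: "nat \<Rightarrow> real \<Rightarrow> real" where
  "ball_bound M R = (R + 2)\<^sup>2 * real M powr (R + 1)"

context box_space
begin

lemma M_ge_2: "2 \<le> M" using m_ge_2 m_le_M by simp

lemma card_ball_real:
  assumes "z \<in> X" "0 \<le> R" "A \<subseteq> {w \<in> X. rho z w \<le> R}"
  shows "finite A" "real (card A) \<le> ball_bound M R"
proof -
  define r where "r = nat \<lceil>R\<rceil>"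
  have r: "R \<le> real r" "real r \<le> R + 1" using assms(2) unfolding r_def by linarith+
  have sub: "A \<subseteq> {w \<in> X. rho z w \<le> real r}" using assms(3) r by auto
  show "finite A" using sub card_ball[OF assms(1), of r] finite_subset by blast
  have "card A \<le> (r + 1)\<^sup>2 * M ^ r"
    using card_mono[OF _ sub] card_ball[OF assms(1), of r] by linarith
  then have "real (card A) \<le> real ((r + 1)\<^sup>2 * M ^ r)" by (rule of_nat_mono)
  then have "real (card A) \<le> (real r + 1)\<^sup>2 * real M ^ r" by (simp add: add.commute)
  also have "\<dots> \<le> (R + 2)\<^sup>2 * real M powr (R + 1)"
  proof (rule mult_mono)
    show "(real r + 1)\<^sup>2 \<le> (R + 2)\<^sup>2" using r assms(2) by (intro power_mono) auto
    have "real M ^ r = real M powr real r" using M_ge_2 by (simp add: powr_realpow)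
    also have "\<dots> \<le> real M powr (R + 1)" using r M_ge_2 by (intro powr_mono) auto
    finally show "real M ^ r \<le> real M powr (R + 1)" .
  qed auto
  finally show "real (card A) \<le> ball_bound M R" by (simp add: ball_bound_def)
qed

end

lemma ball_bound_nonneg: "0 \<le> ball_bound M R"
  by (simp add: ball_bound_def)

locale box_pair =
  A: box_space X h b c m n M + B: box_space Y h' b' c' m' n' M
  for X :: "'z set" and h b c m n and Y :: "'y set" and h' b' c' m' n' and M
begin

abbreviation qi :: "real \<Rightarrow> ('z \<Rightarrow> 'y) \<Rightarrow> bool" where
  "qi L \<phi> \<equiv> quasi_iso L X A.rho Y B.rho \<phi>"

lemma qiD:
  assumes "qi L \<phi>"
  shows "1 \<le> L" "z \<in> X \<Longrightarrow> \<phi> z \<in> Y"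
    "z \<in> X \<Longrightarrow> w \<in> X \<Longrightarrow> B.rho (\<phi> z) (\<phi> w) \<le> L * A.rho z w + L"
    "z \<in> X \<Longrightarrow> w \<in> X \<Longrightarrow> A.rho z w \<le> L * B.rho (\<phi> z) (\<phi> w) + L"
    "y \<in> Y \<Longrightarrow> \<exists>z\<in>X. B.rho y (\<phi> z) \<le> L"
proof -
  have *: "1 \<le> L" "\<phi> \<in> X \<rightarrow> Y" "\<forall>z\<in>X. \<forall>w\<in>X. B.rho (\<phi> z) (\<phi> w) \<le> L * A.rho z w + L \<and>
      A.rho z w \<le> L * B.rho (\<phi> z) (\<phi> w) + L" "\<forall>y\<in>Y. \<exists>z\<in>X. B.rho y (\<phi> z) \<le> L"
    using assms unfolding quasi_iso_def by simp_all
  show "1 \<le> L" by (rule *(1))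
  show "z \<in> X \<Longrightarrow> \<phi> z \<in> Y" using *(2) by (simp add: Pi_iff)
  show "z \<in> X \<Longrightarrow> w \<in> X \<Longrightarrow> B.rho (\<phi> z) (\<phi> w) \<le> L * A.rho z w + L" using *(3) by blast
  show "z \<in> X \<Longrightarrow> w \<in> X \<Longrightarrow> A.rho z w \<le> L * B.rho (\<phi> z) (\<phi> w) + L" using *(3) by blast
  show "y \<in> Y \<Longrightarrow> \<exists>z\<in>X. B.rho y (\<phi> z) \<le> L" using *(4) by blast
qed

lemma card_close:
  assumes "qi L \<phi>" "A \<subseteq> X" "g \<in> Y" "\<And>z. z \<in> A \<Longrightarrow> B.rho (\<phi> z) g \<le> R" "0 \<le> R"
  shows "finite A" "real (card A) \<le> ball_bound M (2 * L * R + L)"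
proof -
  have "finite A \<and> real (card A) \<le> ball_bound M (2 * L * R + L)"
  proof (cases "A = {}")
    case True
    then show ?thesis by (simp add: ball_bound_nonneg)
  next
    case False
    then obtain z where z: "z \<in> A" by blast
    have "A.rho z w \<le> 2 * L * R + L" if "w \<in> A" for w
    proof -
      have X: "z \<in> X" "w \<in> X" using z that assms(2) by auto
      have "B.rho (\<phi> z) (\<phi> w) \<le> 2 * R"
        using B.rho_tri[OF qiD(2)[OF assms(1) X(1)] assms(3) qiD(2)[OF assms(1) X(2)]]
          B.rho_sym[OF assms(3) qiD(2)[OF assms(1) X(2)]] assms(4)[OF z] assms(4)[OF that] by linarith
      then have "L * B.rho (\<phi> z) (\<phi> w) \<le> L * (2 * R)" using qiD(1)[OF assms(1)] by (intro mult_left_mono) auto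
      then show ?thesis using qiD(4)[OF assms(1) X] by (simp add: algebra_simps)
    qed
    then have sub: "A \<subseteq> {w \<in> X. A.rho z w \<le> 2 * L * R + L}" using assms(2) by auto
    have nn: "0 \<le> 2 * L * R + L" using qiD(1)[OF assms(1)] assms(5) by simp
    show ?thesis using A.card_ball_real[OF _ nn sub] z assms(2) by auto
  qed
  then show "finite A" "real (card A) \<le> ball_bound M (2 * L * R + L)" by auto
qed

lemma card_near_segment:
  assumes qi: "qi L \<phi>" and Y: "w \<in> Y" "p \<in> Y" and \<alpha>: "0 \<le> \<alpha>" and R: "0 \<le> R" and KX: "K \<subseteq> X"
    and K: "\<And>u. u \<in> K \<Longrightarrow> \<exists>i\<le>nat \<lfloor>\<alpha>\<rfloor>. \<exists>g\<in>Y. h' g = h' w + real i \<and> b' g p = h' w + real i \<and>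
      c' g w = h' w + real i \<and> B.rho (\<phi> u) g \<le> R"
  shows "real (card K) \<le> (\<alpha> + 1) * ball_bound M (2 * L * R + L)"
proof -
  define H where "H = h' w"
  define G where "G i = {u \<in> K. \<exists>g\<in>Y. h' g = H + real i \<and> b' g p = H + real i \<and>
    c' g w = H + real i \<and> B.rho (\<phi> u) g \<le> R}" for i
  have KG: "K = (\<Union>i\<in>{..nat \<lfloor>\<alpha>\<rfloor>}. G i)" using K unfolding G_def H_def by blast
  have G: "real (card (G i)) \<le> ball_bound M (2 * L * R + L)" for i
  proof (cases "G i = {}")
    case True then show ?thesis by (simp add: ball_bound_nonneg)
  next
    case False
    then obtain g where g: "g \<in> Y" "h' g = H + real i" "b' g p = H + real i" "c' g w = H + real i"
      unfolding G_def by blast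
    have "B.rho (\<phi> u) g \<le> R" if uG: "u \<in> G i" for u
    proof -
      obtain g' where g': "g' \<in> Y" "h' g' = H + real i" "b' g' p = H + real i" "c' g' w = H + real i"
        "B.rho (\<phi> u) g' \<le> R" using uG unfolding G_def by blast
      have "h' g \<le> b' g g'" using B.ultra_cases(1)[OF g(1) Y(2) g'(1)] g g' B.bc(5)[OF g'(1) Y(2)] by linarith
      moreover have "c' g g' \<le> h' g"
        using B.ultra_cases(2)[OF g(1) Y(1) g'(1)] g g' B.bc(6)[OF g'(1) Y(1)] by linarith
      ultimately have "g = g'" using B.eq_if[OF g(1) g'(1)] g g' by simp
      then show ?thesis using g'(5) by simp
    qed
    moreover have "G i \<subseteq> X" using KX unfolding G_def by blast
    ultimately show ?thesis using card_close(2)[OF qi _ g(1), of "G i" R] R by blast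
  qed
  have "real (card K) \<le> (\<Sum>i\<le>nat \<lfloor>\<alpha>\<rfloor>. real (card (G i)))"
    unfolding KG using card_UN_le[of "{..nat \<lfloor>\<alpha>\<rfloor>}" G]
    by (metis finite_atMost of_nat_mono of_nat_sum)
  also have "\<dots> \<le> (\<Sum>i\<le>nat \<lfloor>\<alpha>\<rfloor>. ball_bound M (2 * L * R + L))" by (intro sum_mono G)
  also have "\<dots> = (real (nat \<lfloor>\<alpha>\<rfloor>) + 1) * ball_bound M (2 * L * R + L)" by simp
  also have "\<dots> \<le> (\<alpha> + 1) * ball_bound M (2 * L * R + L)"
    using \<alpha> by (intro mult_right_mono ball_bound_nonneg) linarith
  finally show ?thesis .
qed

lemma few_ahead:
  assumes qi: "qi L \<phi>" and w: "w \<in> X" and s: "s \<le> l" "L * real s + L \<le> \<alpha>" and t: "0 < t"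
    and s1: "(\<Sum>u\<in>A.U s w. B.dd (\<phi> w) (\<phi> u)) \<le> (\<kappa> * real s + e) * real m ^ s"
    and s2: "\<And>u. u \<in> A.U s w \<Longrightarrow>
      (\<Sum>v\<in>A.U (l - s) u. B.dd (\<phi> u) (\<phi> v)) \<le> (\<kappa> * real (l - s) + e) * real m ^ (l - s)"
    and s3: "(\<Sum>v\<in>A.U l w. B.dd (\<phi> w) (\<phi> v)) \<ge> (\<kappa> * real l - e) * real m ^ l"
    and s4: "(\<Sum>v\<in>A.U l w. B.nu (\<phi> w) (\<phi> v)) \<le> e * real m ^ l"
    and p: "p \<in> Y"
  shows "t * real (card {v \<in> A.U l w. h' (\<phi> w) + \<alpha> \<le> b' p (\<phi> v)}) \<le>
    4 * e * real m ^ l + t * ((\<alpha> + 1) * ball_bound M (8 * L * t + L) * real m ^ (l - s))"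
proof -
  define H where "H = h' (\<phi> w)"
  define K where "K = {u \<in> A.U s w. \<exists>i\<le>nat \<lfloor>\<alpha>\<rfloor>. \<exists>g\<in>Y. h' g = H + real i \<and> b' g p = H + real i \<and>
    c' g (\<phi> w) = H + real i \<and> B.rho (\<phi> u) g \<le> 4 * t}"
  have wY: "\<phi> w \<in> Y" using qiD(2)[OF qi w] .
  have L1: "1 \<le> L" using qiD(1)[OF qi] .
  have a0: "0 \<le> \<alpha>" using s(2) L1 by (smt (verit) mult_nonneg_nonneg of_nat_0_le_iff)
  have UX: "A.U r z \<subseteq> X" for r z using A.up_sub(1) .
  have fin: "finite (A.U r z)" if "z \<in> X" for r z using A.finite_up[OF that] .
  have key: "t \<le> B.dd (\<phi> w) (\<phi> u) + B.dd (\<phi> u) (\<phi> v) - B.dd (\<phi> w) (\<phi> v) + B.nu (\<phi> w) (\<phi> v)"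
    if u: "u \<in> A.U s w" and v: "v \<in> A.U (l - s) u" and bp: "H + \<alpha> \<le> b' p (\<phi> v)" and uK: "u \<notin> K" for u v
  proof (rule ccontr)
    assume "\<not> ?thesis"
    then have lt: "B.dd (\<phi> w) (\<phi> u) + B.dd (\<phi> u) (\<phi> v) - B.dd (\<phi> w) (\<phi> v) + B.nu (\<phi> w) (\<phi> v) < t" by simp
    have X: "u \<in> X" "v \<in> X" using u v UX by blast+
    have Y: "\<phi> u \<in> Y" "\<phi> v \<in> Y" using X qiD(2)[OF qi] by blast+
    have hu: "h u = h w + real s" "b w u = h w" "c w u = h u" using u unfolding A.up_iff[OF w] by blast+
    have "A.rho w u = real s" using hu by (simp add: box_dist_def)
    then have r: "B.rho (\<phi> w) (\<phi> u) \<le> \<alpha>" using qiD(3)[OF qi w X(1)] s(2) by simp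
    define x where "x = h' (\<phi> u)"
    define y where "y = h' (\<phi> v)"
    have y: "H + \<alpha> \<le> y" using bp B.bc(2)[OF p Y(2)] unfolding y_def by linarith
    have x: "\<bar>H - x\<bar> \<le> \<alpha>" using B.rho_ge[OF wY Y(1)] r unfolding H_def x_def by linarith
    define n1 where "n1 = B.nu (\<phi> w) (\<phi> u)"
    define n2 where "n2 = B.nu (\<phi> u) (\<phi> v)"
    define n0 where "n0 = B.nu (\<phi> w) (\<phi> v)"
    have nn: "0 \<le> n1" "0 \<le> n2" "0 \<le> n0" unfolding n0_def n1_def n2_def using B.nu_nonneg wY Y by auto
    have tri: "B.dd (\<phi> w) (\<phi> v) \<le> B.dd (\<phi> w) (\<phi> u) + B.dd (\<phi> u) (\<phi> v)" by (rule B.dd_tri[OF wY Y])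
    have e1: "B.dd (\<phi> w) (\<phi> u) = 3 * \<bar>H - x\<bar> + 4 * n1" unfolding H_def x_def n1_def B.dd_eq(1) by simp
    have e2: "B.dd (\<phi> u) (\<phi> v) = 3 * (y - x) + 4 * n2" using x y unfolding y_def x_def n2_def B.dd_eq(1) by simp
    have e3: "B.dd (\<phi> w) (\<phi> v) = 3 * (y - H) + 4 * n0" using a0 y unfolding H_def y_def n0_def B.dd_eq(1) by simp
    have le: "3 * (\<bar>H - x\<bar> + H - x) + 4 * n1 + 4 * n2 \<le> 4 * t"
      using lt tri nn unfolding e1 e2 e3 n0_def[symmetric] by argo
    have abs: "H - x \<le> \<bar>H - x\<bar>" "x - H \<le> \<bar>H - x\<bar>" using abs_ge_self[of "H - x"] abs_ge_minus_self[of "H - x"] by simp_all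
    have xH: "H - t \<le> x" using le nn abs t by argo
    have n1: "n1 \<le> t" using le nn abs by argo
    have n2: "n2 \<le> t" using le nn abs by argo
    have xy: "x \<le> y" using x y by linarith
    have b1: "x - t \<le> b' (\<phi> u) (\<phi> v)"
      using n2 xy B.bc(4)[OF Y] unfolding n2_def tilt_def x_def[symmetric] y_def[symmetric] by linarith
    have c1: "c' (\<phi> w) (\<phi> u) \<le> max H x + t"
      using n1 B.bc(1,2)[OF wY Y(1)] unfolding n1_def tilt_def H_def[symmetric] x_def[symmetric] by argo
    define k where "k = max H x"
    have kI: "k \<in> \<int>" unfolding k_def H_def x_def using B.h_int wY Y by (auto simp: max_def)
    have k: "H \<le> k" "x \<le> k" "k \<le> H + \<alpha>" using x a0 unfolding k_def by linarith+
    obtain g where g: "g \<in> Y" "h' g = k" "b' g p = k" "c' g (\<phi> w) = k"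
      using B.join[OF wY p kI] k y bp B.bc(1)[OF p Y(2)] unfolding H_def[symmetric] by force
    obtain kk Hk where kk: "k = of_int kk" "H = of_int Hk"
      using kI B.h_int[OF wY] unfolding H_def by (auto elim!: Ints_cases)
    define i where "i = nat (kk - Hk)"
    have i: "k = H + real i" using kk k unfolding i_def by simp
    have ia: "i \<le> nat \<lfloor>\<alpha>\<rfloor>" using i k by (simp add: le_nat_floor)
    have bb: "x - t \<le> b' (\<phi> u) g"
    proof -
      have "x - t \<le> b' (\<phi> u) p"
        using B.ultra_cases(1)[OF Y p] b1 bp x B.bc(5)[OF p Y(2)] t by linarith
      then show ?thesis using B.ultra_cases(1)[OF Y(1) p g(1)] B.bc(5)[OF g(1) p] g(3) k t by linarith
    qed
    have cc: "c' (\<phi> u) g \<le> k + t"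
      using B.ultra_cases(2)[OF Y(1) wY g(1)] c1 g(4) B.bc(6)[OF wY Y(1)] B.bc(6)[OF g(1) wY] t
      unfolding k_def by argo
    have "k - x \<le> t" using xH t unfolding k_def by argo
    then have "B.rho (\<phi> u) g \<le> 4 * t" using bb cc t unfolding box_dist_def by linarith
    then have "u \<in> K" unfolding K_def using u g i ia by auto
    then show False using uK by blast
  qed
  have cardK: "real (card K) \<le> (\<alpha> + 1) * ball_bound M (8 * L * t + L)"
  proof -
    have "real (card K) \<le> (\<alpha> + 1) * ball_bound M (2 * L * (4 * t) + L)"
    proof (rule card_near_segment[OF qi wY p a0])
      show "K \<subseteq> X" using UX unfolding K_def by blast
    qed (use t in \<open>auto simp: K_def H_def\<close>)
    also have "2 * L * (4 * t) + L = 8 * L * t + L" by simp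
    finally show ?thesis .
  qed
  define I where "I = {v \<in> A.U l w. H + \<alpha> \<le> b' p (\<phi> v)}"
  define F where "F u v = B.dd (\<phi> w) (\<phi> u) + B.dd (\<phi> u) (\<phi> v) - B.dd (\<phi> w) (\<phi> v) + B.nu (\<phi> w) (\<phi> v)" for u v
  have split: "(\<Sum>v\<in>A.U l w. g v) = (\<Sum>u\<in>A.U s w. \<Sum>v\<in>A.U (l - s) u. g v)" for g :: "'z \<Rightarrow> real"
    using A.sum_up[OF w, of g s "l - s"] s(1) by simp
  have cU: "real (card (A.U r z)) = real m ^ r" if "z \<in> X" for r z using A.card_up[OF that] by simp
  have cU': "card (A.U (l - s) u) = m ^ (l - s)" if "u \<in> A.U s w" for u
    using that UX A.card_up by blast
  have "t * real (card I) = (\<Sum>v\<in>A.U l w. t * of_bool (v \<in> I))"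
    using fin[OF w] unfolding I_def by (simp add: sum_distrib_left[symmetric] Int_def)
  also have "\<dots> = (\<Sum>u\<in>A.U s w. \<Sum>v\<in>A.U (l - s) u. t * of_bool (v \<in> I))" by (rule split)
  also have "\<dots> \<le> (\<Sum>u\<in>A.U s w. \<Sum>v\<in>A.U (l - s) u. F u v + t * of_bool (u \<in> K))"
  proof (intro sum_mono)
    fix u v assume uv: "u \<in> A.U s w" "v \<in> A.U (l - s) u"
    have X: "u \<in> X" "v \<in> X" using uv UX by blast+
    have "0 \<le> F u v"
      unfolding F_def using B.dd_tri[OF wY qiD(2)[OF qi X(1)] qiD(2)[OF qi X(2)]]
        B.nu_nonneg[OF wY qiD(2)[OF qi X(2)]] by linarith
    then show "t * of_bool (v \<in> I) \<le> F u v + t * of_bool (u \<in> K)"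
      using key[OF uv] t unfolding F_def[symmetric] I_def by (cases "u \<in> K") auto
  qed
  also have "\<dots> = (\<Sum>u\<in>A.U s w. \<Sum>v\<in>A.U (l - s) u. F u v) + (\<Sum>u\<in>A.U s w. \<Sum>v\<in>A.U (l - s) u. t * of_bool (u \<in> K))"
    by (simp add: sum.distrib)
  also have "(\<Sum>u\<in>A.U s w. \<Sum>v\<in>A.U (l - s) u. t * of_bool (u \<in> K)) = t * real (card K) * real m ^ (l - s)"
  proof -
    have "(\<Sum>u\<in>A.U s w. \<Sum>v\<in>A.U (l - s) u. t * of_bool (u \<in> K)) =
        (\<Sum>u\<in>A.U s w. t * real m ^ (l - s) * of_bool (u \<in> K))"
      by (intro sum.cong HOL.refl) (simp add: cU')
    also have "\<dots> = t * real m ^ (l - s) * real (card K)"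
      using fin[OF w] unfolding K_def by (simp add: sum_distrib_left[symmetric] Int_def)
    finally show ?thesis by simp
  qed
  also have "(\<Sum>u\<in>A.U s w. \<Sum>v\<in>A.U (l - s) u. F u v) \<le> 4 * e * real m ^ l"
  proof -
    have "(\<Sum>u\<in>A.U s w. \<Sum>v\<in>A.U (l - s) u. F u v) =
      (\<Sum>u\<in>A.U s w. real m ^ (l - s) * B.dd (\<phi> w) (\<phi> u)) + (\<Sum>u\<in>A.U s w. \<Sum>v\<in>A.U (l - s) u. B.dd (\<phi> u) (\<phi> v))
       - (\<Sum>v\<in>A.U l w. B.dd (\<phi> w) (\<phi> v)) + (\<Sum>v\<in>A.U l w. B.nu (\<phi> w) (\<phi> v))"
      unfolding split F_def sum.distrib sum_subtractf
      by (simp add: cU')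
    also have "(\<Sum>u\<in>A.U s w. real m ^ (l - s) * B.dd (\<phi> w) (\<phi> u)) \<le> (\<kappa> * real s + e) * real m ^ l"
    proof -
      have "(\<Sum>u\<in>A.U s w. real m ^ (l - s) * B.dd (\<phi> w) (\<phi> u)) = real m ^ (l - s) * (\<Sum>u\<in>A.U s w. B.dd (\<phi> w) (\<phi> u))"
        by (simp add: sum_distrib_left)
      also have "\<dots> \<le> real m ^ (l - s) * ((\<kappa> * real s + e) * real m ^ s)"
        by (intro mult_left_mono s1) auto
      also have "\<dots> = (\<kappa> * real s + e) * real m ^ l"
        using s(1) by (simp add: power_add[symmetric] mult.commute mult.left_commute)
      finally show ?thesis .
    qed
    also have "(\<Sum>u\<in>A.U s w. \<Sum>v\<in>A.U (l - s) u. B.dd (\<phi> u) (\<phi> v)) \<le> (\<kappa> * real (l - s) + e) * real m ^ l"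
    proof -
      have "(\<Sum>u\<in>A.U s w. \<Sum>v\<in>A.U (l - s) u. B.dd (\<phi> u) (\<phi> v)) \<le> (\<Sum>u\<in>A.U s w. (\<kappa> * real (l - s) + e) * real m ^ (l - s))"
        by (intro sum_mono s2)
      also have "\<dots> = (\<kappa> * real (l - s) + e) * real m ^ l"
        using s(1) cU[OF w] by (simp add: power_add[symmetric] mult.left_commute)
      finally show ?thesis .
    qed
    finally have "(\<Sum>u\<in>A.U s w. \<Sum>v\<in>A.U (l - s) u. F u v) \<le> (\<kappa> * real s + e) * real m ^ l +
      (\<kappa> * real (l - s) + e) * real m ^ l - (\<kappa> * real l - e) * real m ^ l + e * real m ^ l"
      using s3 s4 by linarith
    also have "\<dots> = 4 * e * real m ^ l" using s(1) by (simp add: of_nat_diff algebra_simps)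
    finally show ?thesis .
  qed
  also have "t * real (card K) * real m ^ (l - s) \<le> t * ((\<alpha> + 1) * ball_bound M (8 * L * t + L) * real m ^ (l - s))"
    using mult_left_mono[OF mult_right_mono[OF cardK, of "real m ^ (l - s)"], of t] t by (simp add: mult.assoc)
  finally show ?thesis unfolding I_def H_def by simp
qed

end

lemma exp_beats_cubic:
  fixes a K \<eta> :: real
  assumes "0 < a" "0 < \<eta>"
  shows "\<exists>l0::nat. \<forall>l\<ge>l0. K * (real l + 1) ^ 3 * 2 powr (- (a * real l)) \<le> \<eta>"
proof -
  have "(\<lambda>l::nat. (real l + 1) ^ 3 * 2 powr (- (a * real l))) \<longlonglongrightarrow> 0"
    using assms(1) by real_asymp
  then have "(\<lambda>l::nat. K * ((real l + 1) ^ 3 * 2 powr (- (a * real l)))) \<longlonglongrightarrow> K * 0"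
    by (rule tendsto_mult_left)
  then have "\<forall>\<^sub>F l in sequentially. K * ((real l + 1) ^ 3 * 2 powr (- (a * real l))) < \<eta>"
    using assms(2) by (intro order_tendstoD) simp_all
  then show ?thesis unfolding eventually_sequentially by (auto simp: mult.assoc intro: less_imp_le)
qed

definition slope_bound ::
  "'z set \<Rightarrow> ('z \<Rightarrow> real) \<Rightarrow> ('z \<Rightarrow> 'z \<Rightarrow> real) \<Rightarrow> ('z \<Rightarrow> 'z \<Rightarrow> real) \<Rightarrow> nat \<Rightarrow> ('z \<Rightarrow> 'z \<Rightarrow> real) \<Rightarrow>
   real \<Rightarrow> real \<Rightarrow> nat \<Rightarrow> bool" where
  "slope_bound X h b c m d \<kappa> e l \<longleftrightarrow>
     (\<forall>z\<in>X. \<forall>j\<le>l. (\<Sum>v\<in>up_tree X h b c j z. d z v) \<le> (\<kappa> * real j + e) * real m ^ j)"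

definition extremal ::
  "'z set \<Rightarrow> ('z \<Rightarrow> real) \<Rightarrow> ('z \<Rightarrow> 'z \<Rightarrow> real) \<Rightarrow> ('z \<Rightarrow> 'z \<Rightarrow> real) \<Rightarrow> nat \<Rightarrow> ('z \<Rightarrow> 'z \<Rightarrow> real) \<Rightarrow>
   ('z \<Rightarrow> 'z \<Rightarrow> real) \<Rightarrow> real \<Rightarrow> real \<Rightarrow> nat \<Rightarrow> 'z \<Rightarrow> bool" where
  "extremal X h b c m d nu \<kappa> e l w \<longleftrightarrow>
     (\<kappa> * real l - e) * real m ^ l \<le> (\<Sum>v\<in>up_tree X h b c l w. d w v) \<and>
     (\<Sum>v\<in>up_tree X h b c l w. nu w v) \<le> e * real m ^ l"

context box_pair
begin

abbreviation up_bound :: "('z \<Rightarrow> 'y) \<Rightarrow> real \<Rightarrow> real \<Rightarrow> nat \<Rightarrow> bool" where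
  "up_bound \<phi> \<equiv> slope_bound X h b c m (\<lambda>z v. B.dd (\<phi> z) (\<phi> v))"
abbreviation down_bound :: "('z \<Rightarrow> 'y) \<Rightarrow> real \<Rightarrow> real \<Rightarrow> nat \<Rightarrow> bool" where
  "down_bound \<phi> \<equiv> slope_bound X (\<lambda>z. - h z) (\<lambda>z w. - c z w) (\<lambda>z w. - b z w) n (\<lambda>z v. B.dd (\<phi> z) (\<phi> v))"
abbreviation up_extremal :: "('z \<Rightarrow> 'y) \<Rightarrow> real \<Rightarrow> real \<Rightarrow> nat \<Rightarrow> 'z \<Rightarrow> bool" where
  "up_extremal \<phi> \<equiv> extremal X h b c m (\<lambda>z v. B.dd (\<phi> z) (\<phi> v)) (\<lambda>z v. B.nu (\<phi> z) (\<phi> v))"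
abbreviation down_extremal :: "('z \<Rightarrow> 'y) \<Rightarrow> real \<Rightarrow> real \<Rightarrow> nat \<Rightarrow> 'z \<Rightarrow> bool" where
  "down_extremal \<phi> \<equiv> extremal X (\<lambda>z. - h z) (\<lambda>z w. - c z w) (\<lambda>z w. - b z w) n
     (\<lambda>z v. B.dd (\<phi> z) (\<phi> v)) (\<lambda>z v. B.nu (\<phi> z) (\<phi> v))"

lemma flip_source: "box_pair X (\<lambda>z. - h z) (\<lambda>z w. - c z w) (\<lambda>z w. - b z w) n m Y h' b' c' m' n' M"
  using A.flip B.box_space_axioms by (rule box_pair.intro)

lemma flip_target: "box_pair X h b c m n Y (\<lambda>z. - h' z) (\<lambda>z w. - c' z w) (\<lambda>z w. - b' z w) n' m' M"
  using A.box_space_axioms B.flip by (rule box_pair.intro)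

lemma few_ahead_eventually:
  assumes L: "1 \<le> L" and eps: "0 < \<epsilon>" "\<epsilon> \<le> 1"
  shows "\<exists>\<delta>>0. \<exists>l0. \<forall>l\<ge>l0. \<forall>\<phi> \<kappa> w p. qi L \<phi> \<longrightarrow> w \<in> X \<longrightarrow> p \<in> Y \<longrightarrow>
    up_bound \<phi> \<kappa> (\<delta> * real l) l \<longrightarrow> up_extremal \<phi> \<kappa> (\<delta> * real l) l w \<longrightarrow>
    real (card {v \<in> A.U l w. h' (\<phi> w) + \<epsilon> * real l \<le> b' p (\<phi> v)}) \<le> \<epsilon> * real m ^ l"
proof -
  have M2: "2 \<le> M" by (rule A.M_ge_2)
  define q where "q = log 2 (real M)"
  have q: "1 \<le> q" unfolding q_def using M2 by (simp add: le_log_iff)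
  have Mq: "real M powr x = 2 powr (q * x)" for x
    unfolding q_def using M2 by (simp add: powr_powr[symmetric])
  define \<tau> where "\<tau> = \<epsilon> / (32 * L\<^sup>2 * q)"
  define \<delta> where "\<delta> = \<epsilon> * \<tau> / 8"
  have tau: "0 < \<tau>" unfolding \<tau>_def using eps L q by (intro divide_pos_pos mult_pos_pos) auto
  have delta: "0 < \<delta>" unfolding \<delta>_def using eps tau by simp
  define a where "a = \<epsilon> / (4 * L)"
  have a: "0 < a" unfolding a_def using eps L by simp
  have qa: "q * (8 * L * \<tau>) = a"
    unfolding \<tau>_def a_def using q L by (simp add: power2_eq_square field_simps)
  define K where "K = (8 * L * \<tau> + L + 2)\<^sup>2 * (2 * 2 powr (q * (L + 1)))"
  obtain l1 where l1: "\<And>l. l \<ge> l1 \<Longrightarrow> K * (real l + 1) ^ 3 * 2 powr (- (a * real l)) \<le> \<epsilon> / 2"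
    using exp_beats_cubic[OF a, of "\<epsilon> / 2" K] eps by auto
  define l0 where "l0 = max l1 (max 1 (nat \<lceil>2 * L / \<epsilon>\<rceil>))"
  show ?thesis
  proof (intro exI[of _ \<delta>] conjI delta exI[of _ l0] allI impI)
    fix l \<phi> \<kappa> w p
    assume l: "l0 \<le> l" and qi: "qi L \<phi>" and w: "w \<in> X" and p: "p \<in> Y"
      and bd: "up_bound \<phi> \<kappa> (\<delta> * real l) l" and ex: "up_extremal \<phi> \<kappa> (\<delta> * real l) l w"
    have ll: "l1 \<le> l" "1 \<le> real l" "2 * L / \<epsilon> \<le> real l" using l unfolding l0_def by linarith+
    have lL: "2 * L \<le> \<epsilon> * real l" using ll(3) eps by (simp add: field_simps)
    define s where "s = nat \<lfloor>\<epsilon> * real l / (2 * L)\<rfloor>"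
    have s0: "0 \<le> \<epsilon> * real l / (2 * L)" using eps L by simp
    have s1: "real s \<le> \<epsilon> * real l / (2 * L)" "\<epsilon> * real l / (2 * L) - 1 \<le> real s"
      unfolding s_def using s0 by linarith+
    have "L * real s \<le> L * (\<epsilon> * real l / (2 * L))" using s1(1) L by (intro mult_left_mono) auto
    then have sL: "L * real s + L \<le> \<epsilon> * real l" using lL L by simp
    have "real s \<le> L * real s" using L by (simp add: mult_le_cancel_right1)
    moreover have "\<epsilon> * real l \<le> real l" using eps by (simp add: mult_left_le_one_le)
    ultimately have "real s \<le> real l" using sL L by linarith
    then have sl: "s \<le> l" by simp
    have UX: "A.U r z \<subseteq> X" for r z by (rule A.up_sub)
    define t where "t = \<tau> * real l"
    have t: "0 < t" unfolding t_def using tau ll by simp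
    have "t * real (card {v \<in> A.U l w. h' (\<phi> w) + \<epsilon> * real l \<le> b' p (\<phi> v)}) \<le>
      4 * (\<delta> * real l) * real m ^ l + t * ((\<epsilon> * real l + 1) * ball_bound M (8 * L * t + L) * real m ^ (l - s))"
    proof (rule few_ahead[OF qi w sl sL t, of \<kappa>])
      show "(\<Sum>u\<in>A.U s w. B.dd (\<phi> w) (\<phi> u)) \<le> (\<kappa> * real s + \<delta> * real l) * real m ^ s"
        using bd w sl unfolding slope_bound_def by blast
      show "(\<Sum>v\<in>A.U (l - s) u. B.dd (\<phi> u) (\<phi> v)) \<le> (\<kappa> * real (l - s) + \<delta> * real l) * real m ^ (l - s)"
        if "u \<in> A.U s w" for u
        using bd that UX diff_le_self unfolding slope_bound_def by blast
      show "(\<Sum>v\<in>A.U l w. B.dd (\<phi> w) (\<phi> v)) \<ge> (\<kappa> * real l - \<delta> * real l) * real m ^ l"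
        using ex unfolding extremal_def by blast
      show "(\<Sum>v\<in>A.U l w. B.nu (\<phi> w) (\<phi> v)) \<le> \<delta> * real l * real m ^ l"
        using ex unfolding extremal_def by blast
    qed (rule p)
    also have "4 * (\<delta> * real l) * real m ^ l = t * (\<epsilon> / 2 * real m ^ l)"
      unfolding \<delta>_def t_def by simp
    also have "(\<epsilon> * real l + 1) * ball_bound M (8 * L * t + L) * real m ^ (l - s) \<le> \<epsilon> / 2 * real m ^ l"
    proof -
      have e1: "\<epsilon> * real l + 1 \<le> real l + 1" using \<open>\<epsilon> * real l \<le> real l\<close> by simp
      have e2: "ball_bound M (8 * L * t + L) \<le> ((8 * L * \<tau> + L + 2) * (real l + 1))\<^sup>2 * 2 powr (a * real l + q * (L + 1))"
        unfolding ball_bound_def Mq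
      proof (rule mult_mono)
        have "8 * L * t + L + 2 \<le> (8 * L * \<tau> + L + 2) * (real l + 1)"
          unfolding t_def using L tau ll(2) by (simp add: algebra_simps)
        then show "(8 * L * t + L + 2)\<^sup>2 \<le> ((8 * L * \<tau> + L + 2) * (real l + 1))\<^sup>2"
          using L t by (intro power_mono) auto
        have "q * (8 * L * t + L + 1) = q * (8 * L * \<tau>) * real l + q * (L + 1)"
          unfolding t_def by (simp add: algebra_simps)
        then show "2 powr (q * (8 * L * t + L + 1)) \<le> 2 powr (a * real l + q * (L + 1))"
          unfolding qa by simp
      qed auto
      have e3: "real m ^ (l - s) \<le> real m ^ l * (2 * 2 powr (- (2 * a * real l)))"
      proof -
        have "2 powr (\<epsilon> * real l / (2 * L) - 1) \<le> 2 powr real s" using s1(2) by simp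
        also have "\<dots> = 2 ^ s" by (simp add: powr_realpow)
        also have "\<dots> \<le> real m ^ s" using A.m_ge_2 by (intro power_mono) auto
        finally have "2 powr (2 * a * real l - 1) \<le> real m ^ s" unfolding a_def by simp
        then have "real m ^ (l - s) * 2 powr (2 * a * real l - 1) \<le> real m ^ (l - s) * real m ^ s"
          by (intro mult_left_mono) auto
        also have "\<dots> = real m ^ l" using sl by (simp add: power_add[symmetric])
        finally show ?thesis
          by (simp add: powr_diff powr_minus field_simps)
      qed
      have "(\<epsilon> * real l + 1) * ball_bound M (8 * L * t + L) * real m ^ (l - s) \<le>
        (real l + 1) * (((8 * L * \<tau> + L + 2) * (real l + 1))\<^sup>2 * 2 powr (a * real l + q * (L + 1))) *
        (real m ^ l * (2 * 2 powr (- (2 * a * real l))))"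
        by (intro mult_mono e1 e2 e3) (use ball_bound_nonneg in auto)
      also have "\<dots> = K * (real l + 1) ^ 3 * (2 powr (a * real l) * 2 powr (- (2 * a * real l))) * real m ^ l"
        unfolding K_def powr_add by (simp add: power_mult_distrib power3_eq_cube power2_eq_square)
      also have "2 powr (a * real l) * 2 powr (- (2 * a * real l)) = 2 powr (- (a * real l))"
        by (simp add: powr_add[symmetric])
      also have "K * (real l + 1) ^ 3 * 2 powr (- (a * real l)) * real m ^ l \<le> \<epsilon> / 2 * real m ^ l"
        using l1[OF ll(1)] by (intro mult_right_mono) auto
      finally show ?thesis .
    qed
    finally have "t * real (card {v \<in> A.U l w. h' (\<phi> w) + \<epsilon> * real l \<le> b' p (\<phi> v)}) \<le>
      t * (\<epsilon> / 2 * real m ^ l) + t * (\<epsilon> / 2 * real m ^ l)" using t by simp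
    also have "\<dots> = t * (\<epsilon> * real m ^ l)" by (simp add: algebra_simps)
    finally show "real (card {v \<in> A.U l w. h' (\<phi> w) + \<epsilon> * real l \<le> b' p (\<phi> v)}) \<le> \<epsilon> * real m ^ l"
      using t by simp
  qed
qed

end

section \<open>Boxes over extremal trees\<close>

lemma slope_bound_mono:
  assumes "slope_bound X h b c m d \<kappa> e l" "e \<le> e'" shows "slope_bound X h b c m d \<kappa> e' l"
  unfolding slope_bound_def
proof (intro ballI allI impI)
  fix z j assume "z \<in> X" "j \<le> l"
  then have "(\<Sum>v\<in>up_tree X h b c j z. d z v) \<le> (\<kappa> * real j + e) * real m ^ j"
    using assms(1) unfolding slope_bound_def by blast
  also have "\<dots> \<le> (\<kappa> * real j + e') * real m ^ j" using assms(2) by (intro mult_right_mono) auto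
  finally show "(\<Sum>v\<in>up_tree X h b c j z. d z v) \<le> (\<kappa> * real j + e') * real m ^ j" .
qed

lemma extremal_mono:
  assumes "extremal X h b c m d nu \<kappa> e l w" "e \<le> e'" shows "extremal X h b c m d nu \<kappa> e' l w"
proof -
  have "(\<kappa> * real l - e') * real m ^ l \<le> (\<kappa> * real l - e) * real m ^ l" "e * real m ^ l \<le> e' * real m ^ l"
    using assms(2) by (intro mult_right_mono; auto)+
  then show ?thesis using assms(1) unfolding extremal_def by linarith
qed

context box_pair
begin

lemma rho_path:
  assumes "qi L \<phi>" "w \<in> X" "v \<in> A.U l w" "p \<in> A.D l v"
  shows "p \<in> X" "v \<in> X" "A.rho w p \<le> real l" "A.U l p = A.U l w"
proof -
  show X: "p \<in> X" "v \<in> X" using assms A.up_sub by blast+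
  have 1: "h v = h w + real l" "b w v = h w" "c w v = h v" using assms(3) unfolding A.up_iff[OF assms(2)] by blast+
  have 2: "h p = h v - real l" "b v p = h p" "c v p = h v" using assms(4) unfolding A.down_iff[OF X(2)] by blast+
  have "h w \<le> b w p" using A.ultra_cases(1)[OF assms(2) X(2,1)] 1 2 by linarith
  moreover have "c w p \<le> h v" using A.ultra_cases(2)[OF assms(2) X(2,1)] 1 2 by linarith
  ultimately show "A.rho w p \<le> real l" using 1 unfolding box_dist_def by linarith
  show "A.U l p = A.U l w" by (rule A.down_tops[OF assms(2-4)])
qed

lemma dd_spread_ahead:
  assumes Y: "W \<in> Y" "P \<in> Y" "V \<in> Y" and V: "h' W \<le> h' V" "b' P V < h' W + \<alpha>" and \<alpha>: "0 \<le> \<alpha>"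
  shows "B.dd W V + \<bar>h' P - h' W\<bar> \<le> B.dd P V + 4 * B.nu W V + 4 * \<alpha>"
proof -
  have "B.dd W V = 3 * (h' V - h' W) + 4 * B.nu W V" using V(1) unfolding B.dd_eq(1) by simp
  moreover have "3 * (h' V - h' W) + \<bar>h' P - h' W\<bar> \<le> B.dd P V + 4 * \<alpha>"
    unfolding mixed_dist_def using B.bc(1-4)[OF Y(2,3)] V \<alpha> by argo
  ultimately show ?thesis by linarith
qed

lemma dd_spread_behind:
  assumes Y: "W \<in> Y" "P \<in> Y" "V \<in> Y" and V: "h' V \<le> h' W" "h' W - \<alpha> < c' P V" and \<alpha>: "0 \<le> \<alpha>"
  shows "B.dd W V + \<bar>h' P - h' W\<bar> \<le> B.dd P V + 4 * B.nu W V + 4 * \<alpha>"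
proof -
  interpret T: box_pair X h b c m n Y "\<lambda>z. - h' z" "\<lambda>z w. - c' z w" "\<lambda>z w. - b' z w" n' m' M
    by (rule flip_target)
  show ?thesis using T.dd_spread_ahead[OF Y, of \<alpha>] V \<alpha> by (simp add: abs_minus_commute)
qed

text \<open>The slope bound at \<open>p\<close> turns the inequality \<open>dd_spread_ahead\<close>, valid for most \<open>v\<close>, into an
  almost equality. So all points at the bottom of the box behave like \<open>w\<close>.\<close>

lemma bottoms_eventually:
  assumes L: "1 \<le> L" and eps: "0 < \<epsilon>" "\<epsilon> \<le> 1"
  shows "\<exists>\<delta>>0. \<exists>l0. \<forall>l\<ge>l0. \<forall>\<phi> \<kappa> w v p. qi L \<phi> \<longrightarrow> w \<in> X \<longrightarrow>
    up_bound \<phi> \<kappa> (\<delta> * real l) l \<longrightarrow> up_extremal \<phi> \<kappa> (\<delta> * real l) l w \<longrightarrow> v \<in> A.U l w \<longrightarrow> p \<in> A.D l v \<longrightarrow>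
    \<bar>h' (\<phi> p) - h' (\<phi> w)\<bar> \<le> \<epsilon> * real l \<and>
    real (card {v \<in> A.U l w. \<epsilon> * real l < B.nu (\<phi> p) (\<phi> v)}) \<le> \<epsilon> * real m ^ l"
proof -
  interpret T: box_pair X h b c m n Y "\<lambda>z. - h' z" "\<lambda>z w. - c' z w" "\<lambda>z w. - b' z w" n' m' M
    by (rule flip_target)
  define \<beta> where "\<beta> = \<epsilon>\<^sup>2 / (80 * L)"
  have beta: "0 < \<beta>" "\<beta> \<le> 1" "80 * L * \<beta> = \<epsilon>\<^sup>2" "\<beta> \<le> \<epsilon> / 80"
  proof -
    show "0 < \<beta>" unfolding \<beta>_def using eps L by simp
    show *: "80 * L * \<beta> = \<epsilon>\<^sup>2" unfolding \<beta>_def using L by simp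
    have "\<epsilon>\<^sup>2 \<le> \<epsilon>" unfolding power2_eq_square using eps by (simp add: mult_left_le_one_le)
    moreover have "80 * \<beta> \<le> 80 * L * \<beta>" using L \<open>0 < \<beta>\<close> by simp
    ultimately show "\<beta> \<le> \<epsilon> / 80" using * by linarith
    then show "\<beta> \<le> 1" using eps by linarith
  qed
  obtain \<delta>1 l1 where d1: "0 < \<delta>1" and "\<forall>l\<ge>l1. \<forall>\<phi> \<kappa> w p. qi L \<phi> \<longrightarrow> w \<in> X \<longrightarrow> p \<in> Y \<longrightarrow>
    up_bound \<phi> \<kappa> (\<delta>1 * real l) l \<longrightarrow> up_extremal \<phi> \<kappa> (\<delta>1 * real l) l w \<longrightarrow>
    real (card {v \<in> A.U l w. h' (\<phi> w) + \<beta> * real l \<le> b' p (\<phi> v)}) \<le> \<beta> * real m ^ l"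
    using few_ahead_eventually[OF L beta(1,2)] by (elim exE conjE) (rule that)
  note few1 = this(2)[rule_format]
  obtain \<delta>2 l2 where d2: "0 < \<delta>2" and "\<forall>l\<ge>l2. \<forall>\<phi> \<kappa> w p. qi L \<phi> \<longrightarrow> w \<in> X \<longrightarrow> p \<in> Y \<longrightarrow>
    up_bound \<phi> \<kappa> (\<delta>2 * real l) l \<longrightarrow> up_extremal \<phi> \<kappa> (\<delta>2 * real l) l w \<longrightarrow>
    real (card {v \<in> A.U l w. - h' (\<phi> w) + \<beta> * real l \<le> - c' p (\<phi> v)}) \<le> \<beta> * real m ^ l"
    using T.few_ahead_eventually[OF L beta(1,2)] unfolding flip_simps by (elim exE conjE) (rule that)
  note few2 = this(2)[rule_format]
  define \<delta> where "\<delta> = min \<beta> (min \<delta>1 \<delta>2)"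
  have delta: "0 < \<delta>" "\<delta> \<le> \<beta>" "\<delta> \<le> \<delta>1" "\<delta> \<le> \<delta>2" unfolding \<delta>_def using beta d1 d2 by auto
  show ?thesis
  proof (intro exI[of _ \<delta>] conjI delta(1) exI[of _ "max 1 (max l1 l2)"] allI impI)
    fix l \<phi> \<kappa> w v0 p
    assume l: "max 1 (max l1 l2) \<le> l" and qi: "qi L \<phi>" and w: "w \<in> X"
      and bd: "up_bound \<phi> \<kappa> (\<delta> * real l) l" and ex: "up_extremal \<phi> \<kappa> (\<delta> * real l) l w"
      and v0: "v0 \<in> A.U l w" and p0: "p \<in> A.D l v0"
    have l1: "1 \<le> real l" using l by simp
    have bd': "up_bound \<phi> \<kappa> (\<delta>' * real l) l" if "\<delta> \<le> \<delta>'" for \<delta>'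
      using slope_bound_mono[OF bd] that by (simp add: mult_right_mono)
    have ex': "up_extremal \<phi> \<kappa> (\<delta>' * real l) l w" if "\<delta> \<le> \<delta>'" for \<delta>'
      using extremal_mono[OF ex] that by (simp add: mult_right_mono)
    have p: "p \<in> X" and v0X: "v0 \<in> X" and pr: "A.rho w p \<le> real l" and Up: "A.U l p = A.U l w"
      using rho_path[OF qi w v0 p0] by auto
    have fin: "finite (A.U l w)" by (rule A.finite_up[OF w])
    have cU: "real (card (A.U l w)) = real m ^ l" using A.card_up[OF w] by simp
    define N where "N = real m ^ l"
    have N: "0 < N" unfolding N_def using A.m_ge_2 by simp
    define W where "W = \<phi> w"
    define P where "P = \<phi> p"
    have Y: "W \<in> Y" "P \<in> Y" unfolding W_def P_def using qiD(2)[OF qi] w p by auto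
    have vY: "\<phi> v \<in> Y" if "v \<in> A.U l w" for v using that A.up_sub qiD(2)[OF qi] by blast
    define E where "E = {v \<in> A.U l w. h' W + \<beta> * real l \<le> b' P (\<phi> v)} \<union>
      {v \<in> A.U l w. - h' W + \<beta> * real l \<le> - c' P (\<phi> v)}"
    have cE: "real (card E) \<le> 2 * \<beta> * N"
    proof -
      have "card E \<le> card {v \<in> A.U l w. h' W + \<beta> * real l \<le> b' P (\<phi> v)} +
        card {v \<in> A.U l w. - h' W + \<beta> * real l \<le> - c' P (\<phi> v)}"
        unfolding E_def by (rule card_Un_le)
      moreover have "real (card {v \<in> A.U l w. h' W + \<beta> * real l \<le> b' P (\<phi> v)}) \<le> \<beta> * N"
        unfolding W_def N_def using l Y(2) by (intro few1[OF _ qi w _ bd'[OF delta(3)] ex'[OF delta(3)]]) auto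
      moreover have "real (card {v \<in> A.U l w. - h' W + \<beta> * real l \<le> - c' P (\<phi> v)}) \<le> \<beta> * N"
        unfolding W_def N_def using l Y(2) by (intro few2[OF _ qi w _ bd'[OF delta(4)] ex'[OF delta(4)]]) auto
      ultimately show ?thesis by linarith
    qed
    have EU: "E \<subseteq> A.U l w" unfolding E_def by blast
    define R where "R = \<bar>h' P - h' W\<bar>"
    have WP: "B.rho W P \<le> 2 * L * real l"
    proof -
      have "L * A.rho w p \<le> L * real l" using pr L by (intro mult_left_mono) auto
      moreover have "L \<le> L * real l" using L l1 by simp
      ultimately show ?thesis using qiD(3)[OF qi w p] unfolding W_def P_def by linarith
    qed
    have R: "0 \<le> R" "R \<le> 2 * L * real l"
      using B.rho_ge[OF Y] WP unfolding R_def by linarith+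
    define F where "F v = B.dd P (\<phi> v) - B.dd W (\<phi> v) + 4 * B.nu W (\<phi> v) + 4 * \<beta> * real l - R +
      (8 * L * real l + R) * of_bool (v \<in> E)" for v
    have F0: "0 \<le> F v" if v: "v \<in> A.U l w" for v
    proof (cases "v \<in> E")
      case True
      have "B.dd W (\<phi> v) \<le> B.dd W P + B.dd P (\<phi> v)" by (rule B.dd_tri[OF Y vY[OF v]])
      moreover have "B.dd W P \<le> 8 * L * real l" using B.dd_le[OF Y] WP by linarith
      moreover have "0 \<le> 4 * \<beta> * real l" using beta(1) by simp
      ultimately show ?thesis using True B.nu_nonneg[OF Y(1) vY[OF v]] unfolding F_def by simp
    next
      case False
      then have nb: "b' P (\<phi> v) < h' W + \<beta> * real l" "h' W - \<beta> * real l < c' P (\<phi> v)"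
        using v unfolding E_def by auto
      have "0 \<le> \<beta> * real l" using beta(1) by simp
      then have "B.dd W (\<phi> v) + R \<le> B.dd P (\<phi> v) + 4 * B.nu W (\<phi> v) + 4 * (\<beta> * real l)"
        unfolding R_def using dd_spread_ahead[OF Y vY[OF v] _ nb(1)] dd_spread_behind[OF Y vY[OF v] _ nb(2)]
        by linarith
      then show ?thesis using False unfolding F_def by simp
    qed
    have "sum F (A.U l w) = (\<Sum>v\<in>A.U l w. B.dd P (\<phi> v)) - (\<Sum>v\<in>A.U l w. B.dd W (\<phi> v)) +
        4 * (\<Sum>v\<in>A.U l w. B.nu W (\<phi> v)) + (4 * \<beta> * real l - R) * N + (8 * L * real l + R) * real (card E)"
    proof -
      have "(\<Sum>v\<in>A.U l w. (8 * L * real l + R) * of_bool (v \<in> E)) = (8 * L * real l + R) * real (card E)"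
        using fin EU by (simp add: sum_distrib_left[symmetric] Int_absorb1)
      then show ?thesis
        unfolding F_def sum.distrib sum_subtractf by (simp add: sum_distrib_left cU N_def algebra_simps)
    qed
    also have "(\<Sum>v\<in>A.U l w. B.dd P (\<phi> v)) \<le> (\<kappa> * real l + \<delta> * real l) * N"
      using bd p unfolding slope_bound_def N_def P_def Up[symmetric] by blast
    also have "(\<Sum>v\<in>A.U l w. B.nu W (\<phi> v)) \<le> \<delta> * real l * N"
      using ex unfolding extremal_def W_def N_def by blast
    also have "(8 * L * real l + R) * real (card E) \<le> (8 * L * real l + 2 * L * real l) * (2 * \<beta> * N)"
      using R L by (intro mult_mono cE) auto
    finally have "sum F (A.U l w) \<le> (\<kappa> * real l + \<delta> * real l) * N - (\<kappa> * real l - \<delta> * real l) * N +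
      4 * (\<delta> * real l * N) + (4 * \<beta> * real l - R) * N + (8 * L * real l + 2 * L * real l) * (2 * \<beta> * N)"
      using ex unfolding extremal_def W_def N_def by (smt (verit))
    also have "\<dots> = ((6 * \<delta> + 4 * \<beta> + 20 * L * \<beta>) * real l - R) * N" by (simp add: algebra_simps)
    also have "\<dots> \<le> (3 / 8 * \<epsilon>\<^sup>2 * real l - R) * N"
    proof (intro mult_right_mono diff_right_mono)
      have "6 * \<delta> + 4 * \<beta> \<le> 10 * \<beta>" using delta(2) by simp
      also have "\<dots> \<le> 10 * L * \<beta>" using L beta(1) by simp
      finally show "6 * \<delta> + 4 * \<beta> + 20 * L * \<beta> \<le> 3 / 8 * \<epsilon>\<^sup>2" using beta(3) by linarith
    qed (use N in auto)
    finally have sF: "sum F (A.U l w) \<le> (3 / 8 * \<epsilon>\<^sup>2 * real l - R) * N" .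
    have "0 \<le> sum F (A.U l w)" using F0 by (rule sum_nonneg)
    then have "0 \<le> (3 / 8 * \<epsilon>\<^sup>2 * real l - R) * N" using sF by linarith
    then have "0 \<le> 3 / 8 * \<epsilon>\<^sup>2 * real l - R" using N by (metis mult_neg_pos not_le)
    then have Rle: "R \<le> 3 / 8 * \<epsilon>\<^sup>2 * real l" by simp
    have "\<epsilon>\<^sup>2 \<le> \<epsilon>" unfolding power2_eq_square using eps by (simp add: mult_left_le_one_le)
    then have ee: "\<epsilon>\<^sup>2 * real l \<le> \<epsilon> * real l" by (intro mult_right_mono) auto
    have el: "0 < \<epsilon> * real l" using eps l1 by simp
    show "\<bar>h' (\<phi> p) - h' (\<phi> w)\<bar> \<le> \<epsilon> * real l"
      using Rle ee el unfolding R_def W_def P_def by linarith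
    have sub: "{v \<in> A.U l w. \<epsilon> * real l < B.nu P (\<phi> v)} \<subseteq> E \<union> {v \<in> A.U l w. 2 * \<epsilon> * real l \<le> F v}"
    proof
      fix v assume "v \<in> {v \<in> A.U l w. \<epsilon> * real l < B.nu P (\<phi> v)}"
      then have v: "v \<in> A.U l w" "\<epsilon> * real l < B.nu P (\<phi> v)" by auto
      show "v \<in> E \<union> {v \<in> A.U l w. 2 * \<epsilon> * real l \<le> F v}"
      proof (cases "v \<in> E")
        case False
        have "4 * B.nu P (\<phi> v) + 3 * \<bar>h' P - h' (\<phi> v)\<bar> = B.dd P (\<phi> v)" unfolding B.dd_eq(1) by simp
        moreover have "B.dd W (\<phi> v) = 3 * \<bar>h' W - h' (\<phi> v)\<bar> + 4 * B.nu W (\<phi> v)" unfolding B.dd_eq(1) by simp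
        moreover have "\<bar>h' W - h' (\<phi> v)\<bar> \<le> R + \<bar>h' P - h' (\<phi> v)\<bar>" unfolding R_def by linarith
        moreover have "0 \<le> 4 * \<beta> * real l" using beta(1) by simp
        moreover have "F v = B.dd P (\<phi> v) - B.dd W (\<phi> v) + 4 * B.nu W (\<phi> v) + 4 * \<beta> * real l - R"
          using False unfolding F_def by simp
        ultimately have "4 * B.nu P (\<phi> v) \<le> F v + 4 * R" by argo
        moreover have "4 * R \<le> 3 / 2 * (\<epsilon> * real l)" using Rle ee by linarith
        ultimately have "2 * \<epsilon> * real l \<le> F v" using v(2) el by linarith
        then show ?thesis using v by simp
      qed simp
    qed
    have "(2 * \<epsilon> * real l) * real (card {v \<in> A.U l w. 2 * \<epsilon> * real l \<le> F v}) \<le> sum F (A.U l w)"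
      by (rule markov_count[OF fin]) (use F0 in auto)
    also have "\<dots> \<le> (3 / 8 * \<epsilon>\<^sup>2 * real l) * N"
    proof -
      have "(3 / 8 * \<epsilon>\<^sup>2 * real l - R) * N \<le> (3 / 8 * \<epsilon>\<^sup>2 * real l) * N"
        using R(1) N by (intro mult_right_mono) auto
      then show ?thesis using sF by linarith
    qed
    also have "\<dots> = (2 * \<epsilon> * real l) * (3 / 16 * \<epsilon> * N)" by (simp add: power2_eq_square)
    finally have c2: "real (card {v \<in> A.U l w. 2 * \<epsilon> * real l \<le> F v}) \<le> 3 / 16 * \<epsilon> * N"
      by (rule mult_left_le_imp_le) (use el in simp)
    have "card {v \<in> A.U l w. \<epsilon> * real l < B.nu P (\<phi> v)} \<le> card (E \<union> {v \<in> A.U l w. 2 * \<epsilon> * real l \<le> F v})"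
      by (rule card_mono[OF _ sub]) (use fin EU finite_subset in auto)
    also have "\<dots> \<le> card E + card {v \<in> A.U l w. 2 * \<epsilon> * real l \<le> F v}" by (rule card_Un_le)
    finally have "real (card {v \<in> A.U l w. \<epsilon> * real l < B.nu P (\<phi> v)}) \<le> 2 * \<beta> * N + 3 / 16 * \<epsilon> * N"
      using cE c2 by linarith
    also have "\<dots> \<le> \<epsilon> * N"
    proof -
      have "2 * \<beta> + 3 / 16 * \<epsilon> \<le> \<epsilon>" using beta(4) eps by linarith
      then have "(2 * \<beta> + 3 / 16 * \<epsilon>) * N \<le> \<epsilon> * N" using N by (intro mult_right_mono) auto
      then show ?thesis by (simp add: algebra_simps)
    qed
    finally show "real (card {v \<in> A.U l w. \<epsilon> * real l < B.nu (\<phi> p) (\<phi> v)}) \<le> \<epsilon> * real m ^ l"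
      unfolding P_def N_def .
  qed
qed

lemma bottoms_eq:
  assumes "w \<in> X" "v \<in> A.U l w" "v' \<in> A.U l w" shows "A.D l v' = A.D l v"
proof -
  interpret S: box_pair X "\<lambda>z. - h z" "\<lambda>z w. - c z w" "\<lambda>z w. - b z w" n m Y h' b' c' m' n' M
    by (rule flip_source)
  have v: "v \<in> X" "v' \<in> X" using assms(2,3) A.up_sub by blast+
  then show ?thesis
    using S.A.down_tops[of v w l v'] assms A.up_down[OF assms(1)] by simp
qed

lemma box_eventually:
  assumes L: "1 \<le> L" and eps: "0 < \<epsilon>" "\<epsilon> \<le> 1"
  shows "\<exists>\<delta>>0. \<exists>l0. \<forall>l\<ge>l0. \<forall>\<phi> \<kappa> w. qi L \<phi> \<longrightarrow> w \<in> X \<longrightarrow>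
    up_bound \<phi> \<kappa> (\<delta> * real l) l \<longrightarrow> down_bound \<phi> \<kappa> (\<delta> * real l) l \<longrightarrow> up_extremal \<phi> \<kappa> (\<delta> * real l) l w \<longrightarrow>
    (\<exists>k. \<bar>3 * \<bar>k\<bar> - \<kappa> * real l\<bar> \<le> \<epsilon> * real l \<and>
      (\<forall>v\<in>A.U l w. \<forall>p\<in>A.D l v. \<bar>h' (\<phi> v) - h' (\<phi> p) - k\<bar> \<le> \<epsilon> * real l))"
proof -
  interpret S: box_pair X "\<lambda>z. - h z" "\<lambda>z w. - c z w" "\<lambda>z w. - b z w" n m Y h' b' c' m' n' M
    by (rule flip_source)
  define \<epsilon>2 where "\<epsilon>2 = \<epsilon> / 8"
  have eps2: "0 < \<epsilon>2" "\<epsilon>2 \<le> 1" "\<epsilon> = 8 * \<epsilon>2" unfolding \<epsilon>2_def using eps by auto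
  obtain \<delta>2 l2 where d2: "0 < \<delta>2" and "\<forall>l\<ge>l2. \<forall>\<phi> \<kappa> w v p. qi L \<phi> \<longrightarrow> w \<in> X \<longrightarrow>
    down_bound \<phi> \<kappa> (\<delta>2 * real l) l \<longrightarrow> down_extremal \<phi> \<kappa> (\<delta>2 * real l) l w \<longrightarrow> v \<in> A.D l w \<longrightarrow> p \<in> A.U l v \<longrightarrow>
    \<bar>h' (\<phi> p) - h' (\<phi> w)\<bar> \<le> \<epsilon>2 * real l \<and>
    real (card {v \<in> A.D l w. \<epsilon>2 * real l < B.nu (\<phi> p) (\<phi> v)}) \<le> \<epsilon>2 * real n ^ l"
    using S.bottoms_eventually[OF L eps2(1,2)] unfolding flip_simps minus_minus by (elim exE conjE) (rule that)
  note tops = this(2)[rule_format]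
  define \<epsilon>1 where "\<epsilon>1 = min \<epsilon>2 (\<delta>2 / (12 * L))"
  have eps1: "0 < \<epsilon>1" "\<epsilon>1 \<le> 1" "\<epsilon>1 \<le> \<epsilon>2" unfolding \<epsilon>1_def using eps2 d2 L by auto
  have eps1L: "6 * (L * \<epsilon>1) \<le> \<delta>2 / 2"
  proof -
    have "L * \<epsilon>1 \<le> L * (\<delta>2 / (12 * L))" unfolding \<epsilon>1_def using L by (intro mult_left_mono) auto
    then show ?thesis using L by simp
  qed
  obtain \<delta>1 l1 where d1: "0 < \<delta>1" and "\<forall>l\<ge>l1. \<forall>\<phi> \<kappa> w v p. qi L \<phi> \<longrightarrow> w \<in> X \<longrightarrow>
    up_bound \<phi> \<kappa> (\<delta>1 * real l) l \<longrightarrow> up_extremal \<phi> \<kappa> (\<delta>1 * real l) l w \<longrightarrow> v \<in> A.U l w \<longrightarrow> p \<in> A.D l v \<longrightarrow>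
    \<bar>h' (\<phi> p) - h' (\<phi> w)\<bar> \<le> \<epsilon>1 * real l \<and>
    real (card {v \<in> A.U l w. \<epsilon>1 * real l < B.nu (\<phi> p) (\<phi> v)}) \<le> \<epsilon>1 * real m ^ l"
    using bottoms_eventually[OF L eps1(1,2)] by (elim exE conjE) (rule that)
  note bottoms = this(2)[rule_format]
  define \<delta> where "\<delta> = min (min \<delta>1 (\<delta>2 / 12)) (\<epsilon>2 / 2)"
  have delta: "0 < \<delta>" "\<delta> \<le> \<delta>1" "12 * \<delta> \<le> \<delta>2" "2 * \<delta> \<le> \<epsilon>2" unfolding \<delta>_def using d1 d2 eps2 by auto
  show ?thesis
  proof (rule exI[of _ \<delta>], rule conjI, rule delta(1), rule exI[of _ "max 1 (max l1 l2)"], intro allI impI)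
    fix l \<phi> \<kappa> w
    assume l: "max 1 (max l1 l2) \<le> l" and qi: "qi L \<phi>" and w: "w \<in> X"
      and bd: "up_bound \<phi> \<kappa> (\<delta> * real l) l" and dbd: "down_bound \<phi> \<kappa> (\<delta> * real l) l"
      and ex: "up_extremal \<phi> \<kappa> (\<delta> * real l) l w"
    have ll: "1 \<le> real l" "l1 \<le> l" "l2 \<le> l" using l by auto
    have bd1: "up_bound \<phi> \<kappa> (\<delta>1 * real l) l"
      using slope_bound_mono[OF bd] delta by (simp add: mult_right_mono)
    have ex1: "up_extremal \<phi> \<kappa> (\<delta>1 * real l) l w"
      using extremal_mono[OF ex] delta by (simp add: mult_right_mono)
    have dbd2: "down_bound \<phi> \<kappa> (\<delta>2 * real l) l"
      using slope_bound_mono[OF dbd] delta by (simp add: mult_right_mono)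
    define N where "N = real m ^ l"
    define N' where "N' = real n ^ l"
    have N: "0 < N" "0 < N'" unfolding N_def N'_def using A.m_ge_2 A.n_ge_2 by auto
    obtain v1 where v1: "v1 \<in> A.U l w" using A.up_ne[OF w] by blast
    define Bo where "Bo = A.D l v1"
    have v1X: "v1 \<in> X" using v1 A.up_sub by blast
    have Bo: "A.D l v = Bo" if "v \<in> A.U l w" for v unfolding Bo_def using bottoms_eq[OF w v1 that] .
    have cU: "real (card (A.U l w)) = N" unfolding N_def using A.card_up[OF w] by simp
    have cB: "real (card Bo) = N'" unfolding N'_def Bo_def using A.card_down[OF v1X] by simp
    have fU: "finite (A.U l w)" by (rule A.finite_up[OF w])
    have UX: "A.U l w \<subseteq> X" by (rule A.up_sub)
    have BX: "Bo \<subseteq> X" unfolding Bo_def by (rule A.up_sub)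
    have wY: "\<phi> w \<in> Y" using qiD(2)[OF qi w] .
    have vY: "\<phi> v \<in> Y" if "v \<in> A.U l w" for v using that UX qiD(2)[OF qi] by blast
    have pY: "\<phi> p \<in> Y" if "p \<in> Bo" for p using that BX qiD(2)[OF qi] by blast
    have hp: "\<bar>h' (\<phi> p) - h' (\<phi> w)\<bar> \<le> \<epsilon>1 * real l"
      and cp: "real (card {v \<in> A.U l w. \<epsilon>1 * real l < B.nu (\<phi> p) (\<phi> v)}) \<le> \<epsilon>1 * N" if "p \<in> Bo" for p
      using bottoms[OF ll(2) qi w bd1 ex1 v1 that[unfolded Bo_def]] unfolding N_def by auto
    have nu_le: "B.nu (\<phi> p) (\<phi> v) \<le> 2 * L * real l" if p: "p \<in> Bo" and v: "v \<in> A.U l w" for p v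
    proof -
      have X: "p \<in> X" "v \<in> X" using p v BX UX by auto
      have "p \<in> A.D l v" using p Bo[OF v] by simp
      then have "A.rho p v = real l"
        using A.down_iff[OF X(2), of p l] A.bc(5,6)[OF X] unfolding box_dist_def by simp
      moreover have "L \<le> L * real l" using L ll by simp
      ultimately have "B.rho (\<phi> p) (\<phi> v) \<le> 2 * L * real l" using qiD(3)[OF qi X] by simp
      then show ?thesis unfolding tilt_def box_dist_def by simp
    qed
    define g where "g v = ((\<kappa> * real l + \<delta> * real l) * N' - (\<Sum>p\<in>Bo. B.dd (\<phi> v) (\<phi> p))) + (\<Sum>p\<in>Bo. B.nu (\<phi> v) (\<phi> p))" for v
    have g1: "(\<Sum>p\<in>Bo. B.dd (\<phi> v) (\<phi> p)) \<le> (\<kappa> * real l + \<delta> * real l) * N'" if "v \<in> A.U l w" for v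
      using dbd that UX Bo[OF that] unfolding slope_bound_def N'_def by blast
    have g2: "0 \<le> (\<Sum>p\<in>Bo. B.nu (\<phi> v) (\<phi> p))" if "v \<in> A.U l w" for v
      using vY[OF that] pY by (intro sum_nonneg B.nu_nonneg) auto
    have s1: "(\<kappa> * real l - 5 * \<delta> * real l - 3 * \<epsilon>1 * real l) * N \<le> (\<Sum>v\<in>A.U l w. B.dd (\<phi> v) (\<phi> p))"
      if p: "p \<in> Bo" for p
    proof -
      have "(\<Sum>v\<in>A.U l w. B.dd (\<phi> w) (\<phi> v) - 4 * B.nu (\<phi> w) (\<phi> v) - 3 * \<epsilon>1 * real l) \<le> (\<Sum>v\<in>A.U l w. B.dd (\<phi> v) (\<phi> p))"
      proof (rule sum_mono)
        fix v assume v: "v \<in> A.U l w"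
        have "B.dd (\<phi> v) (\<phi> p) = 3 * \<bar>h' (\<phi> v) - h' (\<phi> p)\<bar> + 4 * B.nu (\<phi> v) (\<phi> p)" by (rule B.dd_eq)
        moreover have "B.dd (\<phi> w) (\<phi> v) = 3 * \<bar>h' (\<phi> w) - h' (\<phi> v)\<bar> + 4 * B.nu (\<phi> w) (\<phi> v)" by (rule B.dd_eq)
        moreover have "0 \<le> B.nu (\<phi> v) (\<phi> p)" using vY[OF v] pY[OF p] by (rule B.nu_nonneg)
        ultimately show "B.dd (\<phi> w) (\<phi> v) - 4 * B.nu (\<phi> w) (\<phi> v) - 3 * \<epsilon>1 * real l \<le> B.dd (\<phi> v) (\<phi> p)"
          using hp[OF p] by argo
      qed
      moreover have "(\<Sum>v\<in>A.U l w. B.dd (\<phi> w) (\<phi> v) - 4 * B.nu (\<phi> w) (\<phi> v) - 3 * \<epsilon>1 * real l) =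
        (\<Sum>v\<in>A.U l w. B.dd (\<phi> w) (\<phi> v)) - 4 * (\<Sum>v\<in>A.U l w. B.nu (\<phi> w) (\<phi> v)) - 3 * \<epsilon>1 * real l * N"
        unfolding sum_subtractf by (simp add: sum_distrib_left cU)
      moreover have "(\<kappa> * real l - \<delta> * real l) * N \<le> (\<Sum>v\<in>A.U l w. B.dd (\<phi> w) (\<phi> v))"
        "(\<Sum>v\<in>A.U l w. B.nu (\<phi> w) (\<phi> v)) \<le> \<delta> * real l * N"
        using ex unfolding extremal_def N_def by blast+
      ultimately show ?thesis by (simp add: algebra_simps)
    qed
    have s2: "(\<Sum>v\<in>A.U l w. B.nu (\<phi> v) (\<phi> p)) \<le> (\<epsilon>1 + 2 * L * \<epsilon>1) * real l * N" if p: "p \<in> Bo" for p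
    proof -
      define Q where "Q = {v \<in> A.U l w. \<epsilon>1 * real l < B.nu (\<phi> p) (\<phi> v)}"
      have "(\<Sum>v\<in>A.U l w. B.nu (\<phi> v) (\<phi> p)) \<le> (\<Sum>v\<in>A.U l w. \<epsilon>1 * real l + 2 * L * real l * of_bool (v \<in> Q))"
      proof (rule sum_mono)
        fix v assume v: "v \<in> A.U l w"
        have "B.nu (\<phi> v) (\<phi> p) = B.nu (\<phi> p) (\<phi> v)"
          unfolding tilt_def using B.bc(5,6)[OF vY[OF v] pY[OF p]] by (simp add: abs_minus_commute)
        moreover have "0 \<le> \<epsilon>1 * real l" using eps1 by simp
        ultimately show "B.nu (\<phi> v) (\<phi> p) \<le> \<epsilon>1 * real l + 2 * L * real l * of_bool (v \<in> Q)"
          using nu_le[OF p v] v unfolding Q_def by auto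
      qed
      also have "\<dots> = \<epsilon>1 * real l * N + 2 * L * real l * real (card Q)"
      proof -
        have "A.U l w \<inter> Q = Q" unfolding Q_def by blast
        then show ?thesis unfolding sum.distrib using fU by (simp add: sum_distrib_left[symmetric] cU)
      qed
      also have "\<dots> \<le> \<epsilon>1 * real l * N + 2 * L * real l * (\<epsilon>1 * N)"
        using cp[OF p] L unfolding Q_def by (intro add_left_mono mult_left_mono) auto
      finally show ?thesis by (simp add: algebra_simps)
    qed
    have "(\<Sum>v\<in>A.U l w. g v) = (\<kappa> * real l + \<delta> * real l) * N' * N -
       (\<Sum>p\<in>Bo. \<Sum>v\<in>A.U l w. B.dd (\<phi> v) (\<phi> p)) + (\<Sum>p\<in>Bo. \<Sum>v\<in>A.U l w. B.nu (\<phi> v) (\<phi> p))"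
      unfolding g_def sum.distrib sum_subtractf
      using sum.swap[of "\<lambda>v p. B.dd (\<phi> v) (\<phi> p)" Bo "A.U l w"] sum.swap[of "\<lambda>v p. B.nu (\<phi> v) (\<phi> p)" Bo "A.U l w"]
      by (simp add: cU)
    also have "(\<Sum>p\<in>Bo. \<Sum>v\<in>A.U l w. B.nu (\<phi> v) (\<phi> p)) \<le> (\<Sum>p\<in>Bo. (\<epsilon>1 + 2 * L * \<epsilon>1) * real l * N)"
      by (rule sum_mono[OF s2])
    also have "\<dots> = (\<epsilon>1 + 2 * L * \<epsilon>1) * real l * N * N'" using cB by simp
    finally have "(\<Sum>v\<in>A.U l w. g v) \<le> (\<kappa> * real l + \<delta> * real l) * N' * N -
       (\<Sum>p\<in>Bo. (\<kappa> * real l - 5 * \<delta> * real l - 3 * \<epsilon>1 * real l) * N) + (\<epsilon>1 + 2 * L * \<epsilon>1) * real l * N * N'"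
      using sum_mono[OF s1, of Bo "\<lambda>p. p"] by linarith
    also have "\<dots> = ((6 * \<delta> + 4 * \<epsilon>1 + 2 * L * \<epsilon>1) * real l * N') * N"
      using cB by (simp add: algebra_simps)
    also have "\<dots> \<le> (\<delta>2 * real l * N') * N"
    proof (intro mult_right_mono)
      have "\<epsilon>1 \<le> L * \<epsilon>1" using L eps1 by simp
      then show "6 * \<delta> + 4 * \<epsilon>1 + 2 * L * \<epsilon>1 \<le> \<delta>2" using delta eps1L by linarith
    qed (use N in auto)
    finally obtain v0 where v0: "v0 \<in> A.U l w" "g v0 \<le> \<delta>2 * real l * N'"
      using exists_le_average[OF fU A.up_ne[OF w]] cU by metis
    have v0X: "v0 \<in> X" using v0 UX by blast
    have ex2: "down_extremal \<phi> \<kappa> (\<delta>2 * real l) l v0"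
      unfolding extremal_def Bo[OF v0(1)] N'_def[symmetric]
    proof
      have "0 \<le> \<delta> * real l * N'" using delta N by simp
      then show "(\<kappa> * real l - \<delta>2 * real l) * N' \<le> (\<Sum>p\<in>Bo. B.dd (\<phi> v0) (\<phi> p))"
        using v0(2) g2[OF v0(1)] unfolding g_def by (simp add: algebra_simps)
      show "(\<Sum>p\<in>Bo. B.nu (\<phi> v0) (\<phi> p)) \<le> \<delta>2 * real l * N'"
        using v0(2) g1[OF v0(1)] unfolding g_def by linarith
    qed
    have hv: "\<bar>h' (\<phi> v) - h' (\<phi> v0)\<bar> \<le> \<epsilon>2 * real l" if v: "v \<in> A.U l w" for v
    proof -
      have "w \<in> A.D l v0" using A.up_down[OF w v0X] v0 by blast
      then show ?thesis using tops[OF ll(3) qi v0X dbd2 ex2 _ v] by blast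
    qed
    define k where "k = h' (\<phi> v0) - h' (\<phi> w)"
    have aux: "\<bar>z - x\<bar> \<le> \<bar>x - y\<bar> + e" "\<bar>x - y\<bar> \<le> \<bar>z - x\<bar> + e" if "\<bar>y - z\<bar> \<le> e" for x y z e :: real
      using that by linarith+
    have hk: "3 * \<bar>k\<bar> - 3 * \<epsilon>2 * real l \<le> 3 * \<bar>h' (\<phi> w) - h' (\<phi> v)\<bar>"
      "3 * \<bar>h' (\<phi> w) - h' (\<phi> v)\<bar> \<le> 3 * \<bar>k\<bar> + 3 * \<epsilon>2 * real l" if "v \<in> A.U l w" for v
      using aux[OF hv[OF that], of "h' (\<phi> w)"] unfolding k_def by simp_all
    have el: "0 \<le> \<epsilon>2 * real l" "\<epsilon>1 * real l \<le> \<epsilon>2 * real l" using eps1 eps2 by (auto simp: mult_right_mono)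
    show "\<exists>k. \<bar>3 * \<bar>k\<bar> - \<kappa> * real l\<bar> \<le> \<epsilon> * real l \<and>
      (\<forall>v\<in>A.U l w. \<forall>p\<in>A.D l v. \<bar>h' (\<phi> v) - h' (\<phi> p) - k\<bar> \<le> \<epsilon> * real l)"
    proof (intro exI[of _ k] conjI ballI)
      fix v p assume v: "v \<in> A.U l w" and p: "p \<in> A.D l v"
      have "p \<in> Bo" using p Bo[OF v] by simp
      then have "\<bar>h' (\<phi> v) - h' (\<phi> p) - k\<bar> \<le> \<epsilon>2 * real l + \<epsilon>1 * real l"
        using hv[OF v] hp unfolding k_def by fastforce
      then show "\<bar>h' (\<phi> v) - h' (\<phi> p) - k\<bar> \<le> \<epsilon> * real l"
        using el unfolding eps2(3) by linarith
    next
      have S: "(\<Sum>v\<in>A.U l w. 3 * \<bar>h' (\<phi> w) - h' (\<phi> v)\<bar>) =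
         (\<Sum>v\<in>A.U l w. B.dd (\<phi> w) (\<phi> v)) - 4 * (\<Sum>v\<in>A.U l w. B.nu (\<phi> w) (\<phi> v))"
        unfolding B.dd_eq(1) sum.distrib by (simp add: sum_distrib_left)
      have nn: "0 \<le> (\<Sum>v\<in>A.U l w. B.nu (\<phi> w) (\<phi> v))"
        using wY vY by (intro sum_nonneg B.nu_nonneg) auto
      have "(\<Sum>v\<in>A.U l w. 3 * \<bar>k\<bar> - 3 * \<epsilon>2 * real l) \<le> (\<Sum>v\<in>A.U l w. 3 * \<bar>h' (\<phi> w) - h' (\<phi> v)\<bar>)"
        by (rule sum_mono[OF hk(1)])
      also have "\<dots> \<le> (\<Sum>v\<in>A.U l w. B.dd (\<phi> w) (\<phi> v))" unfolding S using nn by simp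
      also have "\<dots> \<le> (\<kappa> * real l + \<delta> * real l) * N" using bd w unfolding slope_bound_def N_def by blast
      finally have "(3 * \<bar>k\<bar> - 3 * \<epsilon>2 * real l) * N \<le> (\<kappa> * real l + \<delta> * real l) * N"
        by (simp add: cU mult.commute)
      then have 1: "3 * \<bar>k\<bar> - 3 * \<epsilon>2 * real l \<le> \<kappa> * real l + \<delta> * real l" using N by simp
      have "(\<kappa> * real l - \<delta> * real l) * N - 4 * (\<delta> * real l * N) \<le> (\<Sum>v\<in>A.U l w. 3 * \<bar>h' (\<phi> w) - h' (\<phi> v)\<bar>)"
        unfolding S using ex unfolding extremal_def N_def by linarith
      also have "\<dots> \<le> (\<Sum>v\<in>A.U l w. 3 * \<bar>k\<bar> + 3 * \<epsilon>2 * real l)"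
        by (rule sum_mono[OF hk(2)])
      finally have "(\<kappa> * real l - \<delta> * real l - 4 * (\<delta> * real l)) * N \<le> (3 * \<bar>k\<bar> + 3 * \<epsilon>2 * real l) * N"
        by (simp add: cU algebra_simps)
      then have 2: "\<kappa> * real l - \<delta> * real l - 4 * (\<delta> * real l) \<le> 3 * \<bar>k\<bar> + 3 * \<epsilon>2 * real l" using N by simp
      have "2 * (\<delta> * real l) \<le> \<epsilon>2 * real l" using mult_right_mono[OF delta(4), of "real l"] by simp
      then show "\<bar>3 * \<bar>k\<bar> - \<kappa> * real l\<bar> \<le> \<epsilon> * real l"
        using 1 2 el unfolding eps2(3) by linarith
    qed
  qed
qed

end

section \<open>Counting points in the image of a box\<close>

context box_space
begin

definition in_box :: "nat \<Rightarrow> 'z \<Rightarrow> 'z \<Rightarrow> bool" where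
  "in_box l w z \<longleftrightarrow> z \<in> X \<and> h w \<le> b z w \<and> c z w \<le> h w + real l"

lemma dd_lower: "3 * h z - 3 * h w + 4 * nu z w \<le> dd z w" "3 * h w - 3 * h z + 4 * nu z w \<le> dd z w"
  unfolding dd_eq(1) by argo+

lemma nat_diff:
  assumes "z \<in> X" "w \<in> X" "h w \<le> h z" obtains j :: nat where "h z = h w + real j"
proof -
  obtain i k where "h z = of_int i" "h w = of_int k" using h_int assms by (metis Ints_cases)
  then have "h z = h w + real (nat (i - k))" using assms(3) by simp
  then show ?thesis using that by blast
qed

lemma in_box_level:
  assumes "w \<in> X" "in_box l w z" obtains j where "j \<le> l" "h z = h w + real j"
proof -
  have z: "z \<in> X" "h w \<le> b z w" "c z w \<le> h w + real l" using assms(2) unfolding in_box_def by auto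
  then obtain j where "h z = h w + real j" using nat_diff[OF z(1) assms(1)] bc(1)[OF z(1) assms(1)] by force
  then show ?thesis using that[of j] z bc(3)[OF z(1) assms(1)] by simp
qed

lemma in_box_near:
  assumes "w \<in> X" "in_box l w z" "z' \<in> X" "h w \<le> b z' z" "c z' z \<le> h w + real l" shows "in_box l w z'"
proof -
  have z: "z \<in> X" "h w \<le> b z w" "c z w \<le> h w + real l" using assms(2) unfolding in_box_def by auto
  then show ?thesis
    using ultra_cases[OF assms(3) z(1) assms(1)] assms(3-5) unfolding in_box_def by linarith
qed

lemma in_box_down:
  assumes "w \<in> X" "in_box l w z" "h z = h w + real j" "i \<le> j" "u \<in> D i z"
  shows "in_box l w u" "u \<in> X" "h u = h z - real i" "b z u = h u" "c z u = h z"
proof -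
  have z: "z \<in> X" "h w \<le> b z w" "c z w \<le> h w + real l" using assms(2) unfolding in_box_def by auto
  show u: "u \<in> X" "h u = h z - real i" "b z u = h u" "c z u = h z"
    using assms(5) unfolding down_iff[OF z(1)] by blast+
  show "in_box l w u"
    using in_box_near[OF assms(1,2) u(1)] u assms(3,4) bc(5,6)[OF z(1) u(1)] bc(3)[OF z(1) assms(1)] z(3) by simp
qed

lemma in_box_up:
  assumes "w \<in> X" "in_box l w z" "h z = h w + real j" "j + i \<le> l" "u \<in> U i z"
  shows "in_box l w u" "u \<in> X" "h u = h z + real i" "b z u = h z" "c z u = h u"
proof -
  have z: "z \<in> X" "h w \<le> b z w" "c z w \<le> h w + real l" using assms(2) unfolding in_box_def by auto
  show u: "u \<in> X" "h u = h z + real i" "b z u = h z" "c z u = h u"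
    using assms(5) unfolding up_iff[OF z(1)] by blast+
  have "real j + real i \<le> real l" using assms(4) by (metis of_nat_add of_nat_le_iff)
  then show "in_box l w u"
    using in_box_near[OF assms(1,2) u(1)] u assms(3) bc(5,6)[OF z(1) u(1)] by simp
qed

lemma in_box_bottom:
  assumes "w \<in> X" "in_box l w p" "h p = h w" "v \<in> U l w" shows "p \<in> D l v"
proof -
  have p: "p \<in> X" "h w \<le> b p w" "c p w \<le> h w + real l" using assms(2) unfolding in_box_def by auto
  have "U l p = U l w" using up_common[OF p(1) assms(1,3)] p assms(3) by simp
  moreover have "v \<in> X" using assms(4) up_sub by blast
  ultimately show ?thesis using up_down[OF p(1)] assms(4) by blast
qed

lemma in_box_top:
  assumes "w \<in> X" "in_box l w v" "h v = h w + real l" shows "v \<in> U l w"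
proof -
  have v: "v \<in> X" "h w \<le> b v w" "c v w \<le> h w + real l" using assms(2) unfolding in_box_def by auto
  then show ?thesis using assms(1,3) bc[OF v(1) assms(1)] unfolding up_iff[OF assms(1)] by simp
qed

lemma in_box_flip:
  assumes "w \<in> X" "v \<in> U l w" "z \<in> X"
  shows "in_box l w z \<longleftrightarrow> h v - real l \<le> b z v \<and> c z v \<le> h v"
proof -
  have vX: "v \<in> X" using assms up_sub by blast
  have v: "h v = h w + real l" "b w v = h w" "c w v = h v" using assms(2) unfolding up_iff[OF assms(1)] by blast+
  show ?thesis
    using v assms(3) ultra_cases[OF assms(3,1) vX] ultra_cases[OF assms(3) vX assms(1)] bc(5,6)[OF assms(1) vX]
    unfolding in_box_def by force
qed

end

context box_pair
begin

definition good_box :: "('z \<Rightarrow> 'y) \<Rightarrow> real \<Rightarrow> real \<Rightarrow> nat \<Rightarrow> real \<Rightarrow> 'z \<Rightarrow> bool" where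
  "good_box \<phi> \<kappa> E l k w \<longleftrightarrow> w \<in> X \<and> up_bound \<phi> \<kappa> E l \<and> down_bound \<phi> \<kappa> E l \<and> 0 \<le> k \<and> \<bar>3 * k - \<kappa> * real l\<bar> \<le> E \<and>
     (\<forall>v\<in>A.U l w. \<forall>p\<in>A.D l v. \<bar>h' (\<phi> v) - h' (\<phi> p) - k\<bar> \<le> E)"

lemma flip_both: "box_pair X (\<lambda>z. - h z) (\<lambda>z w. - c z w) (\<lambda>z w. - b z w) n m
   Y (\<lambda>z. - h' z) (\<lambda>z w. - c' z w) (\<lambda>z w. - b' z w) n' m' M"
  using A.flip B.flip by (rule box_pair.intro)

lemma good_box_flip:
  assumes "good_box \<phi> \<kappa> E l k w" "v \<in> A.U l w"
  shows "box_pair.good_box X (\<lambda>z. - h z) (\<lambda>z w. - c z w) (\<lambda>z w. - b z w) n m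
     (\<lambda>z. - h' z) (\<lambda>z w. - c' z w) (\<lambda>z w. - b' z w) \<phi> \<kappa> E l k v"
proof -
  interpret F: box_pair X "\<lambda>z. - h z" "\<lambda>z w. - c z w" "\<lambda>z w. - b z w" n m
     Y "\<lambda>z. - h' z" "\<lambda>z w. - c' z w" "\<lambda>z w. - b' z w" n' m' M by (rule flip_both)
  have w: "w \<in> X" using assms(1) unfolding good_box_def by blast
  have v: "v \<in> X" using assms(2) A.up_sub by blast
  have "\<bar>- h' (\<phi> p) - - h' (\<phi> u) - k\<bar> \<le> E" if p: "p \<in> A.D l v" and u: "u \<in> A.U l p" for p u
  proof -
    have "u \<in> A.U l w" using A.down_tops[OF w assms(2) p] u by simp
    moreover have "p \<in> A.D l u" using u A.up_down[of p u l] p A.up_sub by blast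
    ultimately show ?thesis using assms(1) unfolding good_box_def by force
  qed
  then show ?thesis using assms(1) v unfolding good_box_def F.good_box_def by simp
qed

lemma good_box_height:
  assumes gb: "good_box \<phi> \<kappa> E l k w" and qi: "qi L \<phi>" and z: "A.in_box l w z" "h z = h w + real j"
  shows "\<bar>h' (\<phi> z) - h' (\<phi> w) - \<kappa> / 3 * real j\<bar> \<le> 3 * E"
proof -
  have w: "w \<in> X" and ub: "up_bound \<phi> \<kappa> E l" and db: "down_bound \<phi> \<kappa> E l" and k: "\<bar>3 * k - \<kappa> * real l\<bar> \<le> E"
    and V: "\<And>v p. v \<in> A.U l w \<Longrightarrow> p \<in> A.D l v \<Longrightarrow> \<bar>h' (\<phi> v) - h' (\<phi> p) - k\<bar> \<le> E"
    using gb unfolding good_box_def by blast+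
  have zX: "z \<in> X" using z(1) unfolding A.in_box_def by blast
  have jl: "j \<le> l" using A.in_box_level[OF w z(1)] z(2) by force
  obtain v0 where v0: "v0 \<in> A.U l w" using A.up_ne[OF w] by blast
  have v0X: "v0 \<in> X" using v0 A.up_sub by blast
  have wv0: "w \<in> A.D l v0" using A.up_down[OF w v0X] v0 by blast
  have "(\<Sum>p\<in>A.D j z. B.dd (\<phi> z) (\<phi> p)) \<le> (\<kappa> * real j + E) * real (card (A.D j z))"
    using db zX jl A.card_down[OF zX] unfolding slope_bound_def by auto
  then obtain p where p: "p \<in> A.D j z" "B.dd (\<phi> z) (\<phi> p) \<le> \<kappa> * real j + E"
    using exists_le_average[OF A.finite_down[OF zX] A.down_ne[OF zX]] by metis
  have "(\<Sum>v\<in>A.U (l - j) z. B.dd (\<phi> z) (\<phi> v)) \<le> (\<kappa> * real (l - j) + E) * real (card (A.U (l - j) z))"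
    using ub zX A.card_up[OF zX] unfolding slope_bound_def by auto
  then obtain v where v: "v \<in> A.U (l - j) z" "B.dd (\<phi> z) (\<phi> v) \<le> \<kappa> * real (l - j) + E"
    using exists_le_average[OF A.finite_up[OF zX] A.up_ne[OF zX]] by metis
  have pb: "A.in_box l w p" "p \<in> X" "h p = h w"
    using A.in_box_down[OF w z order.refl p(1)] z(2) by simp_all
  have vb: "A.in_box l w v" "v \<in> X" "h v = h w + real l"
    using A.in_box_up[OF w z _ v(1)] z(2) jl by (simp_all add: of_nat_diff)
  have vt: "v \<in> A.U l w" by (rule A.in_box_top[OF w vb(1,3)])
  have pt: "p \<in> A.D l v0" by (rule A.in_box_bottom[OF w pb(1,3) v0])
  have wt: "w \<in> A.D l v" using A.up_down[OF w vb(2)] vt by blast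
  have Y: "\<phi> z \<in> Y" "\<phi> p \<in> Y" "\<phi> v \<in> Y" using qiD(2)[OF qi] zX pb vb by auto
  have 1: "3 * h' (\<phi> z) - 3 * h' (\<phi> p) \<le> \<kappa> * real j + E"
    using p(2) B.nu_nonneg[OF Y(1,2)] B.dd_lower(1)[of "\<phi> z" "\<phi> p"] by linarith
  have 2: "3 * h' (\<phi> v) - 3 * h' (\<phi> z) \<le> \<kappa> * real (l - j) + E"
    using v(2) B.nu_nonneg[OF Y(1,3)] B.dd_lower(2)[of "\<phi> v" "\<phi> z"] by linarith
  have 3: "\<bar>h' (\<phi> v0) - h' (\<phi> p) - k\<bar> \<le> E" "\<bar>h' (\<phi> v0) - h' (\<phi> w) - k\<bar> \<le> E" "\<bar>h' (\<phi> v) - h' (\<phi> w) - k\<bar> \<le> E"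
    using V v0 pt wv0 vt wt by blast+
  define kl where "kl = \<kappa> * real l"
  define kj where "kj = \<kappa> * real j"
  have 4: "\<kappa> * real (l - j) = kl - kj" unfolding kl_def kj_def using jl by (simp add: of_nat_diff algebra_simps)
  have "\<bar>h' (\<phi> z) - h' (\<phi> w) - kj / 3\<bar> \<le> 3 * E"
  proof -
    have "0 \<le> E" using 3 by linarith
    moreover have "h' (\<phi> z) \<le> h' (\<phi> p) + (kj + E) / 3" using 1 unfolding kj_def[symmetric] by argo
    moreover have "h' (\<phi> p) \<le> h' (\<phi> w) + 2 * E" using 3(1,2) by linarith
    moreover have "h' (\<phi> v) - (kl - kj + E) / 3 \<le> h' (\<phi> z)" using 2 unfolding 4 by argo
    moreover have "h' (\<phi> w) + k - E \<le> h' (\<phi> v)" using 3(3) by linarith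
    moreover have "(kl - E) / 3 \<le> k" using k unfolding kl_def[symmetric] by argo
    ultimately show ?thesis by argo
  qed
  then show ?thesis unfolding kj_def by simp
qed

lemma good_box_down:
  assumes gb: "good_box \<phi> \<kappa> E l k w" and qi: "qi L \<phi>" and z: "A.in_box l w z" "h z = h w + real j" and i: "i \<le> j"
  obtains u where "u \<in> A.D i z" "B.nu (\<phi> z) (\<phi> u) \<le> 5 * E"
proof -
  have w: "w \<in> X" and db: "down_bound \<phi> \<kappa> E l" using gb unfolding good_box_def by blast+
  have zX: "z \<in> X" using z(1) unfolding A.in_box_def by blast
  have jl: "j \<le> l" using A.in_box_level[OF w z(1)] z(2) by force
  have "(\<Sum>p\<in>A.D i z. B.dd (\<phi> z) (\<phi> p)) \<le> (\<kappa> * real i + E) * real (card (A.D i z))"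
    using db zX jl i A.card_down[OF zX] unfolding slope_bound_def by auto
  then obtain u where u: "u \<in> A.D i z" "B.dd (\<phi> z) (\<phi> u) \<le> \<kappa> * real i + E"
    using exists_le_average[OF A.finite_down[OF zX] A.down_ne[OF zX]] by metis
  have ub: "A.in_box l w u" "h u = h w + real (j - i)"
    using A.in_box_down[OF w z i u(1)] z(2) i by (simp_all add: of_nat_diff)
  define x where "x = \<kappa> / 3 * real i"
  have "\<kappa> / 3 * real (j - i) = \<kappa> / 3 * real j - x"
    unfolding x_def using i by (simp add: of_nat_diff right_diff_distrib)
  then have "h' (\<phi> z) - h' (\<phi> u) \<ge> x - 6 * E"
    using good_box_height[OF gb qi z] good_box_height[OF gb qi ub] by linarith
  moreover have "\<kappa> * real i = 3 * x" unfolding x_def by simp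
  ultimately have "4 * B.nu (\<phi> z) (\<phi> u) \<le> 19 * E" using u(2) B.dd_lower(1)[of "\<phi> z" "\<phi> u"] by linarith
  moreover have "0 \<le> E" using gb unfolding good_box_def by linarith
  ultimately show ?thesis using that[OF u(1)] by linarith
qed

lemma good_box_same_b:
  assumes gb: "good_box \<phi> \<kappa> E l k w" and qi: "qi L \<phi>" and z: "A.in_box l w z" and y: "A.in_box l w y"
    and eq: "h y = h z" "h z \<le> b z y" and k: "0 \<le> \<kappa>"
  shows "h' (\<phi> z) - 22 * E \<le> b' (\<phi> z) (\<phi> y)"
proof -
  have w: "w \<in> X" and ub: "up_bound \<phi> \<kappa> E l" using gb unfolding good_box_def by blast+
  have X: "z \<in> X" "y \<in> X" using z y unfolding A.in_box_def by blast+
  obtain j where j: "j \<le> l" "h z = h w + real j" using A.in_box_level[OF w z] .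
  define i where "i = l - j"
  have ij: "j + i = l" unfolding i_def using j by simp
  have ijr: "real l = real j + real i" using ij by (metis of_nat_add)
  have cz: "c z w \<le> h w + real l" "c y w \<le> h w + real l" using z y unfolding A.in_box_def by blast+
  have "c z y \<le> h z + real i"
    using A.ultra_cases(2)[OF X(1) w X(2)] cz A.bc(6)[OF X(2) w] j(2) ijr by linarith
  then have Ui: "A.U i z = A.U i y" using A.up_common[OF X] eq by simp
  have "(\<Sum>v\<in>A.U i x. B.dd (\<phi> x) (\<phi> v)) \<le> (\<kappa> * real i + E) * real (card (A.U i x))" if "x \<in> X" for x
    using ub that ij A.card_up[OF that] unfolding slope_bound_def by auto
  from this[OF X(1)] this[OF X(2)]
  have "(\<Sum>v\<in>A.U i z. B.dd (\<phi> z) (\<phi> v) + B.dd (\<phi> y) (\<phi> v)) \<le> (2 * \<kappa> * real i + 2 * E) * real (card (A.U i z))"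
    unfolding sum.distrib Ui by (simp add: algebra_simps)
  then obtain v where v: "v \<in> A.U i z" "B.dd (\<phi> z) (\<phi> v) + B.dd (\<phi> y) (\<phi> v) \<le> 2 * \<kappa> * real i + 2 * E"
    by (rule exists_le_average[OF A.finite_up[OF X(1)] A.up_ne[OF X(1)]])
  have vb: "A.in_box l w v" "v \<in> X" "h v = h w + real l"
    using A.in_box_up[OF w z j(2) _ v(1)] ij j(2) ijr by simp_all
  have Y: "\<phi> z \<in> Y" "\<phi> y \<in> Y" "\<phi> v \<in> Y" using qiD(2)[OF qi] X vb by auto
  have E0: "0 \<le> E" using gb unfolding good_box_def by linarith
  define x where "x = \<kappa> / 3 * real i"
  have x0: "0 \<le> x" unfolding x_def using k by simp
  have x: "\<kappa> / 3 * real l = \<kappa> / 3 * real j + x" "2 * \<kappa> * real i = 6 * x"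
    unfolding x_def ijr by (simp_all add: algebra_simps)
  have hz: "\<bar>h' (\<phi> z) - h' (\<phi> w) - \<kappa> / 3 * real j\<bar> \<le> 3 * E" by (rule good_box_height[OF gb qi z j(2)])
  have hy: "\<bar>h' (\<phi> y) - h' (\<phi> w) - \<kappa> / 3 * real j\<bar> \<le> 3 * E" using good_box_height[OF gb qi y] eq j(2) by simp
  have hv: "\<bar>h' (\<phi> v) - h' (\<phi> w) - (\<kappa> / 3 * real j + x)\<bar> \<le> 3 * E"
    using good_box_height[OF gb qi vb(1,3)] unfolding x .
  have vz: "x - 6 * E \<le> h' (\<phi> v) - h' (\<phi> z)" "x - 6 * E \<le> h' (\<phi> v) - h' (\<phi> y)" "\<bar>h' (\<phi> z) - h' (\<phi> y)\<bar> \<le> 6 * E"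
    using hz hy hv by linarith+
  have nn: "0 \<le> B.nu (\<phi> z) (\<phi> v)" "0 \<le> B.nu (\<phi> y) (\<phi> v)" using B.nu_nonneg Y by auto
  have "3 * x - 18 * E + 4 * B.nu (\<phi> z) (\<phi> v) + 3 * x - 18 * E + 4 * B.nu (\<phi> y) (\<phi> v) \<le> 6 * x + 2 * E"
    using v(2) vz(1,2) B.dd_lower(2)[of "\<phi> v" "\<phi> z"] B.dd_lower(2)[of "\<phi> v" "\<phi> y"] unfolding x(2) by linarith
  then have nu: "B.nu (\<phi> z) (\<phi> v) \<le> 10 * E" "B.nu (\<phi> y) (\<phi> v) \<le> 10 * E" using nn E0 by linarith+
  have "h' (\<phi> z) - 16 * E \<le> b' (\<phi> z) (\<phi> v)"
    using nu(1) vz(1) x0 E0 B.bc(3,4)[OF Y(1,3)] unfolding tilt_def by linarith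
  moreover have "h' (\<phi> y) - 16 * E \<le> b' (\<phi> y) (\<phi> v)"
    using nu(2) vz(2) x0 E0 B.bc(3,4)[OF Y(2,3)] unfolding tilt_def by linarith
  moreover have "h' (\<phi> z) - 6 * E \<le> h' (\<phi> y)" using vz(3) by linarith
  ultimately show ?thesis
    using B.ultra_cases(1)[OF Y(1,3,2)] B.bc(5)[OF Y(2,3)] E0 by linarith
qed

lemma good_box_same_c:
  assumes gb: "good_box \<phi> \<kappa> E l k w" and qi: "qi L \<phi>" and z: "A.in_box l w z" and y: "A.in_box l w y"
    and eq: "h y = h z" "c z y \<le> h z" and k: "0 \<le> \<kappa>"
  shows "c' (\<phi> z) (\<phi> y) \<le> h' (\<phi> z) + 22 * E"
proof -
  interpret F: box_pair X "\<lambda>z. - h z" "\<lambda>z w. - c z w" "\<lambda>z w. - b z w" n m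
     Y "\<lambda>z. - h' z" "\<lambda>z w. - c' z w" "\<lambda>z w. - b' z w" n' m' M by (rule flip_both)
  have w: "w \<in> X" using gb unfolding good_box_def by blast
  obtain v where v: "v \<in> A.U l w" using A.up_ne[OF w] by blast
  have X: "z \<in> X" "y \<in> X" using z y unfolding A.in_box_def by blast+
  have "F.A.in_box l v z" "F.A.in_box l v y"
    using z y X A.in_box_flip[OF w v] unfolding F.A.in_box_def by auto
  from F.good_box_same_b[OF good_box_flip[OF gb v] _ this, of L]
  have "- h' (\<phi> z) - 22 * E \<le> - c' (\<phi> z) (\<phi> y)" using qi eq k by simp
  then show ?thesis by linarith
qed

lemma good_box_b:
  assumes gb: "good_box \<phi> \<kappa> E l k w" and qi: "qi L \<phi>" and z: "A.in_box l w z" and y: "A.in_box l w y"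
    and k: "0 \<le> \<kappa>" and eta: "0 \<le> \<eta>" and b': "min (h' (\<phi> z)) (h' (\<phi> y)) - \<eta> \<le> b' (\<phi> z) (\<phi> y)"
  shows "min (h z) (h y) - (L * (56 * E + \<eta>) + L) \<le> b z y"
proof -
  have w: "w \<in> X" using gb unfolding good_box_def by blast
  have X: "z \<in> X" "y \<in> X" using z y unfolding A.in_box_def by blast+
  have E0: "0 \<le> E" using gb unfolding good_box_def by linarith
  have L1: "1 \<le> L" using qiD(1)[OF qi] .
  obtain jz where jz: "jz \<le> l" "h z = h w + real jz" using A.in_box_level[OF w z] .
  obtain jy where jy: "jy \<le> l" "h y = h w + real jy" using A.in_box_level[OF w y] .
  define j where "j = min jz jy"
  have jmin: "min (h z) (h y) = h w + real j" unfolding j_def jz jy by (simp add: min_def)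
  have j: "j \<le> jz" "j \<le> jy" unfolding j_def by auto
  obtain u where u: "u \<in> A.D (jz - j) z" "B.nu (\<phi> z) (\<phi> u) \<le> 5 * E"
    by (rule good_box_down[OF gb qi z jz(2) diff_le_self])
  obtain x where x: "x \<in> A.D (jy - j) y" "B.nu (\<phi> y) (\<phi> x) \<le> 5 * E"
    by (rule good_box_down[OF gb qi y jy(2) diff_le_self])
  have ub: "A.in_box l w u" "u \<in> X" "h u = h w + real j" "b z u = h u" "c z u = h z"
    using A.in_box_down[OF w z jz(2) _ u(1)] jz(2) j by (simp_all add: of_nat_diff)
  have xb: "A.in_box l w x" "x \<in> X" "h x = h w + real j" "b y x = h x" "c y x = h y"
    using A.in_box_down[OF w y jy(2) _ x(1)] jy(2) j by (simp_all add: of_nat_diff)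
  obtain g where g: "g \<in> X" "h g = h w + real j" "b g x = h w + real j" "c g u = h w + real j"
    using A.join[OF ub(2) xb(2), of "h w + real j"] A.h_int[OF w] ub(3) xb(3) by auto
  have "h w \<le> b x w" "c u w \<le> h w + real l" using ub(1) xb(1) unfolding A.in_box_def by blast+
  moreover have "real j \<le> real l" using jz(1) j(1) by simp
  ultimately have gb': "A.in_box l w g"
    using A.ultra_cases(1)[OF g(1) xb(2) w] A.ultra_cases(2)[OF g(1) ub(2) w] g unfolding A.in_box_def by force
  define H where "H = h' (\<phi> w) + \<kappa> / 3 * real j"
  have hu: "\<bar>h' (\<phi> u) - H\<bar> \<le> 3 * E" using good_box_height[OF gb qi ub(1,3)] unfolding H_def by linarith
  have hx: "\<bar>h' (\<phi> x) - H\<bar> \<le> 3 * E" using good_box_height[OF gb qi xb(1,3)] unfolding H_def by linarith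
  have hg: "\<bar>h' (\<phi> g) - H\<bar> \<le> 3 * E" using good_box_height[OF gb qi gb' g(2)] unfolding H_def by linarith
  have kj: "\<kappa> / 3 * real j \<le> \<kappa> / 3 * real jz" "\<kappa> / 3 * real j \<le> \<kappa> / 3 * real jy"
    using j k by (simp_all add: mult_left_mono)
  have hz: "H - 3 * E \<le> h' (\<phi> z)" using good_box_height[OF gb qi z jz(2)] kj(1) unfolding H_def by linarith
  have hy: "H - 3 * E \<le> h' (\<phi> y)" using good_box_height[OF gb qi y jy(2)] kj(2) unfolding H_def by linarith
  have Y: "\<phi> z \<in> Y" "\<phi> y \<in> Y" "\<phi> u \<in> Y" "\<phi> x \<in> Y" "\<phi> g \<in> Y" using qiD(2)[OF qi] X ub xb g by auto
  have bu: "H - 11 * E \<le> b' (\<phi> u) (\<phi> z)"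
  proof -
    have "h' (\<phi> u) - 6 * E \<le> h' (\<phi> z)" using hz hu by linarith
    then have "h' (\<phi> u) - 6 * E - 5 * E + 3 * E \<le> b' (\<phi> z) (\<phi> u) + 3 * E"
      using u(2) B.bc(3,4)[OF Y(1,3)] E0 unfolding tilt_def by linarith
    moreover have "H - 3 * E \<le> h' (\<phi> u)" using hu by linarith
    moreover have "H - 11 * E \<le> b' (\<phi> z) (\<phi> u)"
      using u(2) B.bc(3,4)[OF Y(1,3)] E0 hz calculation unfolding tilt_def by linarith
    ultimately show ?thesis using B.bc(5)[OF Y(1,3)] by linarith
  qed
  have bx: "H - 11 * E \<le> b' (\<phi> x) (\<phi> y)"
  proof -
    have "H - 3 * E \<le> h' (\<phi> x)" using hx by linarith
    then have "H - 11 * E \<le> b' (\<phi> y) (\<phi> x)"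
      using x(2) B.bc(3,4)[OF Y(2,4)] E0 hy unfolding tilt_def by linarith
    then show ?thesis using B.bc(5)[OF Y(2,4)] by linarith
  qed
  have "H - 3 * E - \<eta> \<le> b' (\<phi> z) (\<phi> y)" using b' hz hy by linarith
  then have "H - 11 * E - \<eta> \<le> b' (\<phi> u) (\<phi> y)"
    using B.ultra_cases(1)[OF Y(3,1,2)] bu E0 eta by linarith
  then have bux: "H - 11 * E - \<eta> \<le> b' (\<phi> u) (\<phi> x)"
    using B.ultra_cases(1)[OF Y(3,2,4)] bx B.bc(5)[OF Y(2,4)] E0 eta by linarith
  have "h' (\<phi> g) - 22 * E \<le> b' (\<phi> g) (\<phi> x)"
    by (rule good_box_same_b[OF gb qi gb' xb(1)]) (use xb g k in simp_all)
  then have "H - 25 * E \<le> b' (\<phi> g) (\<phi> x)" using hg by linarith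
  then have bgu: "H - 25 * E - \<eta> \<le> b' (\<phi> g) (\<phi> u)"
    using B.ultra_cases(1)[OF Y(5,4,3)] bux B.bc(5)[OF Y(3,4)] E0 eta by linarith
  have "c' (\<phi> g) (\<phi> u) \<le> h' (\<phi> g) + 22 * E"
    by (rule good_box_same_c[OF gb qi gb' ub(1)]) (use ub g k in simp_all)
  then have "B.rho (\<phi> g) (\<phi> u) \<le> 56 * E + \<eta>" using bgu hg E0 unfolding box_dist_def by linarith
  then have "L * B.rho (\<phi> g) (\<phi> u) \<le> L * (56 * E + \<eta>)" using L1 by (intro mult_left_mono) auto
  then have "A.rho g u \<le> L * (56 * E + \<eta>) + L" using qiD(4)[OF qi g(1) ub(2)] by linarith
  then have bg: "h w + real j - (L * (56 * E + \<eta>) + L) \<le> b g u" using g(4) unfolding box_dist_def by linarith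
  have nn: "0 \<le> L * (56 * E + \<eta>) + L" using L1 E0 eta by simp
  have "h w + real j - (L * (56 * E + \<eta>) + L) \<le> b z g"
    using A.ultra_cases(1)[OF X(1) ub(2) g(1)] ub bg A.bc(5)[OF g(1) ub(2)] nn by linarith
  then have "h w + real j - (L * (56 * E + \<eta>) + L) \<le> b z x"
    using A.ultra_cases(1)[OF X(1) g(1) xb(2)] g nn by linarith
  then show ?thesis
    using A.ultra_cases(1)[OF X(1) xb(2) X(2)] xb A.bc(5)[OF X(2) xb(2)] nn unfolding jmin by linarith
qed

lemma good_box_c:
  assumes gb: "good_box \<phi> \<kappa> E l k w" and qi: "qi L \<phi>" and z: "A.in_box l w z" and y: "A.in_box l w y"
    and k: "0 \<le> \<kappa>" and eta: "0 \<le> \<eta>" and c': "c' (\<phi> z) (\<phi> y) \<le> max (h' (\<phi> z)) (h' (\<phi> y)) + \<eta>"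
  shows "c z y \<le> max (h z) (h y) + (L * (56 * E + \<eta>) + L)"
proof -
  interpret F: box_pair X "\<lambda>z. - h z" "\<lambda>z w. - c z w" "\<lambda>z w. - b z w" n m
     Y "\<lambda>z. - h' z" "\<lambda>z w. - c' z w" "\<lambda>z w. - b' z w" n' m' M by (rule flip_both)
  have w: "w \<in> X" using gb unfolding good_box_def by blast
  obtain v where v: "v \<in> A.U l w" using A.up_ne[OF w] by blast
  have X: "z \<in> X" "y \<in> X" using z y unfolding A.in_box_def by blast+
  have "F.A.in_box l v z" "F.A.in_box l v y"
    using z y X A.in_box_flip[OF w v] unfolding F.A.in_box_def by auto
  have "min (- h' (\<phi> z)) (- h' (\<phi> y)) - \<eta> \<le> - c' (\<phi> z) (\<phi> y)" using c' by linarith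
  then have "min (- h z) (- h y) - (L * (56 * E + \<eta>) + L) \<le> - c z y"
    using F.good_box_b[OF good_box_flip[OF gb v] _ \<open>F.A.in_box l v z\<close> \<open>F.A.in_box l v y\<close> k eta, of L] qi by simp
  then show ?thesis by linarith
qed

end

context box_space
begin

lemma vertical_b:
  assumes "z \<in> X" "y \<in> X" "rho z y = \<bar>h z - h y\<bar>" shows "b z y = min (h z) (h y)" "c z y = max (h z) (h y)"
  using assms(3) bc(1-4)[OF assms(1,2)] unfolding box_dist_def by argo+

lemma near_vertical:
  assumes "z \<in> X" "y \<in> X" "x \<in> X" "rho z y = \<bar>h z - h y\<bar>" "rho y x \<le> L"
  shows "min (h z) (h x) - L \<le> b z x" "c z x \<le> max (h z) (h x) + L"
proof -
  have v: "b z y = min (h z) (h y)" "c z y = max (h z) (h y)" by (rule vertical_b[OF assms(1,2,4)])+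
  have d: "c y x - b y x \<le> L" using assms(5) unfolding box_dist_def .
  show "min (h z) (h x) - L \<le> b z x"
    using ultra_cases(1)[OF assms(1-3)] v(1) d bc(1-4)[OF assms(2,3)] by argo
  show "c z x \<le> max (h z) (h x) + L"
    using ultra_cases(2)[OF assms(1-3)] v(2) d bc(1-4)[OF assms(2,3)] by argo
qed

lemma vertex_dist_tri:
  assumes "z \<in> X" "w \<in> X" "u \<in> X"
  shows "2 * rho z u - \<bar>h z - h u\<bar> \<le> (2 * rho z w - \<bar>h z - h w\<bar>) + (2 * rho w u - \<bar>h w - h u\<bar>)"
  unfolding box_dist_def using b_ultra[OF assms] c_ultra[OF assms] bc(1-4)[OF assms(1,2)] bc(1-4)[OF assms(2,3)]
  by argo

text \<open>Along a path that is almost geodesic for \<open>mixed_dist\<close>, the intervals \<open>[b, c]\<close> swept by three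
  consecutive pieces have almost disjoint interiors, so the middle piece must be almost vertical.\<close>

lemma middle_vertical:
  assumes X: "x0 \<in> X" "x1 \<in> X" "x2 \<in> X" "x3 \<in> X" and r: "0 < r" "r \<le> rho x0 x1" "r \<le> rho x2 x3" and S: "rho x1 x2 \<le> S"
  shows "nu x1 x2 \<le> (1 + S / r) * (dd x0 x1 + dd x1 x2 + dd x2 x3 - dd x0 x3)"
proof -
  define \<Delta> where "\<Delta> = dd x0 x1 + dd x1 x2 + dd x2 x3 - dd x0 x3"
  have D0: "0 \<le> \<Delta>" unfolding \<Delta>_def using dd_tri[OF X(1,2,4)] dd_tri[OF X(2,3,4)] by linarith
  have S0: "0 \<le> S" using S rho_ge[OF X(2,3)] by linarith
  have nn: "nu x1 x2 \<le> S" using S unfolding tilt_def box_dist_def by linarith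
  show ?thesis
  proof (cases "\<Delta> < r")
    case False
    have "S \<le> (S / r) * \<Delta>" using False r(1) S0 by (simp add: field_simps mult_left_mono)
    also have "\<dots> \<le> (1 + S / r) * \<Delta>" using D0 by (intro mult_right_mono) auto
    finally show ?thesis using nn unfolding \<Delta>_def by linarith
  next
    case True
    have dd: "dd z w = 4 * rho z w - \<bar>h z - h w\<bar>" for z w unfolding mixed_dist_def box_dist_def by simp
    have "2 * (rho x0 x1 + rho x1 x2 + rho x2 x3 - rho x0 x3) \<le> \<Delta>"
      using vertex_dist_tri[OF X(1,2,4)] vertex_dist_tri[OF X(2,3,4)] unfolding \<Delta>_def dd by argo
    then have e: "2 * (c x0 x1 - b x0 x1 + (c x1 x2 - b x1 x2) + (c x2 x3 - b x2 x3) - (c x0 x3 - b x0 x3)) \<le> \<Delta>"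
      unfolding box_dist_def .
    have rr: "\<Delta> < c x0 x1 - b x0 x1" "\<Delta> < c x2 x3 - b x2 x3" using r True unfolding box_dist_def by linarith+
    have bb: "min (b x0 x1) (min (b x1 x2) (b x2 x3)) \<le> b x0 x3"
      using b_ultra[OF X(1,2,4)] b_ultra[OF X(2,3,4)] by argo
    have cc: "c x0 x3 \<le> max (c x0 x1) (max (c x1 x2) (c x2 x3))"
      using c_ultra[OF X(1,2,4)] c_ultra[OF X(2,3,4)] by argo
    have "c x1 x2 - b x1 x2 - \<bar>h x1 - h x2\<bar> \<le> \<Delta>"
      using e rr bb cc D0 bc(1-4)[OF X(1,2)] bc(1-4)[OF X(2,3)] bc(1-4)[OF X(3,4)] by argo
    moreover have "\<Delta> \<le> (1 + S / r) * \<Delta>"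
      using mult_right_mono[of 1 "1 + S / r" \<Delta>] D0 S0 r(1) by simp
    ultimately show ?thesis unfolding tilt_def \<Delta>_def[symmetric] by linarith
  qed
qed

end

context box_pair
begin

lemma good_box_count:
  assumes gb: "good_box \<phi> \<kappa> E l k w" and qi: "qi L \<phi>" and k: "3 \<le> \<kappa>" and z: "z \<in> A.U (l div 2) w"
    and s: "L * (real s + L) + L \<le> real l / 2 - 1"
    and Z: "finite Z" "Z \<subseteq> Y" "\<And>y. y \<in> Z \<Longrightarrow> B.rho (\<phi> z) y = \<bar>h' (\<phi> z) - h' y\<bar> \<and> B.rho (\<phi> z) y \<le> real s"
  shows "real (card Z) \<le> ball_bound M (real s * (3 / \<kappa>) + L + 6 * E + 2 * (L * (56 * E + L) + L)) * ball_bound M L"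
proof -
  define R where "R = real s * (3 / \<kappa>) + L + 6 * E + 2 * (L * (56 * E + L) + L)"
  have w: "w \<in> X" using gb unfolding good_box_def by blast
  have E0: "0 \<le> E" using gb unfolding good_box_def by linarith
  have L1: "1 \<le> L" using qiD(1)[OF qi] .
  have zX: "z \<in> X" using z A.up_sub by blast
  have zw: "h z = h w + real (l div 2)" "b w z = h w" "c w z = h z" using z unfolding A.up_iff[OF w] by blast+
  have l2: "2 * real (l div 2) \<le> real l" "real l - 1 \<le> 2 * real (l div 2)" by linarith+
  have zb: "A.in_box l w z" unfolding A.in_box_def using zX zw A.bc(5,6)[OF w zX] l2 by linarith
  have zY: "\<phi> z \<in> Y" using qiD(2)[OF qi zX] .
  have near: "\<exists>x\<in>X. B.rho (\<phi> x) y \<le> L \<and> A.rho z x \<le> R" if y: "y \<in> Z" for y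
  proof -
    have yY: "y \<in> Y" using y Z(2) by blast
    obtain x where x: "x \<in> X" "B.rho y (\<phi> x) \<le> L" using qiD(5)[OF qi yY] by blast
    have xY: "\<phi> x \<in> Y" using qiD(2)[OF qi x(1)] .
    have yz: "B.rho (\<phi> z) y = \<bar>h' (\<phi> z) - h' y\<bar>" "B.rho (\<phi> z) y \<le> real s" using Z(3)[OF y] by blast+
    have rzx: "B.rho (\<phi> z) (\<phi> x) \<le> real s + L" using B.rho_tri[OF zY yY xY] yz x(2) by linarith
    have "L * B.rho (\<phi> z) (\<phi> x) \<le> L * (real s + L)" using rzx L1 by (intro mult_left_mono) auto
    then have "A.rho z x \<le> real l / 2 - 1" using qiD(4)[OF qi zX x(1)] s by linarith
    then have bcx: "c z x - b z x \<le> real l / 2 - 1" unfolding box_dist_def .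
    have xb: "A.in_box l w x"
      by (rule A.in_box_near[OF w zb x(1)])
        (use bcx A.bc[OF zX x(1)] zw l2 in linarith)+
    have bz: "min (h' (\<phi> z)) (h' (\<phi> x)) - L \<le> b' (\<phi> z) (\<phi> x)" "c' (\<phi> z) (\<phi> x) \<le> max (h' (\<phi> z)) (h' (\<phi> x)) + L"
      using B.near_vertical[OF zY yY xY yz(1) x(2)] by blast+
    have b1: "min (h z) (h x) - (L * (56 * E + L) + L) \<le> b z x"
      by (rule good_box_b[OF gb qi zb xb _ _ bz(1)]) (use k L1 in auto)
    have c1: "c z x \<le> max (h z) (h x) + (L * (56 * E + L) + L)"
      by (rule good_box_c[OF gb qi zb xb _ _ bz(2)]) (use k L1 in auto)
    obtain j where j: "j \<le> l" "h x = h w + real j" using A.in_box_level[OF w xb] .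
    have "\<bar>h' (\<phi> z) - h' (\<phi> x)\<bar> \<le> real s + L" using B.rho_ge[OF zY xY] rzx by linarith
    then have "\<bar>\<kappa> / 3 * real (l div 2) - \<kappa> / 3 * real j\<bar> \<le> real s + L + 6 * E"
      using good_box_height[OF gb qi zb zw(1)] good_box_height[OF gb qi xb j(2)] by argo
    moreover have "\<kappa> / 3 * real (l div 2) - \<kappa> / 3 * real j = \<kappa> / 3 * (h z - h x)"
      unfolding zw(1) j(2) by (simp add: algebra_simps)
    ultimately have "\<kappa> / 3 * \<bar>h z - h x\<bar> \<le> real s + L + 6 * E" using k by (simp add: abs_mult)
    then have "(3 / \<kappa>) * (\<kappa> / 3 * \<bar>h z - h x\<bar>) \<le> (3 / \<kappa>) * (real s + L + 6 * E)"
      using k by (intro mult_left_mono) auto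
    then have "\<bar>h z - h x\<bar> \<le> real s * (3 / \<kappa>) + (3 / \<kappa>) * (L + 6 * E)" using k by (simp add: algebra_simps)
    moreover have "(3 / \<kappa>) * (L + 6 * E) \<le> L + 6 * E"
      using mult_right_mono[of "3 / \<kappa>" 1 "L + 6 * E"] k L1 E0 by simp
    ultimately have "\<bar>h z - h x\<bar> \<le> real s * (3 / \<kappa>) + L + 6 * E" by linarith
    then have "A.rho z x \<le> R" using b1 c1 unfolding R_def box_dist_def by argo
    moreover have "B.rho (\<phi> x) y \<le> L" using x(2) B.rho_sym[OF yY xY] by simp
    ultimately show ?thesis using x(1) by blast
  qed
  define Q where "Q = {x \<in> X. A.rho z x \<le> R}"
  have R0: "0 \<le> R" unfolding R_def using k L1 E0 by simp
  have Q: "finite Q" "real (card Q) \<le> ball_bound M R"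
    using A.card_ball_real[OF zX R0, of Q] unfolding Q_def by auto
  define T where "T x = {y \<in> Z. B.rho (\<phi> x) y \<le> L}" for x
  have T: "real (card (T x)) \<le> ball_bound M L" if "x \<in> Q" for x
  proof -
    have "\<phi> x \<in> Y" using that qiD(2)[OF qi] unfolding Q_def by blast
    then show ?thesis using B.card_ball_real(2)[of "\<phi> x" L "T x"] L1 Z(2) unfolding T_def by auto
  qed
  have "Z \<subseteq> (\<Union>x\<in>Q. T x)" using near unfolding Q_def T_def by blast
  then have "card Z \<le> card (\<Union>x\<in>Q. T x)" using Q(1) Z(1) unfolding T_def by (intro card_mono) auto
  also have "\<dots> \<le> (\<Sum>x\<in>Q. card (T x))" by (rule card_UN_le[OF Q(1)])
  finally have "real (card Z) \<le> (\<Sum>x\<in>Q. real (card (T x)))" by (metis of_nat_mono of_nat_sum)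
  also have "\<dots> \<le> (\<Sum>x\<in>Q. ball_bound M L)" by (intro sum_mono T)
  also have "\<dots> = real (card Q) * ball_bound M L" by simp
  also have "\<dots> \<le> ball_bound M R * ball_bound M L" using Q(2) by (intro mult_right_mono ball_bound_nonneg)
  finally show ?thesis unfolding R_def .
qed

lemma good_box_mono:
  assumes "good_box \<phi> \<kappa> E l k w" "E \<le> E'" shows "good_box \<phi> \<kappa> E' l k w"
proof -
  have "up_bound \<phi> \<kappa> E' l" "down_bound \<phi> \<kappa> E' l"
    using assms slope_bound_mono unfolding good_box_def by blast+
  then show ?thesis using assms unfolding good_box_def by (meson order_trans)
qed

lemma no_steep_box:
  assumes L: "1 \<le> L" and k: "3 < \<kappa>" and M: "M = m' \<or> M = n'"
  shows "\<exists>\<epsilon>>0. \<epsilon> \<le> 1 \<and> (\<exists>l0. \<forall>l\<ge>l0. \<forall>\<phi> k w. qi L \<phi> \<longrightarrow> \<not> good_box \<phi> \<kappa> (\<epsilon> * real l) l k w)"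
proof -
  define \<theta> where "\<theta> = 1 - 3 / \<kappa>"
  have th: "0 < \<theta>" "\<theta> \<le> 1" "3 / \<kappa> = 1 - \<theta>" unfolding \<theta>_def using k by auto
  define \<epsilon> where "\<epsilon> = \<theta> / (32 * L * (6 + 112 * L))"
  have eps: "0 < \<epsilon>" unfolding \<epsilon>_def using th L by simp
  have epsL: "(6 + 112 * L) * \<epsilon> = \<theta> / (32 * L)"
  proof -
    have "6 + 112 * L \<noteq> 0" using L by simp
    then show ?thesis unfolding \<epsilon>_def by simp
  qed
  have eps1: "\<epsilon> \<le> 1"
  proof -
    have "6 * \<epsilon> \<le> (6 + 112 * L) * \<epsilon>" using eps L by (intro mult_right_mono) auto
    also have "\<dots> \<le> 1" unfolding epsL using th L by (simp add: field_simps)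
    finally show ?thesis using eps by linarith
  qed
  define C where "C = L + 2 * L * L + 2 * L + 2"
  have C0: "0 \<le> C" unfolding C_def using L by simp
  define K where "K = (C + 9 + 112 * L)\<^sup>2 * ball_bound M L * real M powr C"
  define a where "a = \<theta> / (16 * L)"
  have a: "0 < a" unfolding a_def using th L by simp
  have M2: "2 \<le> M" by (rule A.M_ge_2)
  obtain l1 where l1: "\<And>l. l \<ge> l1 \<Longrightarrow> K * (real l + 1) ^ 3 * 2 powr (- (a * real l)) \<le> 1 / 2"
    using exp_beats_cubic[OF a, of "1 / 2" K] by auto
  define l0 where "l0 = max l1 (nat \<lceil>8 * (L * L + L + 1)\<rceil>)"
  show ?thesis
  proof (rule exI[of _ \<epsilon>], intro conjI eps eps1, rule exI[of _ l0], intro allI impI notI)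
    fix l \<phi> kk w assume l: "l0 \<le> l" and qi: "qi L \<phi>" and gb: "good_box \<phi> \<kappa> (\<epsilon> * real l) l kk w"
    have ll: "l1 \<le> l" "8 * (L * L + L + 1) \<le> real l" using l unfolding l0_def by linarith+
    have w: "w \<in> X" using gb unfolding good_box_def by blast
    define s where "s = nat \<lfloor>real l / (8 * L)\<rfloor>"
    have "0 \<le> real l / (8 * L)" using L by simp
    then have s: "real s \<le> real l / (8 * L)" "real l / (8 * L) - 1 \<le> real s"
      unfolding s_def by linarith+
    have "L * real s \<le> L * (real l / (8 * L))" using s(1) L by (intro mult_left_mono) auto
    then have Ls: "L * real s \<le> real l / 8" using L by simp
    then have sL: "L * (real s + L) + L \<le> real l / 2 - 1" using ll(2) by (simp add: algebra_simps)
    have "real s \<le> L * real s" using L by (simp add: mult_le_cancel_right1)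
    then have sl: "real s \<le> real l" using Ls by linarith
    obtain z where z: "z \<in> A.U (l div 2) w" using A.up_ne[OF w] by blast
    then have zY: "\<phi> z \<in> Y" using A.up_sub qiD(2)[OF qi] by blast
    define R where "R = real s * (3 / \<kappa>) + L + 6 * (\<epsilon> * real l) + 2 * (L * (56 * (\<epsilon> * real l) + L) + L)"
    have *: "real (card Z) \<le> ball_bound M R * ball_bound M L"
      if "finite Z" "Z \<subseteq> Y" "\<And>y. y \<in> Z \<Longrightarrow> B.rho (\<phi> z) y = \<bar>h' (\<phi> z) - h' y\<bar> \<and> B.rho (\<phi> z) y \<le> real s" for Z
      unfolding R_def by (rule good_box_count[OF gb qi _ z sL that]) (use k in simp)
    have "real M ^ s \<le> ball_bound M R * ball_bound M L"
      using M
    proof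
      assume M: "M = m'"
      have "real (card (B.U s (\<phi> z))) \<le> ball_bound M R * ball_bound M L"
      proof (rule *)
        show "B.rho (\<phi> z) y = \<bar>h' (\<phi> z) - h' y\<bar> \<and> B.rho (\<phi> z) y \<le> real s" if "y \<in> B.U s (\<phi> z)" for y
          using that unfolding B.up_iff[OF zY] box_dist_def by auto
      qed (use B.finite_up[OF zY] B.up_sub in auto)
      then show ?thesis using B.card_up[OF zY] M by simp
    next
      assume M: "M = n'"
      have "real (card (B.D s (\<phi> z))) \<le> ball_bound M R * ball_bound M L"
      proof (rule *)
        show "B.rho (\<phi> z) y = \<bar>h' (\<phi> z) - h' y\<bar> \<and> B.rho (\<phi> z) y \<le> real s" if "y \<in> B.D s (\<phi> z)" for y
          using that unfolding B.down_iff[OF zY] box_dist_def by auto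
      qed (use B.finite_down[OF zY] B.up_sub in auto)
      then show ?thesis using B.card_down[OF zY] M by simp
    qed
    then have main: "real M powr real s \<le> (R + 2)\<^sup>2 * real M powr (R + 1) * ball_bound M L"
      unfolding ball_bound_def[of M R] using M2 by (simp add: powr_realpow)
    have Req: "R = real s * (1 - \<theta>) + (6 + 112 * L) * \<epsilon> * real l + (C - 2)"
      unfolding R_def th(3) C_def by (simp add: algebra_simps)
    have R1: "R + 1 - real s \<le> C - a * real l"
    proof -
      have "\<theta> * (real l / (8 * L) - 1) \<le> \<theta> * real s" using s(2) th by (intro mult_left_mono) auto
      then have "\<theta> * real l / (8 * L) - \<theta> \<le> \<theta> * real s" by (simp add: algebra_simps)
      moreover have "\<theta> * real l / (8 * L) = 4 * (\<theta> / (32 * L) * real l)" using L by simp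
      moreover have "a * real l = 2 * (\<theta> / (32 * L) * real l)" unfolding a_def using L by simp
      moreover have "0 \<le> \<theta> / (32 * L) * real l" using th L by simp
      moreover have "R = real s - \<theta> * real s + \<theta> / (32 * L) * real l + (C - 2)"
        unfolding Req epsL by (simp add: algebra_simps)
      ultimately show ?thesis using th(2) by linarith
    qed
    have R2: "R + 2 \<le> (C + 9 + 112 * L) * (real l + 1)"
    proof -
      have "real s * (1 - \<theta>) \<le> real s * 1" using th by (intro mult_left_mono) auto
      moreover have "(6 + 112 * L) * \<epsilon> * real l \<le> (6 + 112 * L) * 1 * real l"
        using eps1 L by (intro mult_right_mono mult_left_mono) auto
      moreover have "0 \<le> C * real l" "0 \<le> L * real l" using C0 L by auto
      ultimately show ?thesis using sl L unfolding Req by (simp add: algebra_simps)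
    qed
    have R0: "0 \<le> R + 2" unfolding Req using th eps L C0 by simp
    have "real M powr real s \<le> ((C + 9 + 112 * L) * (real l + 1))\<^sup>2 * real M powr (R + 1) * ball_bound M L"
      by (rule order_trans[OF main]) (intro mult_right_mono power_mono R2 R0 ball_bound_nonneg, auto)
    then have "real M powr real s * real M powr (- real s) \<le>
       ((C + 9 + 112 * L) * (real l + 1))\<^sup>2 * real M powr (R + 1) * ball_bound M L * real M powr (- real s)"
      by (intro mult_right_mono) auto
    moreover have "real M powr real s * real M powr (- real s) = 1" using M2 by (simp add: powr_add[symmetric])
    ultimately have "1 \<le> ((C + 9 + 112 * L) * (real l + 1))\<^sup>2 * real M powr (R + 1) * ball_bound M L * real M powr (- real s)"
      by linarith
    also have "\<dots> = ((C + 9 + 112 * L) * (real l + 1))\<^sup>2 * ball_bound M L * (real M powr (R + 1) * real M powr (- real s))"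
      by (simp only: mult_ac)
    also have "real M powr (R + 1) * real M powr (- real s) = real M powr (R + 1 - real s)"
      by (simp add: powr_add[symmetric])
    also have "((C + 9 + 112 * L) * (real l + 1))\<^sup>2 * ball_bound M L * real M powr (R + 1 - real s) \<le>
      ((C + 9 + 112 * L) * (real l + 1))\<^sup>2 * ball_bound M L * (real M powr C * 2 powr (- (a * real l)))"
    proof (intro mult_left_mono)
      have "real M powr (R + 1 - real s) \<le> real M powr (C - a * real l)" using R1 M2 by (intro powr_mono) auto
      also have "\<dots> = real M powr C * real M powr (- (a * real l))" by (simp add: powr_add[symmetric])
      also have "real M powr (- (a * real l)) \<le> 2 powr (- (a * real l))"
        using M2 a by (intro powr_mono2') auto
      finally show "real M powr (R + 1 - real s) \<le> real M powr C * 2 powr (- (a * real l))"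
        by (simp add: mult_left_mono)
    qed (simp add: ball_bound_nonneg)
    also have "\<dots> = K * (real l + 1) ^ 2 * 2 powr (- (a * real l))"
      unfolding K_def by (simp add: power_mult_distrib)
    also have "\<dots> \<le> K * (real l + 1) ^ 3 * 2 powr (- (a * real l))"
    proof (intro mult_right_mono mult_left_mono)
      show "(real l + 1) ^ 2 \<le> (real l + 1) ^ 3" by (intro power_increasing) auto
      show "0 \<le> K" unfolding K_def by (simp add: ball_bound_nonneg)
    qed simp
    also have "\<dots> \<le> 1 / 2" by (rule l1[OF ll(1)])
    finally show False by simp
  qed
qed

section \<open>The extremal slope\<close>

lemma dd_upper:
  assumes "qi L \<phi>" "z \<in> X" "v \<in> A.U j z"
  shows "B.dd (\<phi> z) (\<phi> v) \<le> 4 * L * (real j + 1)"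
proof -
  have v: "v \<in> X" "h v = h z + real j" "b z v = h z" "c z v = h v" using assms(3) unfolding A.up_iff[OF assms(2)] by auto
  then have "A.rho z v = real j" unfolding box_dist_def by simp
  then have "B.rho (\<phi> z) (\<phi> v) \<le> L * real j + L" using qiD(3)[OF assms(1,2) v(1)] by simp
  moreover have "B.dd (\<phi> z) (\<phi> v) \<le> 4 * B.rho (\<phi> z) (\<phi> v)"
    using B.dd_le qiD(2)[OF assms(1)] assms(2) v(1) by blast
  ultimately show ?thesis by (simp add: algebra_simps)
qed

lemma sum_dd_subadditive:
  assumes "qi L \<phi>" "z \<in> X"
  shows "(\<Sum>v\<in>A.U (i + j) z. B.dd (\<phi> z) (\<phi> v)) \<le>
    real m ^ j * (\<Sum>w\<in>A.U i z. B.dd (\<phi> z) (\<phi> w)) + (\<Sum>w\<in>A.U i z. \<Sum>v\<in>A.U j w. B.dd (\<phi> w) (\<phi> v))"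
proof -
  have UX: "A.U r x \<subseteq> X" for r x by (rule A.up_sub)
  have "(\<Sum>v\<in>A.U (i + j) z. B.dd (\<phi> z) (\<phi> v)) = (\<Sum>w\<in>A.U i z. \<Sum>v\<in>A.U j w. B.dd (\<phi> z) (\<phi> v))"
    by (rule A.sum_up[OF assms(2)])
  also have "\<dots> \<le> (\<Sum>w\<in>A.U i z. \<Sum>v\<in>A.U j w. B.dd (\<phi> z) (\<phi> w) + B.dd (\<phi> w) (\<phi> v))"
  proof (intro sum_mono)
    fix w v assume "w \<in> A.U i z" "v \<in> A.U j w"
    then have "w \<in> X" "v \<in> X" using UX by blast+
    then show "B.dd (\<phi> z) (\<phi> v) \<le> B.dd (\<phi> z) (\<phi> w) + B.dd (\<phi> w) (\<phi> v)"
      by (intro B.dd_tri qiD(2)[OF assms(1)] assms(2))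
  qed
  also have "\<dots> = (\<Sum>w\<in>A.U i z. real m ^ j * B.dd (\<phi> z) (\<phi> w)) + (\<Sum>w\<in>A.U i z. \<Sum>v\<in>A.U j w. B.dd (\<phi> w) (\<phi> v))"
  proof -
    have "card (A.U j w) = m ^ j" if "w \<in> A.U i z" for w using that UX A.card_up by blast
    then show ?thesis by (simp add: sum.distrib)
  qed
  finally show ?thesis by (simp add: sum_distrib_left)
qed

lemma up_bound_fekete:
  assumes qi: "qi L \<phi>" and N: "0 < N" and k: "0 \<le> \<kappa>"
    and bd: "\<And>z. z \<in> X \<Longrightarrow> (\<Sum>v\<in>A.U N z. B.dd (\<phi> z) (\<phi> v)) \<le> \<kappa> * real N * real m ^ N"
  shows "up_bound \<phi> \<kappa> (4 * L * (real N + 1)) l"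
  unfolding slope_bound_def
proof (intro ballI allI impI)
  fix z j assume z: "z \<in> X" and "j \<le> l"
  define e where "e = 4 * L * (real N + 1)"
  show "(\<Sum>v\<in>A.U j z. B.dd (\<phi> z) (\<phi> v)) \<le> (\<kappa> * real j + e) * real m ^ j"
    using z
  proof (induction j arbitrary: z rule: less_induct)
    case (less j)
    show ?case
    proof (cases "j < N")
      case True
      have "(\<Sum>v\<in>A.U j z. B.dd (\<phi> z) (\<phi> v)) \<le> (\<Sum>v\<in>A.U j z. \<kappa> * real j + e)"
      proof (rule sum_mono)
        fix v assume "v \<in> A.U j z"
        then have "B.dd (\<phi> z) (\<phi> v) \<le> 4 * L * (real j + 1)" using dd_upper[OF qi less.prems] by simp
        also have "\<dots> \<le> e" unfolding e_def using True qiD(1)[OF qi] by (intro mult_left_mono) auto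
        finally show "B.dd (\<phi> z) (\<phi> v) \<le> \<kappa> * real j + e" using k by (simp add: add_increasing)
      qed
      then show ?thesis using A.card_up[OF less.prems] by (simp add: mult.commute)
    next
      case False
      define i where "i = j - N"
      have ij: "j = N + i" "i < j" unfolding i_def using False N by auto
      have "(\<Sum>v\<in>A.U j z. B.dd (\<phi> z) (\<phi> v)) \<le>
         real m ^ i * (\<Sum>w\<in>A.U N z. B.dd (\<phi> z) (\<phi> w)) + (\<Sum>w\<in>A.U N z. \<Sum>v\<in>A.U i w. B.dd (\<phi> w) (\<phi> v))"
        unfolding ij(1) by (rule sum_dd_subadditive[OF qi less.prems])
      also have "\<dots> \<le> real m ^ i * (\<kappa> * real N * real m ^ N) + (\<Sum>w\<in>A.U N z. (\<kappa> * real i + e) * real m ^ i)"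
      proof (intro add_mono mult_left_mono sum_mono bd less.prems)
        fix w assume "w \<in> A.U N z"
        then show "(\<Sum>v\<in>A.U i w. B.dd (\<phi> w) (\<phi> v)) \<le> (\<kappa> * real i + e) * real m ^ i"
          using less.IH[OF ij(2)] A.up_sub by blast
      qed simp
      also have "\<dots> = (\<kappa> * real j + e) * real m ^ j"
        using A.card_up[OF less.prems] unfolding ij(1) by (simp add: algebra_simps power_add)
      finally show ?thesis .
    qed
  qed
qed

lemma exists_extremal:
  assumes L: "1 \<le> L" and qi: "qi L \<phi>" and l: "2 * L \<le> real l" and z: "z \<in> X" and e: "0 \<le> e"
    and bd: "up_bound \<phi> \<kappa> e (3 * l)"
    and big: "(3 * \<kappa> * real l - e) * real m ^ (3 * l) \<le> (\<Sum>v\<in>A.U (3 * l) z. B.dd (\<phi> z) (\<phi> v))"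
  shows "\<exists>w\<in>X. up_extremal \<phi> \<kappa> ((8 + 16 * L\<^sup>2) * e) l w"
proof -
  define N where "N = real m ^ l"
  have N: "0 < N" unfolding N_def using A.m_ge_2 by simp
  have N3: "real m ^ (3 * l) = N * N * N" unfolding N_def by (simp add: power_mult power3_eq_cube mult.commute[of 3])
  have UX: "A.U r x \<subseteq> X" for r x by (rule A.up_sub)
  have cU: "card (A.U l x) = m ^ l" if "x \<in> X" for x using A.card_up[OF that] .
  have bdl: "(\<Sum>v\<in>A.U l x. B.dd (\<phi> x) (\<phi> v)) \<le> (\<kappa> * real l + e) * N" if "x \<in> X" for x
  proof -
    have "l \<le> 3 * l" by simp
    then show ?thesis using bd that unfolding slope_bound_def N_def by blast
  qed
  define T where "T f = (\<Sum>x\<in>A.U l z. \<Sum>y\<in>A.U l x. \<Sum>v\<in>A.U l y. f x y v)" for f :: "'z \<Rightarrow> 'z \<Rightarrow> 'z \<Rightarrow> real"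
  have T3: "(\<Sum>v\<in>A.U (3 * l) z. g v) = T (\<lambda>x y v. g v)" for g
  proof -
    have "A.U (3 * l) z = A.U (l + (l + l)) z" by (simp add: numeral_3_eq_3)
    then have "(\<Sum>v\<in>A.U (3 * l) z. g v) = (\<Sum>x\<in>A.U l z. \<Sum>v\<in>A.U (l + l) x. g v)" using A.sum_up[OF z] by simp
    also have "\<dots> = T (\<lambda>x y v. g v)" unfolding T_def
      by (intro sum.cong HOL.refl A.sum_up) (use UX in blast)
    finally show ?thesis .
  qed
  have Tadd: "T (\<lambda>x y v. f x y v + g x y v) = T f + T g" for f g unfolding T_def by (simp add: sum.distrib)
  have Tsub: "T (\<lambda>x y v. f x y v - g x y v) = T f - T g" for f g unfolding T_def by (simp add: sum_subtractf)
  have Tmono: "T f \<le> T g" if "\<And>x y v. x \<in> X \<Longrightarrow> y \<in> X \<Longrightarrow> v \<in> X \<Longrightarrow> x \<in> A.U l z \<Longrightarrow> y \<in> A.U l x \<Longrightarrow> v \<in> A.U l y \<Longrightarrow> f x y v \<le> g x y v" for f g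
    unfolding T_def using that UX by (intro sum_mono) blast
  have Tx: "T (\<lambda>x y v. f x) = N * N * (\<Sum>x\<in>A.U l z. f x)" for f
  proof -
    have "T (\<lambda>x y v. f x) = (\<Sum>x\<in>A.U l z. N * N * f x)"
      unfolding T_def
    proof (intro sum.cong HOL.refl)
      fix x assume "x \<in> A.U l z"
      then have "x \<in> X" using UX by blast
      moreover have "card (A.U l y) = m ^ l" if "y \<in> A.U l x" for y using that UX cU by blast
      ultimately show "(\<Sum>y\<in>A.U l x. \<Sum>v\<in>A.U l y. f x) = N * N * f x" using cU unfolding N_def by simp
    qed
    then show ?thesis by (simp add: sum_distrib_left)
  qed
  have Txy: "T (\<lambda>x y v. f x y) = N * (\<Sum>x\<in>A.U l z. \<Sum>y\<in>A.U l x. f x y)" for f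
  proof -
    have "T (\<lambda>x y v. f x y) = (\<Sum>x\<in>A.U l z. \<Sum>y\<in>A.U l x. N * f x y)"
      unfolding T_def
    proof (intro sum.cong HOL.refl)
      fix x y assume "x \<in> A.U l z" "y \<in> A.U l x"
      then have "y \<in> X" using UX by blast
      then show "(\<Sum>v\<in>A.U l y. f x y) = N * f x y" using cU unfolding N_def by simp
    qed
    then show ?thesis by (simp add: sum_distrib_left)
  qed
  define d where "d x y = B.dd (\<phi> x) (\<phi> y)" for x y
  have s01: "T (\<lambda>x y v. d z x) \<le> (\<kappa> * real l + e) * (N * N * N)"
    using mult_left_mono[OF bdl[OF z], of "N * N"] N unfolding Tx d_def by (simp add: mult_ac)
  have s23: "T (\<lambda>x y v. d y v) \<le> (\<kappa> * real l + e) * (N * N * N)"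
  proof -
    have "T (\<lambda>x y v. d y v) \<le> (\<Sum>x\<in>A.U l z. \<Sum>y\<in>A.U l x. (\<kappa> * real l + e) * N)"
      unfolding T_def d_def using UX by (intro sum_mono bdl) blast
    also have "\<dots> = (\<kappa> * real l + e) * (N * N * N)"
    proof -
      have "card (A.U l x) = m ^ l" if "x \<in> A.U l z" for x using that UX cU by blast
      then show ?thesis using cU[OF z] unfolding N_def by simp
    qed
    finally show ?thesis .
  qed
  have s12: "T (\<lambda>x y v. d x y) \<le> (\<kappa> * real l + e) * (N * N * N)"
  proof -
    have "(\<Sum>x\<in>A.U l z. \<Sum>y\<in>A.U l x. d x y) \<le> (\<Sum>x\<in>A.U l z. (\<kappa> * real l + e) * N)"
      unfolding d_def using UX by (intro sum_mono bdl) blast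
    also have "\<dots> = (\<kappa> * real l + e) * (N * N)" using cU[OF z] unfolding N_def by simp
    finally show ?thesis unfolding Txy using mult_left_mono[of _ _ N] N by (simp add: mult_ac)
  qed
  have s03: "(3 * \<kappa> * real l - e) * (N * N * N) \<le> T (\<lambda>x y v. d z v)"
    using big unfolding T3 N3 d_def .
  have tri: "T (\<lambda>x y v. d z v) \<le> T (\<lambda>x y v. d z x) + T (\<lambda>x y v. d x y) + T (\<lambda>x y v. d y v)"
    unfolding Tadd[symmetric]
  proof (rule Tmono)
    fix x y v assume X: "x \<in> X" "y \<in> X" "v \<in> X"
    then have "\<phi> x \<in> Y" "\<phi> y \<in> Y" "\<phi> v \<in> Y" "\<phi> z \<in> Y" using qiD(2)[OF qi] z by auto
    then show "d z v \<le> d z x + d x y + d y v"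
      unfolding d_def using B.dd_tri[of "\<phi> z" "\<phi> x" "\<phi> v"] B.dd_tri[of "\<phi> x" "\<phi> y" "\<phi> v"] by linarith
  qed
  define q where "q = 1 + 4 * L\<^sup>2"
  have q: "1 \<le> q" unfolding q_def by simp
  have rl: "A.rho x y = real l" if "x \<in> X" "y \<in> A.U l x" for x y
    using that(2) unfolding A.up_iff[OF that(1)] box_dist_def by simp
  have "T (\<lambda>x y v. B.nu (\<phi> x) (\<phi> y)) \<le> T (\<lambda>x y v. q * (d z x + d x y + d y v - d z v))"
  proof (rule Tmono)
    fix x y v assume X: "x \<in> X" "y \<in> X" "v \<in> X" and U: "x \<in> A.U l z" "y \<in> A.U l x" "v \<in> A.U l y"
    have l0: "0 < real l" using l L by linarith
    have lo: "real l / (2 * L) \<le> B.rho (\<phi> x) (\<phi> y)" if "x \<in> X" "y \<in> X" "y \<in> A.U l x" for x y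
    proof -
      have "real l \<le> L * B.rho (\<phi> x) (\<phi> y) + L" using qiD(4)[OF qi that(1,2)] rl[OF that(1,3)] by simp
      then have "real l \<le> 2 * (L * B.rho (\<phi> x) (\<phi> y))" using l by linarith
      then show ?thesis using L by (simp add: divide_le_eq mult_ac)
    qed
    have hi: "B.rho (\<phi> x) (\<phi> y) \<le> 2 * L * real l"
    proof -
      have "L \<le> L * real l" using l L by simp
      then show ?thesis using qiD(3)[OF qi X(1,2)] rl[OF X(1) U(2)] by simp
    qed
    have "B.nu (\<phi> x) (\<phi> y) \<le> (1 + (2 * L * real l) / (real l / (2 * L))) * (d z x + d x y + d y v - d z v)"
      unfolding d_def using z X U L l0
      by (intro B.middle_vertical qiD(2)[OF qi] lo hi) auto
    also have "(2 * L * real l) / (real l / (2 * L)) = 4 * L\<^sup>2" using l0 L by (simp add: power2_eq_square)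
    finally show "B.nu (\<phi> x) (\<phi> y) \<le> q * (d z x + d x y + d y v - d z v)" unfolding q_def .
  qed
  also have "\<dots> = q * (T (\<lambda>x y v. d z x) + T (\<lambda>x y v. d x y) + T (\<lambda>x y v. d y v) - T (\<lambda>x y v. d z v))"
    unfolding Tadd[symmetric] Tsub[symmetric] unfolding T_def by (simp add: sum_distrib_left)
  also have "\<dots> \<le> q * (4 * e * (N * N * N))"
  proof (rule mult_left_mono)
    show "T (\<lambda>x y v. d z x) + T (\<lambda>x y v. d x y) + T (\<lambda>x y v. d y v) - T (\<lambda>x y v. d z v) \<le> 4 * e * (N * N * N)"
      using s01 s12 s23 s03 by (simp add: algebra_simps)
  qed (use q in simp)
  finally have nu: "N * (\<Sum>x\<in>A.U l z. \<Sum>y\<in>A.U l x. B.nu (\<phi> x) (\<phi> y)) \<le> q * (4 * e * (N * N * N))" unfolding Txy .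
  have "(\<kappa> * real l - 3 * e) * (N * N * N) \<le> T (\<lambda>x y v. d x y)"
    using tri s01 s23 s03 by (simp add: algebra_simps)
  then have dd: "(\<kappa> * real l - 3 * e) * (N * N * N) \<le> N * (\<Sum>x\<in>A.U l z. \<Sum>y\<in>A.U l x. d x y)" unfolding Txy .
  define g where "g x = ((\<kappa> * real l + e) * N - (\<Sum>y\<in>A.U l x. d x y)) + (\<Sum>y\<in>A.U l x. B.nu (\<phi> x) (\<phi> y))" for x
  have "N * (\<Sum>x\<in>A.U l z. g x) = (\<kappa> * real l + e) * (N * N * N) - N * (\<Sum>x\<in>A.U l z. \<Sum>y\<in>A.U l x. d x y) +
     N * (\<Sum>x\<in>A.U l z. \<Sum>y\<in>A.U l x. B.nu (\<phi> x) (\<phi> y))"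
    unfolding g_def sum.distrib sum_subtractf using cU[OF z] by (simp add: N_def[symmetric] algebra_simps)
  also have "\<dots> \<le> 4 * e * (N * N * N) + q * (4 * e * (N * N * N))" using dd nu by (simp add: algebra_simps)
  also have "\<dots> = N * (((8 + 16 * L\<^sup>2) * e * N) * real (card (A.U l z)))"
    unfolding q_def cU[OF z] by (simp add: N_def[symmetric] algebra_simps)
  finally have "(\<Sum>x\<in>A.U l z. g x) \<le> ((8 + 16 * L\<^sup>2) * e * N) * real (card (A.U l z))" using N by simp
  then obtain w where w: "w \<in> A.U l z" "g w \<le> (8 + 16 * L\<^sup>2) * e * N"
    by (rule exists_le_average[OF A.finite_up[OF z] A.up_ne[OF z]])
  have wX: "w \<in> X" using w UX by blast
  have "0 \<le> (\<Sum>y\<in>A.U l w. B.nu (\<phi> w) (\<phi> y))"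
    using wX UX qiD(2)[OF qi] by (intro sum_nonneg B.nu_nonneg) blast+
  moreover have "(\<Sum>y\<in>A.U l w. d w y) \<le> (\<kappa> * real l + e) * N" using bdl[OF wX] unfolding d_def .
  moreover have "0 \<le> e * N" using e N by simp
  ultimately have "up_extremal \<phi> \<kappa> ((8 + 16 * L\<^sup>2) * e) l w"
    using w(2) unfolding extremal_def g_def d_def N_def[symmetric] by (simp add: algebra_simps)
  then show ?thesis using wX by blast
qed

lemma no_steep_extremal:
  assumes L: "1 \<le> L" and k: "3 < \<kappa>" and M: "M = m' \<or> M = n'"
  shows "\<exists>\<delta>>0. \<exists>l0. \<forall>l\<ge>l0. \<forall>\<phi> w. qi L \<phi> \<longrightarrow> w \<in> X \<longrightarrow> up_bound \<phi> \<kappa> (\<delta> * real l) l \<longrightarrow>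
    down_bound \<phi> \<kappa> (\<delta> * real l) l \<longrightarrow> \<not> up_extremal \<phi> \<kappa> (\<delta> * real l) l w"
proof -
  interpret T: box_pair X h b c m n Y "\<lambda>z. - h' z" "\<lambda>z w. - c' z w" "\<lambda>z w. - b' z w" n' m' M
    by (rule flip_target)
  obtain \<epsilon>1 l1 where e1: "0 < \<epsilon>1" "\<epsilon>1 \<le> 1" and "\<forall>l\<ge>l1. \<forall>\<phi> k w. qi L \<phi> \<longrightarrow> \<not> good_box \<phi> \<kappa> (\<epsilon>1 * real l) l k w"
    using no_steep_box[OF L k M] by (elim exE conjE) (rule that)
  note no1 = this(3)[rule_format]
  have M': "M = n' \<or> M = m'" using M by blast
  obtain \<epsilon>2 l2 where e2: "0 < \<epsilon>2" "\<epsilon>2 \<le> 1" and "\<forall>l\<ge>l2. \<forall>\<phi> k w. qi L \<phi> \<longrightarrow> \<not> T.good_box \<phi> \<kappa> (\<epsilon>2 * real l) l k w"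
    using T.no_steep_box[OF L k M'] unfolding flip_simps by (elim exE conjE) (rule that)
  note no2 = this(3)[rule_format]
  define \<epsilon> where "\<epsilon> = min \<epsilon>1 \<epsilon>2"
  have eps: "0 < \<epsilon>" "\<epsilon> \<le> 1" "\<epsilon> \<le> \<epsilon>1" "\<epsilon> \<le> \<epsilon>2" unfolding \<epsilon>_def using e1 e2 by auto
  obtain \<delta>0 l0 where d: "0 < \<delta>0" and "\<forall>l\<ge>l0. \<forall>\<phi> \<kappa> w. qi L \<phi> \<longrightarrow> w \<in> X \<longrightarrow>
    up_bound \<phi> \<kappa> (\<delta>0 * real l) l \<longrightarrow> down_bound \<phi> \<kappa> (\<delta>0 * real l) l \<longrightarrow> up_extremal \<phi> \<kappa> (\<delta>0 * real l) l w \<longrightarrow>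
    (\<exists>k. \<bar>3 * \<bar>k\<bar> - \<kappa> * real l\<bar> \<le> \<epsilon> * real l \<and>
      (\<forall>v\<in>A.U l w. \<forall>p\<in>A.D l v. \<bar>h' (\<phi> v) - h' (\<phi> p) - k\<bar> \<le> \<epsilon> * real l))"
    using box_eventually[OF L eps(1,2)] by (elim exE conjE) (rule that)
  note box = this(2)[rule_format]
  define \<delta> where "\<delta> = min \<delta>0 \<epsilon>"
  have delta: "0 < \<delta>" "\<delta> \<le> \<delta>0" "\<delta> \<le> \<epsilon>" unfolding \<delta>_def using d eps by auto
  show ?thesis
  proof (rule exI[of _ \<delta>], intro conjI delta(1), rule exI[of _ "max l0 (max l1 l2)"], intro allI impI notI)
    fix l \<phi> w
    assume l: "max l0 (max l1 l2) \<le> l" and qi: "qi L \<phi>" and w: "w \<in> X" and bd: "up_bound \<phi> \<kappa> (\<delta> * real l) l"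
      and dbd: "down_bound \<phi> \<kappa> (\<delta> * real l) l" and ex: "up_extremal \<phi> \<kappa> (\<delta> * real l) l w"
    have ll: "l0 \<le> l" "l1 \<le> l" "l2 \<le> l" using l by auto
    have mon: "\<delta> * real l \<le> \<delta>0 * real l" "\<delta> * real l \<le> \<epsilon> * real l" "\<epsilon> * real l \<le> \<epsilon>1 * real l" "\<epsilon> * real l \<le> \<epsilon>2 * real l"
      using delta eps by (auto intro: mult_right_mono)
    obtain k where k: "\<bar>3 * \<bar>k\<bar> - \<kappa> * real l\<bar> \<le> \<epsilon> * real l"
      "\<forall>v\<in>A.U l w. \<forall>p\<in>A.D l v. \<bar>h' (\<phi> v) - h' (\<phi> p) - k\<bar> \<le> \<epsilon> * real l"
      using box[OF ll(1) qi w slope_bound_mono[OF bd mon(1)] slope_bound_mono[OF dbd mon(1)] extremal_mono[OF ex mon(1)]] by blast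
    have bds: "up_bound \<phi> \<kappa> (\<epsilon> * real l) l" "down_bound \<phi> \<kappa> (\<epsilon> * real l) l"
      using slope_bound_mono[OF bd mon(2)] slope_bound_mono[OF dbd mon(2)] .
    show False
    proof (cases "0 \<le> k")
      case True
      then have "good_box \<phi> \<kappa> (\<epsilon> * real l) l k w" unfolding good_box_def using w bds k by simp
      then show False using no1[OF ll(2) qi] good_box_mono[OF _ mon(3)] by blast
    next
      case False
      have "\<bar>- h' (\<phi> v) - - h' (\<phi> p) - - k\<bar> \<le> \<epsilon> * real l" if "v \<in> A.U l w" "p \<in> A.D l v" for v p
        using k(2) that by force
      then have "T.good_box \<phi> \<kappa> (\<epsilon> * real l) l (- k) w"
        unfolding T.good_box_def using w bds k(1) False by simp
      then show False using no2[OF ll(3) qi] T.good_box_mono[OF _ mon(4)] by blast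
    qed
  qed
qed

lemma no_steep_tree:
  assumes L: "1 \<le> L" and k: "3 < \<kappa>" and M: "M = m' \<or> M = n'"
  shows "\<exists>\<delta>>0. \<exists>l0. \<forall>l\<ge>l0. \<forall>\<phi> z. qi L \<phi> \<longrightarrow> z \<in> X \<longrightarrow> up_bound \<phi> \<kappa> (\<delta> * real l) (3 * l) \<longrightarrow>
    down_bound \<phi> \<kappa> (\<delta> * real l) (3 * l) \<longrightarrow>
    (\<Sum>v\<in>A.U (3 * l) z. B.dd (\<phi> z) (\<phi> v)) < (3 * \<kappa> * real l - \<delta> * real l) * real m ^ (3 * l)"
proof -
  obtain \<delta>0 l0 where d: "0 < \<delta>0" and "\<forall>l\<ge>l0. \<forall>\<phi> w. qi L \<phi> \<longrightarrow> w \<in> X \<longrightarrow> up_bound \<phi> \<kappa> (\<delta>0 * real l) l \<longrightarrow>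
    down_bound \<phi> \<kappa> (\<delta>0 * real l) l \<longrightarrow> \<not> up_extremal \<phi> \<kappa> (\<delta>0 * real l) l w"
    using no_steep_extremal[OF L k M] by (elim exE conjE) (rule that)
  note no = this(2)[rule_format]
  define q where "q = 8 + 16 * L\<^sup>2"
  have q: "1 \<le> q" unfolding q_def by simp
  define \<delta> where "\<delta> = \<delta>0 / q"
  have delta: "0 < \<delta>" "q * \<delta> = \<delta>0" "\<delta> \<le> \<delta>0" unfolding \<delta>_def using d q by (auto simp: divide_le_eq mult_left_mono)
  show ?thesis
  proof (rule exI[of _ \<delta>], intro conjI delta(1), rule exI[of _ "max l0 (nat \<lceil>2 * L\<rceil>)"], intro allI impI)
    fix l \<phi> z assume l: "max l0 (nat \<lceil>2 * L\<rceil>) \<le> l" and qi: "qi L \<phi>" and z: "z \<in> X"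
      and bd: "up_bound \<phi> \<kappa> (\<delta> * real l) (3 * l)" and dbd: "down_bound \<phi> \<kappa> (\<delta> * real l) (3 * l)"
    have ll: "l0 \<le> l" "2 * L \<le> real l" using l by linarith+
    have mon: "\<delta> * real l \<le> \<delta>0 * real l" using delta by (intro mult_right_mono) auto
    have bds: "up_bound \<phi> \<kappa> (\<delta>0 * real l) l" "down_bound \<phi> \<kappa> (\<delta>0 * real l) l"
      using slope_bound_mono[OF bd mon] slope_bound_mono[OF dbd mon] unfolding slope_bound_def by auto
    show "(\<Sum>v\<in>A.U (3 * l) z. B.dd (\<phi> z) (\<phi> v)) < (3 * \<kappa> * real l - \<delta> * real l) * real m ^ (3 * l)"
    proof (rule ccontr)
      assume "\<not> ?thesis"
      then have big: "(3 * \<kappa> * real l - \<delta> * real l) * real m ^ (3 * l) \<le> (\<Sum>v\<in>A.U (3 * l) z. B.dd (\<phi> z) (\<phi> v))" by simp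
      have "0 \<le> \<delta> * real l" using delta by simp
      from exists_extremal[OF L qi ll(2) z this bd big]
      obtain w where "w \<in> X" "up_extremal \<phi> \<kappa> (q * (\<delta> * real l)) l w" unfolding q_def by blast
      moreover have "q * (\<delta> * real l) = \<delta>0 * real l" using delta(2) by (simp add: mult.assoc[symmetric])
      ultimately show False using no[OF ll(1) qi _ bds] by simp
    qed
  qed
qed

lemma slope_le_3:
  assumes L: "1 \<le> L" and M: "M = m' \<or> M = n'" and k: "3 < \<kappa>"
  shows "\<exists>e\<ge>0. \<forall>\<phi> l. qi L \<phi> \<longrightarrow> up_bound \<phi> \<kappa> e l \<and> down_bound \<phi> \<kappa> e l"
proof -
  interpret S: box_pair X "\<lambda>z. - h z" "\<lambda>z w. - c z w" "\<lambda>z w. - b z w" n m Y h' b' c' m' n' M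
    by (rule flip_source)
  define G where "G = {\<kappa>. 0 \<le> \<kappa> \<and> (\<exists>e\<ge>0. \<forall>\<phi> l. qi L \<phi> \<longrightarrow> up_bound \<phi> \<kappa> e l \<and> down_bound \<phi> \<kappa> e l)}"
  have up: "\<kappa>' \<in> G" if G: "\<kappa> \<in> G" and le: "\<kappa> \<le> \<kappa>'" for \<kappa> \<kappa>'
  proof -
    have mono: "slope_bound X' h0 b0 c0 p d \<kappa>' e l" if "slope_bound X' h0 b0 c0 p d \<kappa> e l"
      for X' :: "'z set" and h0 b0 c0 p d e l
      unfolding slope_bound_def
    proof (intro ballI allI impI)
      fix z j assume "z \<in> X'" "j \<le> l"
      then have "(\<Sum>v\<in>up_tree X' h0 b0 c0 j z. d z v) \<le> (\<kappa> * real j + e) * real p ^ j"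
        using that unfolding slope_bound_def by blast
      also have "\<dots> \<le> (\<kappa>' * real j + e) * real p ^ j" using le by (intro mult_right_mono add_right_mono) auto
      finally show "(\<Sum>v\<in>up_tree X' h0 b0 c0 j z. d z v) \<le> (\<kappa>' * real j + e) * real p ^ j" .
    qed
    obtain e where e: "0 \<le> e" "\<And>\<phi> l. qi L \<phi> \<Longrightarrow> up_bound \<phi> \<kappa> e l \<and> down_bound \<phi> \<kappa> e l" using G unfolding G_def by blast
    have "up_bound \<phi> \<kappa>' e l \<and> down_bound \<phi> \<kappa>' e l" if "qi L \<phi>" for \<phi> l
      using e(2)[OF that] by (intro conjI mono) auto
    moreover have "0 \<le> \<kappa>'" using G le unfolding G_def by simp
    ultimately show ?thesis unfolding G_def using e(1) by blast
  qed
  have fekete: "\<kappa> \<in> G" if N: "0 < N" and k: "0 \<le> \<kappa>"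
    and bd: "\<And>\<phi> z. qi L \<phi> \<Longrightarrow> z \<in> X \<Longrightarrow> (\<Sum>v\<in>A.U N z. B.dd (\<phi> z) (\<phi> v)) \<le> \<kappa> * real N * real m ^ N"
    and dbd: "\<And>\<phi> z. qi L \<phi> \<Longrightarrow> z \<in> X \<Longrightarrow> (\<Sum>v\<in>A.D N z. B.dd (\<phi> z) (\<phi> v)) \<le> \<kappa> * real N * real n ^ N" for N \<kappa>
  proof -
    have "up_bound \<phi> \<kappa> (4 * L * (real N + 1)) l" if "qi L \<phi>" for \<phi> l
      by (rule up_bound_fekete[OF that N k bd[OF that]])
    moreover have "down_bound \<phi> \<kappa> (4 * L * (real N + 1)) l" if "qi L \<phi>" for \<phi> l
      using S.up_bound_fekete[OF _ N k dbd[OF that], of L] that by simp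
    moreover have "0 \<le> 4 * L * (real N + 1)" using L by simp
    ultimately show ?thesis unfolding G_def using k by blast
  qed
  have "8 * L \<in> G"
  proof (rule fekete[of 1])
    fix \<phi> z assume qi: "qi L \<phi>" and z: "z \<in> X"
    have "(\<Sum>v\<in>A.U 1 z. B.dd (\<phi> z) (\<phi> v)) \<le> (\<Sum>v\<in>A.U 1 z. 4 * L * (real 1 + 1))"
      by (intro sum_mono dd_upper[OF qi z])
    then show "(\<Sum>v\<in>A.U 1 z. B.dd (\<phi> z) (\<phi> v)) \<le> 8 * L * real 1 * real m ^ 1"
      using A.card_up[OF z, of 1] by (simp add: mult_ac)
    have "(\<Sum>v\<in>A.D 1 z. B.dd (\<phi> z) (\<phi> v)) \<le> (\<Sum>v\<in>A.D 1 z. 4 * L * (real 1 + 1))"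
    proof (rule sum_mono)
      fix v assume "v \<in> A.D 1 z"
      then show "B.dd (\<phi> z) (\<phi> v) \<le> 4 * L * (real 1 + 1)" using S.dd_upper[of L \<phi> z v 1] qi z by simp
    qed
    then show "(\<Sum>v\<in>A.D 1 z. B.dd (\<phi> z) (\<phi> v)) \<le> 8 * L * real 1 * real n ^ 1"
      using A.card_down[OF z, of 1] by (simp add: mult_ac)
  qed (use L in auto)
  then have ne: "G \<noteq> {}" by blast
  have bel: "bdd_below G" unfolding G_def by (intro bdd_belowI[of _ 0]) auto
  define \<kappa>0 where "\<kappa>0 = Inf G"
  have "\<kappa>0 \<le> 3"
  proof (rule ccontr)
    assume "\<not> ?thesis"
    then have k0: "3 < \<kappa>0" by simp
    obtain \<delta>1 l1 where d1: "0 < \<delta>1" and "\<forall>l\<ge>l1. \<forall>\<phi> z. qi L \<phi> \<longrightarrow> z \<in> X \<longrightarrow> up_bound \<phi> \<kappa>0 (\<delta>1 * real l) (3 * l) \<longrightarrow>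
      down_bound \<phi> \<kappa>0 (\<delta>1 * real l) (3 * l) \<longrightarrow>
      (\<Sum>v\<in>A.U (3 * l) z. B.dd (\<phi> z) (\<phi> v)) < (3 * \<kappa>0 * real l - \<delta>1 * real l) * real m ^ (3 * l)"
      using no_steep_tree[OF L k0 M] by (elim exE conjE) (rule that)
    note no1 = this(2)[rule_format]
    obtain \<delta>2 l2 where d2: "0 < \<delta>2" and "\<forall>l\<ge>l2. \<forall>\<phi> z. qi L \<phi> \<longrightarrow> z \<in> X \<longrightarrow> down_bound \<phi> \<kappa>0 (\<delta>2 * real l) (3 * l) \<longrightarrow>
      up_bound \<phi> \<kappa>0 (\<delta>2 * real l) (3 * l) \<longrightarrow>
      (\<Sum>v\<in>A.D (3 * l) z. B.dd (\<phi> z) (\<phi> v)) < (3 * \<kappa>0 * real l - \<delta>2 * real l) * real n ^ (3 * l)"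
      using S.no_steep_tree[OF L k0 M] unfolding flip_simps minus_minus by (elim exE conjE) (rule that)
    note no2 = this(2)[rule_format]
    define \<delta> where "\<delta> = min (min \<delta>1 \<delta>2) 1"
    have delta: "0 < \<delta>" "\<delta> \<le> \<delta>1" "\<delta> \<le> \<delta>2" "\<delta> \<le> 1" unfolding \<delta>_def using d1 d2 by auto
    obtain \<kappa>1 where k1: "\<kappa>1 \<in> G" "\<kappa>1 < \<kappa>0 + \<delta> / 6"
      using cInf_lessD[OF ne, of "\<kappa>0 + \<delta> / 6"] delta unfolding \<kappa>0_def by auto
    then have "\<kappa>0 + \<delta> / 6 \<in> G" using up by simp
    then obtain e where e: "0 \<le> e" "\<And>\<phi> l. qi L \<phi> \<Longrightarrow> up_bound \<phi> (\<kappa>0 + \<delta> / 6) e l \<and> down_bound \<phi> (\<kappa>0 + \<delta> / 6) e l"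
      unfolding G_def by blast
    define l where "l = max (max 1 (nat \<lceil>2 * e / \<delta>\<rceil>)) (max l1 l2)"
    have ll: "1 \<le> l" "l1 \<le> l" "l2 \<le> l" "2 * e / \<delta> \<le> real l" unfolding l_def by linarith+
    have el: "2 * e \<le> \<delta> * real l" using ll(4) delta by (simp add: field_simps)
    have shift: "slope_bound X' h0 b0 c0 p d \<kappa>0 (\<delta> * real l) (3 * l)"
      if "slope_bound X' h0 b0 c0 p d (\<kappa>0 + \<delta> / 6) e (3 * l)" for X' :: "'z set" and h0 b0 c0 p d
      unfolding slope_bound_def
    proof (intro ballI allI impI)
      fix z j assume z: "z \<in> X'" and j: "j \<le> 3 * l"
      have "(\<Sum>v\<in>up_tree X' h0 b0 c0 j z. d z v) \<le> ((\<kappa>0 + \<delta> / 6) * real j + e) * real p ^ j"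
        using that z j unfolding slope_bound_def by blast
      also have "\<dots> \<le> (\<kappa>0 * real j + \<delta> * real l) * real p ^ j"
      proof (intro mult_right_mono)
        have "\<delta> / 6 * real j \<le> \<delta> / 6 * (3 * real l)" using delta j by (intro mult_left_mono) auto
        then show "(\<kappa>0 + \<delta> / 6) * real j + e \<le> \<kappa>0 * real j + \<delta> * real l"
          using el by (simp add: algebra_simps)
      qed simp
      finally show "(\<Sum>v\<in>up_tree X' h0 b0 c0 j z. d z v) \<le> (\<kappa>0 * real j + \<delta> * real l) * real p ^ j" .
    qed
    have mon: "\<delta> * real l \<le> \<delta>1 * real l" "\<delta> * real l \<le> \<delta>2 * real l" using delta by (auto intro: mult_right_mono)
    have bds: "up_bound \<phi> \<kappa>0 (\<delta> * real l) (3 * l)" "down_bound \<phi> \<kappa>0 (\<delta> * real l) (3 * l)" if "qi L \<phi>" for \<phi>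
      using e(2)[OF that, of "3 * l"] shift by auto
    have "\<kappa>0 - \<delta> / 3 \<in> G"
    proof (rule fekete[of "3 * l"])
      show "0 < 3 * l" using ll by simp
      show "0 \<le> \<kappa>0 - \<delta> / 3" using k0 delta by simp
      fix \<phi> z assume qi: "qi L \<phi>" and z: "z \<in> X"
      have eq: "(\<kappa>0 - \<delta> / 3) * real (3 * l) = 3 * \<kappa>0 * real l - \<delta> * real l" by (simp add: algebra_simps)
      have "(\<Sum>v\<in>A.U (3 * l) z. B.dd (\<phi> z) (\<phi> v)) \<le> (3 * \<kappa>0 * real l - \<delta>1 * real l) * real m ^ (3 * l)"
        using no1[OF ll(2) qi z] slope_bound_mono[OF bds(1)[OF qi] mon(1)] slope_bound_mono[OF bds(2)[OF qi] mon(1)] by simp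
      also have "\<dots> \<le> (3 * \<kappa>0 * real l - \<delta> * real l) * real m ^ (3 * l)" using mon by (intro mult_right_mono) auto
      finally show "(\<Sum>v\<in>A.U (3 * l) z. B.dd (\<phi> z) (\<phi> v)) \<le> (\<kappa>0 - \<delta> / 3) * real (3 * l) * real m ^ (3 * l)" unfolding eq .
      have "(\<Sum>v\<in>A.D (3 * l) z. B.dd (\<phi> z) (\<phi> v)) \<le> (3 * \<kappa>0 * real l - \<delta>2 * real l) * real n ^ (3 * l)"
        using no2[OF ll(3) qi z] slope_bound_mono[OF bds(1)[OF qi] mon(2)] slope_bound_mono[OF bds(2)[OF qi] mon(2)] by simp
      also have "\<dots> \<le> (3 * \<kappa>0 * real l - \<delta> * real l) * real n ^ (3 * l)" using mon by (intro mult_right_mono) auto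
      finally show "(\<Sum>v\<in>A.D (3 * l) z. B.dd (\<phi> z) (\<phi> v)) \<le> (\<kappa>0 - \<delta> / 3) * real (3 * l) * real n ^ (3 * l)" unfolding eq .
    qed
    then have "\<kappa>0 \<le> \<kappa>0 - \<delta> / 3" unfolding \<kappa>0_def by (intro cInf_lower bel)
    then show False using delta by simp
  qed
  then have "Inf G < \<kappa>" using k unfolding \<kappa>0_def by simp
  then obtain \<kappa>1 where "\<kappa>1 \<in> G" "\<kappa>1 < \<kappa>" using cInf_lessD[OF ne] by blast
  then have "\<kappa> \<in> G" using up by simp
  then show ?thesis unfolding G_def by blast
qed

end

section \<open>Level sets\<close>

context box_space
begin

lemma up_0:
  assumes "z \<in> X" "v \<in> U 0 z" shows "v = z"
proof -
  have "v \<in> X" "h v = h z" "b z v = h z" "c z v = h v" using assms(2) unfolding up_iff[OF assms(1)] by auto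
  then show ?thesis using eq_if[OF assms(1), of v] by simp
qed

end

context box_pair
begin

lemma most_far:
  assumes L: "1 \<le> L" and mM: "m = M" and d: "0 < \<delta>" "\<delta> \<le> 1"
  shows "\<exists>l0. \<forall>l\<ge>l0. \<forall>\<phi> w. qi L \<phi> \<longrightarrow> w \<in> X \<longrightarrow>
    (1 - 2 * \<delta>) * real l * real m ^ l \<le> (\<Sum>v\<in>A.U l w. B.rho (\<phi> w) (\<phi> v))"
proof -
  have M2: "2 \<le> M" by (rule A.M_ge_2)
  define K where "K = 4 * real M * ball_bound M L"
  have K0: "0 \<le> K" unfolding K_def by (simp add: ball_bound_nonneg)
  obtain l0 where l0: "\<And>l. l \<ge> l0 \<Longrightarrow> K * (real l + 1) ^ 3 * 2 powr (- (\<delta> * real l)) \<le> \<delta>"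
    using exp_beats_cubic[OF d(1) d(1), of K] by auto
  show ?thesis
  proof (rule exI[of _ l0], intro allI impI)
    fix l \<phi> w assume l: "l0 \<le> l" and qi: "qi L \<phi>" and w: "w \<in> X"
    define R where "R = (1 - \<delta>) * real l"
    have R0: "0 \<le> R" unfolding R_def using d by simp
    have wY: "\<phi> w \<in> Y" using qiD(2)[OF qi w] .
    have UX: "A.U l w \<subseteq> X" by (rule A.up_sub)
    have fU: "finite (A.U l w)" by (rule A.finite_up[OF w])
    define Q where "Q = {v \<in> A.U l w. B.rho (\<phi> w) (\<phi> v) \<le> R}"
    define P where "P = {y \<in> Y. B.rho (\<phi> w) y \<le> R}"
    have P: "finite P" "real (card P) \<le> ball_bound M R" using B.card_ball_real[OF wY R0, of P] unfolding P_def by auto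
    define T where "T y = {v \<in> Q. \<phi> v = y}" for y
    have T: "real (card (T y)) \<le> ball_bound M L" if y: "y \<in> P" for y
    proof -
      have yY: "y \<in> Y" using y unfolding P_def by blast
      have "B.rho y y = 0" unfolding box_dist_def using B.b_refl[OF yY] B.c_refl[OF yY] by simp
      then show ?thesis using card_close(2)[OF qi _ yY, of "T y" 0] UX unfolding T_def Q_def by auto
    qed
    have "Q \<subseteq> (\<Union>y\<in>P. T y)" using UX qiD(2)[OF qi] unfolding P_def T_def Q_def by blast
    then have "card Q \<le> card (\<Union>y\<in>P. T y)" using P(1) fU unfolding T_def Q_def by (intro card_mono) auto
    also have "\<dots> \<le> (\<Sum>y\<in>P. card (T y))" by (rule card_UN_le[OF P(1)])
    finally have "real (card Q) \<le> (\<Sum>y\<in>P. real (card (T y)))" by (metis of_nat_mono of_nat_sum)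
    also have "\<dots> \<le> (\<Sum>y\<in>P. ball_bound M L)" by (intro sum_mono T)
    also have "\<dots> \<le> ball_bound M R * ball_bound M L" using P(2) by (simp add: mult_right_mono ball_bound_nonneg)
    also have "ball_bound M R = (R + 2)\<^sup>2 * (real M powr (R + 1))" unfolding ball_bound_def ..
    also have "(R + 2)\<^sup>2 * (real M powr (R + 1)) * ball_bound M L \<le> (2 * (real l + 1))\<^sup>2 * (real M * 2 powr (- (\<delta> * real l)) * real M ^ l) * ball_bound M L"
    proof (intro mult_right_mono mult_mono power_mono ball_bound_nonneg)
      have "(1 - \<delta>) * real l \<le> 1 * real l" using d by (intro mult_right_mono) auto
      then show "R + 2 \<le> 2 * (real l + 1)" unfolding R_def by simp
      have "real M powr (R + 1) = real M * real M powr (- (\<delta> * real l)) * real M powr real l"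
        using M2 unfolding R_def by (simp add: powr_add[symmetric] powr_mult_base algebra_simps)
      also have "\<dots> \<le> real M * 2 powr (- (\<delta> * real l)) * real M powr real l"
        using M2 d by (intro mult_right_mono mult_left_mono powr_mono2') auto
      finally show "real M powr (R + 1) \<le> real M * 2 powr (- (\<delta> * real l)) * real M ^ l"
        using M2 by (simp add: powr_realpow)
    qed (use R0 in auto)
    also have "\<dots> = (K * (real l + 1)\<^sup>2 * 2 powr (- (\<delta> * real l))) * real M ^ l"
      unfolding K_def power_mult_distrib by simp
    also have "\<dots> \<le> \<delta> * real M ^ l"
    proof (intro mult_right_mono)
      have "K * (real l + 1)\<^sup>2 * 2 powr (- (\<delta> * real l)) \<le> K * (real l + 1) ^ 3 * 2 powr (- (\<delta> * real l))"
        using K0 by (intro mult_right_mono mult_left_mono power_increasing) auto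
      then show "K * (real l + 1)\<^sup>2 * 2 powr (- (\<delta> * real l)) \<le> \<delta>" using l0[OF l] by linarith
    qed simp
    finally have cQ: "real (card Q) \<le> \<delta> * real m ^ l" using mM by simp
    have "R * (real m ^ l - real (card Q)) = (\<Sum>v\<in>A.U l w. R - R * of_bool (v \<in> Q))"
    proof -
      have "A.U l w \<inter> Q = Q" unfolding Q_def by blast
      then show ?thesis using fU A.card_up[OF w, of l] by (simp add: sum_subtractf sum_distrib_left[symmetric] algebra_simps)
    qed
    also have "\<dots> \<le> (\<Sum>v\<in>A.U l w. B.rho (\<phi> w) (\<phi> v))"
    proof (rule sum_mono)
      fix v assume v: "v \<in> A.U l w"
      have "0 \<le> B.rho (\<phi> w) (\<phi> v)" using B.rho_ge[OF wY, of "\<phi> v"] v UX qiD(2)[OF qi] by force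
      then show "R - R * of_bool (v \<in> Q) \<le> B.rho (\<phi> w) (\<phi> v)" using v unfolding Q_def by auto
    qed
    finally have 1: "R * (real m ^ l - real (card Q)) \<le> (\<Sum>v\<in>A.U l w. B.rho (\<phi> w) (\<phi> v))" .
    have "(1 - 2 * \<delta>) * real l * real m ^ l \<le> R * ((1 - \<delta>) * real m ^ l)"
    proof -
      have "1 - 2 * \<delta> \<le> (1 - \<delta>) * (1 - \<delta>)" by (simp add: algebra_simps)
      then have "(1 - 2 * \<delta>) * (real l * real m ^ l) \<le> ((1 - \<delta>) * (1 - \<delta>)) * (real l * real m ^ l)"
        by (rule mult_right_mono) simp
      then show ?thesis unfolding R_def by (simp add: mult_ac)
    qed
    also have "\<dots> \<le> R * (real m ^ l - real (card Q))" using cQ R0 by (intro mult_left_mono) (auto simp: algebra_simps)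
    finally show "(1 - 2 * \<delta>) * real l * real m ^ l \<le> (\<Sum>v\<in>A.U l w. B.rho (\<phi> w) (\<phi> v))" using 1 by linarith
  qed
qed

lemma vertical_signs:
  assumes L: "1 \<le> L" and mM: "m = M" and M: "M = m' \<or> M = n'"
  shows "\<exists>l0. \<forall>l\<ge>l0. \<forall>\<phi> w. qi L \<phi> \<longrightarrow> w \<in> X \<longrightarrow>
    (\<forall>v\<in>A.U l w. real l / 2 \<le> h' (\<phi> v) - h' (\<phi> w)) \<or> (\<forall>v\<in>A.U l w. h' (\<phi> v) - h' (\<phi> w) \<le> - (real l / 2))"
proof -
  have quarter: "0 < (1 / 4 :: real)" "(1 / 4 :: real) \<le> 1" by auto
  obtain \<delta>0 l1 where d0: "0 < \<delta>0" and "\<forall>l\<ge>l1. \<forall>\<phi> \<kappa> w. qi L \<phi> \<longrightarrow> w \<in> X \<longrightarrow>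
    up_bound \<phi> \<kappa> (\<delta>0 * real l) l \<longrightarrow> down_bound \<phi> \<kappa> (\<delta>0 * real l) l \<longrightarrow> up_extremal \<phi> \<kappa> (\<delta>0 * real l) l w \<longrightarrow>
    (\<exists>k. \<bar>3 * \<bar>k\<bar> - \<kappa> * real l\<bar> \<le> 1 / 4 * real l \<and>
      (\<forall>v\<in>A.U l w. \<forall>p\<in>A.D l v. \<bar>h' (\<phi> v) - h' (\<phi> p) - k\<bar> \<le> 1 / 4 * real l))"
    using box_eventually[OF L quarter] by (elim exE conjE) (rule that)
  note box = this(2)[rule_format]
  define \<delta> where "\<delta> = min (\<delta>0 / 8) 1"
  have d: "0 < \<delta>" "\<delta> \<le> 1" "8 * \<delta> \<le> \<delta>0" unfolding \<delta>_def using d0 by auto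
  obtain l2 where "\<forall>l\<ge>l2. \<forall>\<phi> w. qi L \<phi> \<longrightarrow> w \<in> X \<longrightarrow>
    (1 - 2 * \<delta>) * real l * real m ^ l \<le> (\<Sum>v\<in>A.U l w. B.rho (\<phi> w) (\<phi> v))"
    using most_far[OF L mM d(1,2)] by (elim exE) (rule that)
  note far = this[rule_format]
  obtain e where e: "0 \<le> e" "\<And>\<phi> l. qi L \<phi> \<Longrightarrow> up_bound \<phi> (3 + \<delta> / 2) e l \<and> down_bound \<phi> (3 + \<delta> / 2) e l"
    using slope_le_3[OF L M, of "3 + \<delta> / 2"] d by auto
  define l0 where "l0 = max (max l1 l2) (max 1 (nat \<lceil>2 * e / \<delta>\<rceil>))"
  show ?thesis
  proof (rule exI[of _ l0], intro allI impI)
    fix l \<phi> w assume l: "l0 \<le> l" and qi: "qi L \<phi>" and w: "w \<in> X"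
    have ll: "l1 \<le> l" "l2 \<le> l" "1 \<le> real l" "2 * e / \<delta> \<le> real l" using l unfolding l0_def by linarith+
    have el: "2 * e \<le> \<delta> * real l" using ll(4) d by (simp add: field_simps)
    have shift: "slope_bound X' h0 b0 c0 p f 3 (\<delta> * real l) l"
      if "slope_bound X' h0 b0 c0 p f (3 + \<delta> / 2) e l" for X' :: "'z set" and h0 b0 c0 p f
      unfolding slope_bound_def
    proof (intro ballI allI impI)
      fix z j assume z: "z \<in> X'" and j: "j \<le> l"
      have "(\<Sum>v\<in>up_tree X' h0 b0 c0 j z. f z v) \<le> ((3 + \<delta> / 2) * real j + e) * real p ^ j"
        using that z j unfolding slope_bound_def by blast
      also have "\<dots> \<le> (3 * real j + \<delta> * real l) * real p ^ j"
      proof (intro mult_right_mono)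
        have "\<delta> / 2 * real j \<le> \<delta> / 2 * real l" using d j by (intro mult_left_mono) auto
        then show "(3 + \<delta> / 2) * real j + e \<le> 3 * real j + \<delta> * real l"
          using el by (simp add: algebra_simps)
      qed simp
      finally show "(\<Sum>v\<in>up_tree X' h0 b0 c0 j z. f z v) \<le> (3 * real j + \<delta> * real l) * real p ^ j" .
    qed
    have bd: "up_bound \<phi> 3 (\<delta> * real l) l" "down_bound \<phi> 3 (\<delta> * real l) l" using e(2)[OF qi, of l] shift by auto
    define N where "N = real m ^ l"
    have N: "0 < N" unfolding N_def using A.m_ge_2 by simp
    have s1: "(1 - 2 * \<delta>) * real l * N \<le> (\<Sum>v\<in>A.U l w. B.rho (\<phi> w) (\<phi> v))" using far[OF ll(2) qi w] unfolding N_def .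
    have s2: "(\<Sum>v\<in>A.U l w. B.dd (\<phi> w) (\<phi> v)) = 3 * (\<Sum>v\<in>A.U l w. B.rho (\<phi> w) (\<phi> v)) + (\<Sum>v\<in>A.U l w. B.nu (\<phi> w) (\<phi> v))"
      unfolding B.dd_eq(2) sum.distrib by (simp add: sum_distrib_left)
    have s3: "(\<Sum>v\<in>A.U l w. B.dd (\<phi> w) (\<phi> v)) \<le> (3 * real l + \<delta> * real l) * N"
      using bd(1) w unfolding slope_bound_def N_def by blast
    have s4: "0 \<le> (\<Sum>v\<in>A.U l w. B.nu (\<phi> w) (\<phi> v))"
    proof (intro sum_nonneg B.nu_nonneg qiD(2)[OF qi] w)
      fix v assume "v \<in> A.U l w" then show "v \<in> X" using A.up_sub by blast
    qed
    have dl: "8 * (\<delta> * real l * N) \<le> \<delta>0 * real l * N"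
      using mult_right_mono[OF d(3), of "real l * N"] N by (simp add: mult_ac)
    have dN: "0 \<le> \<delta> * real l * N" using d N by simp
    have "(3 * real l - \<delta>0 * real l) * N \<le> (\<Sum>v\<in>A.U l w. B.dd (\<phi> w) (\<phi> v))"
      unfolding s2 using s1 s4 dl dN by (simp add: algebra_simps)
    moreover have "(\<Sum>v\<in>A.U l w. B.nu (\<phi> w) (\<phi> v)) \<le> \<delta>0 * real l * N"
      using s1 s2 s3 dl dN by (simp add: algebra_simps)
    ultimately have ex: "up_extremal \<phi> 3 (\<delta>0 * real l) l w" unfolding extremal_def N_def by simp
    have mon: "\<delta> * real l \<le> \<delta>0 * real l" using d by (intro mult_right_mono) auto
    obtain k where k: "\<bar>3 * \<bar>k\<bar> - 3 * real l\<bar> \<le> 1 / 4 * real l"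
      "\<forall>v\<in>A.U l w. \<forall>p\<in>A.D l v. \<bar>h' (\<phi> v) - h' (\<phi> p) - k\<bar> \<le> 1 / 4 * real l"
      using box[OF ll(1) qi w slope_bound_mono[OF bd(1) mon] slope_bound_mono[OF bd(2) mon] ex] by blast
    have kv: "\<bar>h' (\<phi> v) - h' (\<phi> w) - k\<bar> \<le> 1 / 4 * real l" if v: "v \<in> A.U l w" for v
    proof -
      have "v \<in> X" using v A.up_sub by blast
      then show ?thesis using k(2) v A.up_down[OF w] by blast
    qed
    show "(\<forall>v\<in>A.U l w. real l / 2 \<le> h' (\<phi> v) - h' (\<phi> w)) \<or> (\<forall>v\<in>A.U l w. h' (\<phi> v) - h' (\<phi> w) \<le> - (real l / 2))"
    proof (cases "0 \<le> k")
      case True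
      have "real l / 2 \<le> h' (\<phi> v) - h' (\<phi> w)" if "v \<in> A.U l w" for v
        using kv[OF that] True k(1) ll(3) by argo
      then show ?thesis by blast
    next
      case False
      have "h' (\<phi> v) - h' (\<phi> w) \<le> - (real l / 2)" if "v \<in> A.U l w" for v
        using kv[OF that] False k(1) ll(3) by argo
      then show ?thesis by blast
    qed
  qed
qed

definition ascending :: "nat \<Rightarrow> ('z \<Rightarrow> 'y) \<Rightarrow> bool" where
  "ascending l0 \<phi> \<longleftrightarrow> (\<forall>w\<in>X. \<forall>l\<ge>l0. \<forall>v\<in>A.U l w. real l / 2 \<le> h' (\<phi> v) - h' (\<phi> w))"

lemma unit_step:
  assumes "qi L \<phi>" "w \<in> X" "v \<in> A.U 1 w"
  shows "B.rho (\<phi> w) (\<phi> v) \<le> 2 * L" "\<bar>h' (\<phi> w) - h' (\<phi> v)\<bar> \<le> 2 * L"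
proof -
  have v: "v \<in> X" using assms(3) A.up_sub by blast
  have "A.rho w v = 1" using assms(3) unfolding A.up_iff[OF assms(2)] box_dist_def by simp
  then show "B.rho (\<phi> w) (\<phi> v) \<le> 2 * L" using qiD(3)[OF assms(1,2) v] by simp
  then show "\<bar>h' (\<phi> w) - h' (\<phi> v)\<bar> \<le> 2 * L"
    using B.rho_ge[OF qiD(2)[OF assms(1,2)] qiD(2)[OF assms(1) v]] by linarith
qed

lemma global_sign:
  assumes L: "1 \<le> L" and mM: "m = M" and M: "M = m' \<or> M = n'"
  shows "\<exists>l0>0. \<forall>\<phi>. qi L \<phi> \<longrightarrow> ascending l0 \<phi> \<or>
    (\<forall>w\<in>X. \<forall>l\<ge>l0. \<forall>v\<in>A.U l w. h' (\<phi> v) - h' (\<phi> w) \<le> - (real l / 2))"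
proof -
  obtain l1 where "\<forall>l\<ge>l1. \<forall>\<phi> w. qi L \<phi> \<longrightarrow> w \<in> X \<longrightarrow>
    (\<forall>v\<in>A.U l w. real l / 2 \<le> h' (\<phi> v) - h' (\<phi> w)) \<or> (\<forall>v\<in>A.U l w. h' (\<phi> v) - h' (\<phi> w) \<le> - (real l / 2))"
    using vertical_signs[OF L mM M] by (elim exE) (rule that)
  note signs = this[rule_format]
  define l0 where "l0 = max l1 (nat \<lceil>4 * L\<rceil> + 1)"
  have l0: "l1 \<le> l0" "4 * L < real l0" "0 < l0" unfolding l0_def by linarith+
  show ?thesis
  proof (rule exI[of _ l0], intro conjI l0(3) allI impI)
    fix \<phi> assume qi: "qi L \<phi>"
    define P where "P w l \<longleftrightarrow> (\<forall>v\<in>A.U l w. real l / 2 \<le> h' (\<phi> v) - h' (\<phi> w))" for w l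
    define Q where "Q w l \<longleftrightarrow> (\<forall>v\<in>A.U l w. h' (\<phi> v) - h' (\<phi> w) \<le> - (real l / 2))" for w l
    have PQ: "P w l \<or> Q w l" if "w \<in> X" "l0 \<le> l" for w l
      using signs[OF _ qi that(1), of l] that(2) l0(1) unfolding P_def Q_def by simp
    have stepA: "P w l \<longleftrightarrow> P w (Suc l)" and stepB: "P w (Suc l) \<longleftrightarrow> P x l"
      if w: "w \<in> X" and l: "l0 \<le> l" and x: "x \<in> A.U 1 w" for w l x
    proof -
      have xX: "x \<in> X" using x A.up_sub by blast
      have l': "4 * L < real l" using l l0(2) by linarith
      obtain v where v: "v \<in> A.U l x" using A.up_ne[OF xX] by blast
      have v1: "v \<in> A.U (Suc l) w" using A.up_trans[OF w x v] by simp
      have "v \<in> A.U (l + 1) w" using v1 by simp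
      then obtain u where u: "u \<in> A.U l w" "v \<in> A.U 1 u" by (rule A.up_split[OF w])
      have uX: "u \<in> X" using u A.up_sub by blast
      have s: "\<bar>h' (\<phi> u) - h' (\<phi> v)\<bar> \<le> 2 * L" "\<bar>h' (\<phi> w) - h' (\<phi> x)\<bar> \<le> 2 * L"
        using unit_step(2)[OF qi uX u(2)] unit_step(2)[OF qi w x] .
      have p: "P w l \<Longrightarrow> real l / 2 \<le> h' (\<phi> u) - h' (\<phi> w)" "Q w l \<Longrightarrow> h' (\<phi> u) - h' (\<phi> w) \<le> - (real l / 2)"
        "P x l \<Longrightarrow> real l / 2 \<le> h' (\<phi> v) - h' (\<phi> x)" "Q x l \<Longrightarrow> h' (\<phi> v) - h' (\<phi> x) \<le> - (real l / 2)"
        using u v unfolding P_def Q_def by blast+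
      have "P w (Suc l) \<Longrightarrow> real (Suc l) / 2 \<le> h' (\<phi> v) - h' (\<phi> w)" "Q w (Suc l) \<Longrightarrow> h' (\<phi> v) - h' (\<phi> w) \<le> - (real (Suc l) / 2)"
        using v1 unfolding P_def Q_def by blast+
      moreover have "real l / 2 \<le> real (Suc l) / 2" by simp
      ultimately have q: "P w (Suc l) \<Longrightarrow> real l / 2 \<le> h' (\<phi> v) - h' (\<phi> w)" "Q w (Suc l) \<Longrightarrow> h' (\<phi> v) - h' (\<phi> w) \<le> - (real l / 2)"
        by linarith+
      show "P w l \<longleftrightarrow> P w (Suc l)"
        using PQ[OF w l] PQ[OF w, of "Suc l"] l p(1,2) q s(1) l' by fastforce
      show "P w (Suc l) \<longleftrightarrow> P x l"
        using PQ[OF xX l] PQ[OF w, of "Suc l"] l p(3,4) q s(2) l' by fastforce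
    qed
    have P1: "P w l \<longleftrightarrow> P w l0" if w: "w \<in> X" and l: "l0 \<le> l" for w l
      using l
    proof (induction l rule: dec_induct)
      case (step l)
      obtain x where "x \<in> A.U 1 w" using A.up_ne[OF w] by blast
      then show ?case using step.IH stepA[OF w step.hyps(1)] by blast
    qed simp
    have P2: "P x l0 \<longleftrightarrow> P w l0" if w: "w \<in> X" and x: "x \<in> A.U 1 w" for w x
      using stepA[OF w order.refl x] stepB[OF w order.refl x] by blast
    have P3: "P x l0 \<longleftrightarrow> P w l0" if "w \<in> X" "x \<in> A.U r w" for w x r
      using that
    proof (induction r arbitrary: x)
      case 0
      then have "x = w" using A.up_0 by blast
      then show ?case by simp
    next
      case (Suc r)
      then obtain y where y: "y \<in> A.U r w" "x \<in> A.U 1 y" using A.up_split[OF Suc.prems(1), of x r 1] by auto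
      then have "y \<in> X" using A.up_sub by blast
      then show ?case using P2 y Suc.IH[OF Suc.prems(1) y(1)] by simp
    qed
    have P4: "P w l0 \<longleftrightarrow> P z l0" if z: "z \<in> X" and w: "w \<in> X" for z w
    proof -
      obtain r s t u v x where c: "u \<in> A.D r z" "v \<in> A.D s w" "x \<in> A.U t u" "x \<in> A.U t v"
        by (rule A.connect[OF z w])
      have X: "u \<in> X" "v \<in> X" using c A.up_sub by blast+
      have "z \<in> A.U r u" "w \<in> A.U s v" using c A.up_down X z w by blast+
      then show ?thesis using P3 X c by metis
    qed
    obtain z where z: "z \<in> X" using A.nonempty by blast
    show "ascending l0 \<phi> \<or> (\<forall>w\<in>X. \<forall>l\<ge>l0. \<forall>v\<in>A.U l w. h' (\<phi> v) - h' (\<phi> w) \<le> - (real l / 2))"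
    proof (cases "P z l0")
      case True
      then have "P w l" if "w \<in> X" "l0 \<le> l" for w l using P4[OF z that(1)] P1[OF that] by simp
      then show ?thesis unfolding ascending_def P_def by blast
    next
      case False
      then have "\<not> P w l" if "w \<in> X" "l0 \<le> l" for w l using P4[OF z that(1)] P1[OF that] by simp
      then have "Q w l" if "w \<in> X" "l0 \<le> l" for w l using PQ that by blast
      then show ?thesis unfolding Q_def by blast
    qed
  qed
qed

lemma ascending_vertical:
  assumes qi: "qi L \<phi>" and up: "ascending l0 \<phi>" and w: "w \<in> X" and v: "v \<in> A.U j w"
  shows "h' (\<phi> w) - L * (real l0 + 1) \<le> h' (\<phi> v)"
    "h' (\<phi> w) - L * (real l0 + 3) \<le> b' (\<phi> w) (\<phi> v)" "c' (\<phi> w) (\<phi> v) \<le> h' (\<phi> v) + L * (real l0 + 3)"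
proof -
  have L1: "1 \<le> L" using qiD(1)[OF qi] .
  have mono: "h' (\<phi> w) - L * (real l0 + 1) \<le> h' (\<phi> v)" if w: "w \<in> X" and v: "v \<in> A.U j w" for w v j
  proof (cases "l0 \<le> j")
    case True
    then have "real j / 2 \<le> h' (\<phi> v) - h' (\<phi> w)" using up w v unfolding ascending_def by blast
    moreover have "0 \<le> L * (real l0 + 1)" using L1 by simp
    moreover have "0 \<le> real j / 2" by simp
    ultimately show ?thesis by linarith
  next
    case False
    have vX: "v \<in> X" using v A.up_sub by blast
    have "A.rho w v = real j" using v unfolding A.up_iff[OF w] box_dist_def by simp
    then have "B.rho (\<phi> w) (\<phi> v) \<le> L * real j + L" using qiD(3)[OF qi w vX] by simp
    also have "\<dots> = L * (real j + 1)" by (simp add: algebra_simps)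
    also have "\<dots> \<le> L * (real l0 + 1)" using False L1 by (intro mult_left_mono) auto
    finally show ?thesis using B.rho_ge[OF qiD(2)[OF qi w] qiD(2)[OF qi vX]] by linarith
  qed
  show "h' (\<phi> w) - L * (real l0 + 1) \<le> h' (\<phi> v)" by (rule mono[OF w v])
  have e: "L * (real l0 + 3) = L * (real l0 + 1) + 2 * L" by (simp add: algebra_simps)
  have L0: "0 \<le> L * (real l0 + 1)" using L1 by simp
  show "h' (\<phi> w) - L * (real l0 + 3) \<le> b' (\<phi> w) (\<phi> v)"
    using v
  proof (induction j arbitrary: v)
    case 0
    then have "v = w" using A.up_0[OF w] by blast
    then show ?case using B.b_refl[OF qiD(2)[OF qi w]] L1 by simp
  next
    case (Suc j)
    then obtain u where u: "u \<in> A.U j w" "v \<in> A.U 1 u" using A.up_split[OF w, of v j 1] by auto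
    have X: "u \<in> X" "v \<in> X" using u Suc.prems A.up_sub by blast+
    have Y: "\<phi> w \<in> Y" "\<phi> u \<in> Y" "\<phi> v \<in> Y" using qiD(2)[OF qi] w X by auto
    have "h' (\<phi> u) - 2 * L \<le> b' (\<phi> u) (\<phi> v)"
      using unit_step(1)[OF qi X(1) u(2)] B.bc(3)[OF Y(2,3)] unfolding box_dist_def by linarith
    then have "h' (\<phi> w) - L * (real l0 + 3) \<le> b' (\<phi> u) (\<phi> v)" using mono[OF w u(1)] unfolding e by linarith
    then show ?case using B.ultra_cases(1)[OF Y] Suc.IH[OF u(1)] by linarith
  qed
  show "c' (\<phi> w) (\<phi> v) \<le> h' (\<phi> v) + L * (real l0 + 3)"
    using w v
  proof (induction j arbitrary: w)
    case 0
    then have "v = w" using A.up_0 by blast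
    then show ?case using B.c_refl[OF qiD(2)[OF qi 0(1)]] L1 by simp
  next
    case (Suc j)
    then obtain u where u: "u \<in> A.U 1 w" "v \<in> A.U j u" using A.up_split[OF Suc.prems(1), of v 1 j] by auto
    have X: "u \<in> X" "v \<in> X" using u Suc.prems A.up_sub by blast+
    have Y: "\<phi> w \<in> Y" "\<phi> u \<in> Y" "\<phi> v \<in> Y" using qiD(2)[OF qi] Suc.prems X by auto
    have "c' (\<phi> w) (\<phi> u) \<le> h' (\<phi> u) + 2 * L"
      using unit_step(1)[OF qi Suc.prems(1) u(1)] B.bc(2)[OF Y(1,2)] unfolding box_dist_def by linarith
    then have "c' (\<phi> w) (\<phi> u) \<le> h' (\<phi> v) + L * (real l0 + 3)" using mono[OF X(1) u(2)] unfolding e by linarith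
    then show ?case using B.ultra_cases(2)[OF Y] Suc.IH[OF X(1) u(2)] by linarith
  qed
qed

text \<open>If \<open>z\<close> is mapped much higher than \<open>y\<close>, then the images of the exponentially many points not far
  above \<open>y\<close> must all lie near one vertical segment.\<close>

lemma same_b_height:
  assumes L: "1 \<le> L"
  shows "\<exists>C. \<forall>\<phi> z y. qi L \<phi> \<longrightarrow> ascending l0 \<phi> \<longrightarrow> z \<in> X \<longrightarrow> y \<in> X \<longrightarrow> h z = h y \<longrightarrow> h z \<le> b z y \<longrightarrow>
    h' (\<phi> z) - h' (\<phi> y) \<le> C"
proof -
  define M2 where "M2 = L * (real l0 + 3)"
  have M2: "0 \<le> M2" "L * (real l0 + 1) \<le> M2" unfolding M2_def using L by (auto simp: mult_left_mono)
  define K where "K = 16 * ball_bound M (2 * L * (3 * M2) + L)"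
  have K0: "0 \<le> K" unfolding K_def by (simp add: ball_bound_nonneg)
  have i0: "0 < 1 / L" using L by simp
  obtain l1 where l1: "\<And>l. l \<ge> l1 \<Longrightarrow> K * (real l + 1) ^ 3 * 2 powr (- (1 / L * real l)) \<le> 1 / 2"
    using exp_beats_cubic[OF i0, of "1 / 2" K] by auto
  show ?thesis
  proof (rule exI[of _ "max (real l1) L"], intro allI impI)
    fix \<phi> z y assume qi: "qi L \<phi>" and up: "ascending l0 \<phi>" and z: "z \<in> X" and y: "y \<in> X"
      and hh: "h z = h y" and bzy: "h z \<le> b z y"
    show "h' (\<phi> z) - h' (\<phi> y) \<le> max (real l1) L"
    proof (rule ccontr)
      assume big: "\<not> h' (\<phi> z) - h' (\<phi> y) \<le> max (real l1) L"
      define \<Delta> where "\<Delta> = h' (\<phi> z) - h' (\<phi> y)"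
      have D: "real l1 < \<Delta>" "L < \<Delta>" using big unfolding \<Delta>_def by auto
      have D0: "0 \<le> \<Delta>" using D L by linarith
      define s where "s = nat \<lfloor>(\<Delta> - L) / L\<rfloor>"
      have "0 \<le> (\<Delta> - L) / L" using D L by simp
      then have s: "real s \<le> (\<Delta> - L) / L" "(\<Delta> - L) / L - 1 \<le> real s" unfolding s_def by linarith+
      have "L * real s \<le> L * ((\<Delta> - L) / L)" using s(1) L by (intro mult_left_mono) auto
      then have Ls: "L * real s + L \<le> \<Delta>" using L by simp
      obtain R0 where R0: "c z y - h z \<le> real R0" using real_arch_simple by blast
      have zyY: "\<phi> z \<in> Y" "\<phi> y \<in> Y" using qiD(2)[OF qi] z y by auto
      have UX: "A.U s y \<subseteq> X" by (rule A.up_sub)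
      have near: "\<exists>i\<le>nat \<lfloor>\<Delta>\<rfloor>. \<exists>g\<in>Y. h' g = h' (\<phi> y) + real i \<and> b' g (\<phi> z) = h' (\<phi> y) + real i \<and>
        c' g (\<phi> y) = h' (\<phi> y) + real i \<and> B.rho (\<phi> w) g \<le> 3 * M2" if w: "w \<in> A.U s y" for w
      proof -
        have wX: "w \<in> X" using w UX by blast
        have wY: "\<phi> w \<in> Y" using qiD(2)[OF qi wX] .
        obtain q where q: "q \<in> A.U R0 w" using A.up_ne[OF wX] by blast
        have qX: "q \<in> X" using q A.up_sub by blast
        have qY: "\<phi> q \<in> Y" using qiD(2)[OF qi qX] .
        have qy: "q \<in> A.U (s + R0) y" by (rule A.up_trans[OF y w q])
        have "A.U (s + R0) y = A.U (s + R0) z"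
          using A.up_common[OF z y hh bzy, of "s + R0"] R0 by simp
        then have qz: "q \<in> A.U (s + R0) z" using qy by simp
        have 1: "h' (\<phi> y) - M2 \<le> h' (\<phi> w)" "c' (\<phi> y) (\<phi> w) \<le> h' (\<phi> w) + M2"
          using ascending_vertical[OF qi up y w] M2 unfolding M2_def[symmetric] by linarith+
        have 2: "h' (\<phi> w) - M2 \<le> b' (\<phi> w) (\<phi> q)" "h' (\<phi> z) - M2 \<le> b' (\<phi> z) (\<phi> q)"
          using ascending_vertical(2)[OF qi up wX q] ascending_vertical(2)[OF qi up z qz] unfolding M2_def[symmetric] .
        have "A.rho y w = real s" using w unfolding A.up_iff[OF y] box_dist_def by simp
        then have "B.rho (\<phi> y) (\<phi> w) \<le> \<Delta>" using qiD(3)[OF qi y wX] Ls by simp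
        then have 3: "h' (\<phi> w) \<le> h' (\<phi> z)" using B.rho_ge[OF zyY(2) wY] unfolding \<Delta>_def by linarith
        have bwz: "h' (\<phi> w) - M2 \<le> b' (\<phi> w) (\<phi> z)"
          using B.ultra_cases(1)[OF wY qY zyY(1)] 2 3 B.bc(5)[OF zyY(1) qY] by linarith
        define k where "k = max (h' (\<phi> w)) (h' (\<phi> y))"
        have kI: "k \<in> \<int>" unfolding k_def using B.h_int wY zyY by (auto simp: max_def)
        have k: "h' (\<phi> w) \<le> k" "h' (\<phi> y) \<le> k" "k \<le> h' (\<phi> z)" "k \<le> h' (\<phi> w) + M2"
          unfolding k_def using 1 3 D0 M2 unfolding \<Delta>_def by linarith+
        obtain g where g: "g \<in> Y" "h' g = k" "b' g (\<phi> z) = k" "c' g (\<phi> y) = k"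
          using B.join[OF zyY(2,1) kI k(2,3)] by blast
        obtain kk Hk where kk: "k = of_int kk" "h' (\<phi> y) = of_int Hk"
          using kI B.h_int[OF zyY(2)] by (auto elim!: Ints_cases)
        define i where "i = nat (kk - Hk)"
        have i: "k = h' (\<phi> y) + real i" using kk k unfolding i_def by simp
        have ia: "i \<le> nat \<lfloor>\<Delta>\<rfloor>" using i k(3) unfolding \<Delta>_def by (simp add: le_nat_floor)
        have "h' (\<phi> w) - M2 \<le> b' (\<phi> w) g"
          using B.ultra_cases(1)[OF wY zyY(1) g(1)] bwz B.bc(5)[OF g(1) zyY(1)] g(3) k(1) M2(1) by linarith
        moreover have "c' (\<phi> w) g \<le> h' (\<phi> w) + M2"
          using B.ultra_cases(2)[OF wY zyY(2) g(1)] 1(2) g(4) k(4) B.bc(6)[OF zyY(2) wY] B.bc(6)[OF g(1) zyY(2)] by linarith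
        ultimately have "B.rho (\<phi> w) g \<le> 3 * M2" using M2 unfolding box_dist_def by linarith
        then show ?thesis using g i ia by auto
      qed
      have "real (card (A.U s y)) \<le> (\<Delta> + 1) * ball_bound M (2 * L * (3 * M2) + L)"
        by (rule card_near_segment[OF qi zyY(2,1) D0 _ UX near]) (use M2 in auto)
      then have "real m ^ s \<le> (\<Delta> + 1) * ball_bound M (2 * L * (3 * M2) + L)" using A.card_up[OF y] by simp
      moreover have "2 powr real s \<le> real m ^ s"
        using A.m_ge_2 power_mono[of 2 "real m" s] by (simp add: powr_realpow)
      ultimately have 1: "2 powr real s \<le> (\<Delta> + 1) * ball_bound M (2 * L * (3 * M2) + L)" by linarith
      define l where "l = nat \<lceil>\<Delta>\<rceil>"
      have l: "\<Delta> \<le> real l" "real l \<le> \<Delta> + 1" "l1 \<le> l" using D D0 unfolding l_def by linarith+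
      have "(\<Delta> - L) / L = \<Delta> / L - 1" using L by (simp add: field_simps)
      moreover have "real l / L - 1 \<le> \<Delta> / L"
      proof -
        have "real l / L \<le> (\<Delta> + 1) / L" using l L by (intro divide_right_mono) auto
        also have "\<dots> = \<Delta> / L + 1 / L" by (simp add: add_divide_distrib)
        also have "1 / L \<le> 1" using L by simp
        finally show ?thesis by simp
      qed
      ultimately have "1 / L * real l - 3 \<le> real s" using s(2) by simp
      then have "2 powr (1 / L * real l - 3) \<le> 2 powr real s" by simp
      also have "\<dots> \<le> (real l + 1) * ball_bound M (2 * L * (3 * M2) + L)"
        by (rule order_trans[OF 1]) (intro mult_right_mono ball_bound_nonneg, use l in simp)
      finally have "2 powr (1 / L * real l - 3) * (8 * 2 powr (- (1 / L * real l))) \<le>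
        (real l + 1) * ball_bound M (2 * L * (3 * M2) + L) * (8 * 2 powr (- (1 / L * real l)))"
        by (intro mult_right_mono) auto
      moreover have "2 powr (1 / L * real l - 3) * (8 * 2 powr (- (1 / L * real l))) = 1"
      proof -
        have "(8::real) = 2 powr 3" by simp
        then have "2 powr (1 / L * real l - 3) * (8 * 2 powr (- (1 / L * real l))) =
          2 powr ((1 / L * real l - 3) + 3 + (- (1 / L * real l)))" by (simp only: powr_add mult.assoc)
        then show ?thesis by simp
      qed
      moreover have "K * (real l + 1) * 2 powr (- (1 / L * real l)) =
        2 * ((real l + 1) * ball_bound M (2 * L * (3 * M2) + L) * (8 * 2 powr (- (1 / L * real l))))"
        unfolding K_def by simp
      ultimately have "2 \<le> K * (real l + 1) * 2 powr (- (1 / L * real l))" by linarith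
      also have "\<dots> \<le> K * (real l + 1) ^ 3 * 2 powr (- (1 / L * real l))"
        using K0 power_increasing[of 1 3 "real l + 1"] by (intro mult_right_mono mult_left_mono) auto
      also have "\<dots> \<le> 1 / 2" by (rule l1[OF l(3)])
      finally show False by simp
    qed
  qed
qed

lemma ascending_levels:
  assumes L: "1 \<le> L"
  shows "\<exists>C. \<forall>\<phi>. qi L \<phi> \<longrightarrow> ascending l0 \<phi> \<longrightarrow> (\<forall>z\<in>X. \<forall>w\<in>X. h z = h w \<longrightarrow> \<bar>h' (\<phi> z) - h' (\<phi> w)\<bar> \<le> C)"
proof -
  interpret F: box_pair X "\<lambda>z. - h z" "\<lambda>z w. - c z w" "\<lambda>z w. - b z w" n m
     Y "\<lambda>z. - h' z" "\<lambda>z w. - c' z w" "\<lambda>z w. - b' z w" n' m' M by (rule flip_both)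
  obtain C1 where C1: "\<forall>\<phi> z y. qi L \<phi> \<longrightarrow> ascending l0 \<phi> \<longrightarrow> z \<in> X \<longrightarrow> y \<in> X \<longrightarrow> h z = h y \<longrightarrow> h z \<le> b z y \<longrightarrow>
    h' (\<phi> z) - h' (\<phi> y) \<le> C1" using same_b_height[OF L, of l0] by (elim exE) (rule that)
  obtain C2 where C2: "\<forall>\<phi> z y. qi L \<phi> \<longrightarrow> F.ascending l0 \<phi> \<longrightarrow> z \<in> X \<longrightarrow> y \<in> X \<longrightarrow> - h z = - h y \<longrightarrow> - h z \<le> - c z y \<longrightarrow>
    - h' (\<phi> z) - - h' (\<phi> y) \<le> C2" using F.same_b_height[OF L, of l0] unfolding flip_simps by (elim exE) (rule that)
  show ?thesis
  proof (rule exI[of _ "C1 + C2"], intro allI impI ballI)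
    fix \<phi> z w assume qi: "qi L \<phi>" and up: "ascending l0 \<phi>" and z: "z \<in> X" and w: "w \<in> X" and hh: "h z = h w"
    have up': "F.ascending l0 \<phi>"
      unfolding F.ascending_def
    proof (intro ballI allI impI)
      fix x l v assume "x \<in> X" "l0 \<le> l" "v \<in> A.D l x"
      moreover from this have "v \<in> X" using A.up_sub by blast
      ultimately have "real l / 2 \<le> h' (\<phi> x) - h' (\<phi> v)" using up A.up_down unfolding ascending_def by blast
      then show "real l / 2 \<le> - h' (\<phi> v) - - h' (\<phi> x)" by simp
    qed
    obtain g where g: "g \<in> X" "h g = h z" "b g z = h z" "c g w = h z"
      using A.join[OF w z A.h_int[OF z]] hh by auto
    have s: "b z g = h z" "c w g = h z" using A.bc(5,6)[OF z g(1)] A.bc(5,6)[OF w g(1)] g by auto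
    have "h' (\<phi> z) - h' (\<phi> g) \<le> C1" "h' (\<phi> g) - h' (\<phi> z) \<le> C1"
      using C1 qi up z g s by auto
    moreover have "h' (\<phi> w) - h' (\<phi> g) \<le> C2" "h' (\<phi> g) - h' (\<phi> w) \<le> C2"
      using C2[rule_format, OF qi up' g(1) w] C2[rule_format, OF qi up' w g(1)] g s hh by auto
    ultimately show "\<bar>h' (\<phi> z) - h' (\<phi> w)\<bar> \<le> C1 + C2" by linarith
  qed
qed

lemma levels_respected_growth:
  assumes L: "1 \<le> L" and mM: "m = M" and M: "M = m' \<or> M = n'"
  shows "\<exists>C l0. 0 < l0 \<and> (\<forall>\<phi>. qi L \<phi> \<longrightarrow> (\<forall>z\<in>X. \<forall>w\<in>X. h z = h w \<longrightarrow> \<bar>h' (\<phi> z) - h' (\<phi> w)\<bar> \<le> C) \<and>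
    (\<forall>w\<in>X. \<forall>l\<ge>l0. \<forall>v\<in>A.U l w. real l / 2 \<le> \<bar>h' (\<phi> v) - h' (\<phi> w)\<bar>))"
proof -
  interpret T: box_pair X h b c m n Y "\<lambda>z. - h' z" "\<lambda>z w. - c' z w" "\<lambda>z w. - b' z w" n' m' M
    by (rule flip_target)
  obtain l0 where l0: "0 < l0" and sign: "\<forall>\<phi>. qi L \<phi> \<longrightarrow> ascending l0 \<phi> \<or>
    (\<forall>w\<in>X. \<forall>l\<ge>l0. \<forall>v\<in>A.U l w. h' (\<phi> v) - h' (\<phi> w) \<le> - (real l / 2))"
    using global_sign[OF L mM M] by (elim exE conjE) (rule that)
  obtain C1 where C1: "\<forall>\<phi>. qi L \<phi> \<longrightarrow> ascending l0 \<phi> \<longrightarrow> (\<forall>z\<in>X. \<forall>w\<in>X. h z = h w \<longrightarrow> \<bar>h' (\<phi> z) - h' (\<phi> w)\<bar> \<le> C1)"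
    using ascending_levels[OF L, of l0] by (elim exE) (rule that)
  obtain C2 where C2: "\<forall>\<phi>. qi L \<phi> \<longrightarrow> T.ascending l0 \<phi> \<longrightarrow> (\<forall>z\<in>X. \<forall>w\<in>X. h z = h w \<longrightarrow> \<bar>- h' (\<phi> z) - - h' (\<phi> w)\<bar> \<le> C2)"
    using T.ascending_levels[OF L, of l0] unfolding flip_simps by (elim exE) (rule that)
  show ?thesis
  proof (rule exI[of _ "max C1 C2"], rule exI[of _ l0], intro conjI l0 allI impI)
    fix \<phi> assume qi: "qi L \<phi>"
    have s: "ascending l0 \<phi> \<or> T.ascending l0 \<phi>"
      using sign[rule_format, OF qi]
    proof
      assume *: "\<forall>w\<in>X. \<forall>l\<ge>l0. \<forall>v\<in>A.U l w. h' (\<phi> v) - h' (\<phi> w) \<le> - (real l / 2)"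
      have "T.ascending l0 \<phi>" unfolding T.ascending_def
      proof (intro ballI allI impI)
        fix w l v assume "w \<in> X" "l0 \<le> l" "v \<in> A.U l w"
        then have "h' (\<phi> v) - h' (\<phi> w) \<le> - (real l / 2)" using * by blast
        then show "real l / 2 \<le> - h' (\<phi> v) - - h' (\<phi> w)" by simp
      qed
      then show ?thesis ..
    qed simp
    show "\<forall>z\<in>X. \<forall>w\<in>X. h z = h w \<longrightarrow> \<bar>h' (\<phi> z) - h' (\<phi> w)\<bar> \<le> max C1 C2"
    proof (intro ballI impI)
      fix z w assume "z \<in> X" "w \<in> X" "h z = h w"
      then have "\<bar>h' (\<phi> z) - h' (\<phi> w)\<bar> \<le> C1 \<or> \<bar>- h' (\<phi> z) - - h' (\<phi> w)\<bar> \<le> C2"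
        using s C1 C2 qi by blast
      then show "\<bar>h' (\<phi> z) - h' (\<phi> w)\<bar> \<le> max C1 C2" by linarith
    qed
    show "\<forall>w\<in>X. \<forall>l\<ge>l0. \<forall>v\<in>A.U l w. real l / 2 \<le> \<bar>h' (\<phi> v) - h' (\<phi> w)\<bar>"
    proof (intro ballI allI impI)
      fix w l v assume *: "w \<in> X" "l0 \<le> l" "v \<in> A.U l w"
      from s show "real l / 2 \<le> \<bar>h' (\<phi> v) - h' (\<phi> w)\<bar>"
      proof
        assume "ascending l0 \<phi>"
        then have "real l / 2 \<le> h' (\<phi> v) - h' (\<phi> w)" using * unfolding ascending_def by blast
        then show ?thesis by linarith
      next
        assume "T.ascending l0 \<phi>"
        then have "real l / 2 \<le> - h' (\<phi> v) - - h' (\<phi> w)" using * unfolding T.ascending_def by blast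
        then show ?thesis by linarith
      qed
    qed
  qed
qed

theorem levels_respected:
  assumes L: "1 \<le> L" and mM: "M = m \<or> M = n" and M: "M = m' \<or> M = n'"
  shows "\<exists>C l0. 0 < l0 \<and> (\<forall>\<phi>. qi L \<phi> \<longrightarrow> (\<forall>z\<in>X. \<forall>w\<in>X. h z = h w \<longrightarrow> \<bar>h' (\<phi> z) - h' (\<phi> w)\<bar> \<le> C) \<and>
    (\<forall>w\<in>X. \<forall>l\<ge>l0. \<forall>v\<in>A.U l w. real l / 2 \<le> \<bar>h' (\<phi> v) - h' (\<phi> w)\<bar>))"
  using mM
proof
  assume "M = m"
  then show ?thesis using levels_respected_growth[OF L _ M] by simp
next
  assume "M = n"
  interpret S: box_pair X "\<lambda>z. - h z" "\<lambda>z w. - c z w" "\<lambda>z w. - b z w" n m Y h' b' c' m' n' M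
    by (rule flip_source)
  obtain C l0 where l0: "0 < l0" and *: "\<forall>\<phi>. qi L \<phi> \<longrightarrow> (\<forall>z\<in>X. \<forall>w\<in>X. - h z = - h w \<longrightarrow> \<bar>h' (\<phi> z) - h' (\<phi> w)\<bar> \<le> C) \<and>
    (\<forall>w\<in>X. \<forall>l\<ge>l0. \<forall>v\<in>A.D l w. real l / 2 \<le> \<bar>h' (\<phi> v) - h' (\<phi> w)\<bar>)"
    using S.levels_respected_growth[OF L \<open>M = n\<close>[symmetric] M] unfolding flip_simps minus_minus by (elim exE conjE) (rule that)
  show ?thesis
  proof (rule exI[of _ C], rule exI[of _ l0], intro conjI l0 allI impI ballI)
    fix \<phi> z w assume "qi L \<phi>" "z \<in> X" "w \<in> X" "h z = h w"
    then show "\<bar>h' (\<phi> z) - h' (\<phi> w)\<bar> \<le> C" using * by simp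
  next
    fix \<phi> w l v assume a: "qi L \<phi>" "w \<in> X" "l0 \<le> l" "v \<in> A.U l w"
    have v: "v \<in> X" using a(4) A.up_sub by blast
    then have "w \<in> A.D l v" using a A.up_down by blast
    then have "real l / 2 \<le> \<bar>h' (\<phi> w) - h' (\<phi> v)\<bar>" using * a v by blast
    then show "real l / 2 \<le> \<bar>h' (\<phi> v) - h' (\<phi> w)\<bar>" by (simp add: abs_minus_commute)
  qed
qed

end

section \<open>Trees with a distinguished end\<close>

locale horotree =
  fixes V :: "'a set" and par :: "'a \<Rightarrow> 'a" and ht :: "'a \<Rightarrow> int" and m :: nat
  assumes nonempty: "V \<noteq> {}"
    and par_in: "\<And>x. x \<in> V \<Longrightarrow> par x \<in> V"
    and ht_par: "\<And>x. x \<in> V \<Longrightarrow> ht (par x) = ht x - 1"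
    and card_children: "\<And>x. x \<in> V \<Longrightarrow> card {y \<in> V. par y = x} = m"
    and m_pos: "0 < m"
    and common: "\<And>x y. x \<in> V \<Longrightarrow> y \<in> V \<Longrightarrow> \<exists>i j. (par ^^ i) x = (par ^^ j) y"
begin

definition anc :: "'a \<Rightarrow> int \<Rightarrow> 'a" where "anc x k = (par ^^ nat (ht x - k)) x"
definition desc :: "nat \<Rightarrow> 'a \<Rightarrow> 'a set" where "desc r x = {y \<in> V. (par ^^ r) y = x}"
definition meet :: "'a \<Rightarrow> 'a \<Rightarrow> int" where
  "meet x y = ht x - int (LEAST i. \<exists>j. (par ^^ i) x = (par ^^ j) y)"

lemma iter_in: "x \<in> V \<Longrightarrow> (par ^^ i) x \<in> V" and ht_iter: "x \<in> V \<Longrightarrow> ht ((par ^^ i) x) = ht x - int i"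
  by (induction i) (auto simp: par_in ht_par)

lemma anc_in: "x \<in> V \<Longrightarrow> anc x k \<in> V"
  unfolding anc_def by (rule iter_in)

lemma ht_anc: "x \<in> V \<Longrightarrow> k \<le> ht x \<Longrightarrow> ht (anc x k) = k"
  unfolding anc_def by (simp add: ht_iter)

lemma anc_self: "anc x (ht x) = x"
  unfolding anc_def by simp

lemma anc_anc: "x \<in> V \<Longrightarrow> j \<le> k \<Longrightarrow> k \<le> ht x \<Longrightarrow> anc (anc x k) j = anc x j"
proof -
  assume "x \<in> V" "j \<le> k" "k \<le> ht x"
  then have "nat (k - j) + nat (ht x - k) = nat (ht x - j)" by simp
  then show ?thesis
    using ht_anc[OF \<open>x \<in> V\<close> \<open>k \<le> ht x\<close>] unfolding anc_def by (metis comp_apply funpow_add)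
qed

lemma iter_eq_anc: "(par ^^ i) x = anc x (ht x - int i)"
  unfolding anc_def by simp

lemma anc_eq_mono:
  assumes "x \<in> V" "y \<in> V" "anc x k = anc y k" "k \<le> ht x" "k \<le> ht y" "j \<le> k" shows "anc x j = anc y j"
  using anc_anc[OF assms(1,6,4)] anc_anc[OF assms(2,6,5)] assms(3) by simp

lemma meet_props:
  assumes "x \<in> V" "y \<in> V"
  shows "meet x y \<le> ht x" "meet x y \<le> ht y"
    and meet_iff: "k \<le> ht x \<Longrightarrow> k \<le> ht y \<Longrightarrow> anc x k = anc y k \<longleftrightarrow> k \<le> meet x y"
proof -
  define P where "P i \<longleftrightarrow> (\<exists>j. (par ^^ i) x = (par ^^ j) y)" for i
  define I where "I = (LEAST i. P i)"
  have P: "P i \<longleftrightarrow> ht x - int i \<le> ht y \<and> anc x (ht x - int i) = anc y (ht x - int i)" for i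
  proof
    assume "P i"
    then obtain j where j: "(par ^^ i) x = (par ^^ j) y" unfolding P_def by blast
    then have "ht x - int i = ht y - int j" using ht_iter[OF assms(1), of i] ht_iter[OF assms(2), of j] by simp
    then show "ht x - int i \<le> ht y \<and> anc x (ht x - int i) = anc y (ht x - int i)"
      using j unfolding iter_eq_anc by simp
  next
    assume *: "ht x - int i \<le> ht y \<and> anc x (ht x - int i) = anc y (ht x - int i)"
    then have "(par ^^ i) x = (par ^^ nat (ht y - (ht x - int i))) y"
      unfolding iter_eq_anc by simp
    then show "P i" unfolding P_def by blast
  qed
  have "\<exists>i. P i" using common[OF assms] unfolding P_def by blast
  then have PI: "P I" unfolding I_def by (metis LeastI)
  have le: "I \<le> i" if "P i" for i unfolding I_def using that by (rule Least_le)
  have meet: "meet x y = ht x - int I" unfolding meet_def I_def P_def ..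
  show "meet x y \<le> ht x" unfolding meet by simp
  show my: "meet x y \<le> ht y" using PI unfolding meet P by simp
  assume k: "k \<le> ht x" "k \<le> ht y"
  show "anc x k = anc y k \<longleftrightarrow> k \<le> meet x y"
  proof
    assume "anc x k = anc y k"
    then have "P (nat (ht x - k))" unfolding P using k by simp
    then show "k \<le> meet x y" using le[of "nat (ht x - k)"] unfolding meet using k by linarith
  next
    assume "k \<le> meet x y"
    moreover have "anc x (meet x y) = anc y (meet x y)" using PI unfolding P meet by blast
    ultimately show "anc x k = anc y k"
      using anc_eq_mono[OF assms, of "meet x y" k] my unfolding meet by simp
  qed
qed

lemma anc_meet: "x \<in> V \<Longrightarrow> y \<in> V \<Longrightarrow> anc x (meet x y) = anc y (meet x y)"
  using meet_iff meet_props by blast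

lemma meet_sym: "x \<in> V \<Longrightarrow> y \<in> V \<Longrightarrow> meet x y = meet y x"
  by (metis antisym anc_meet meet_iff meet_props(1,2))

lemma meet_refl: "x \<in> V \<Longrightarrow> meet x x = ht x"
  by (metis antisym meet_iff meet_props(1) order.refl)

lemma meet_ultra:
  assumes "x \<in> V" "y \<in> V" "z \<in> V" shows "min (meet x y) (meet y z) \<le> meet x z"
proof -
  define k where "k = min (meet x y) (meet y z)"
  have k: "k \<le> meet x y" "k \<le> meet y z" "k \<le> ht x" "k \<le> ht y" "k \<le> ht z"
    using meet_props(1,2)[OF assms(1,2)] meet_props(1,2)[OF assms(2,3)] unfolding k_def by auto
  then have "anc x k = anc y k" "anc y k = anc z k" using meet_iff assms by blast+
  then have "anc x k = anc z k" by simp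
  then show ?thesis using meet_iff[OF assms(1,3) k(3,5)] unfolding k_def by blast
qed

lemma meet_anc: "x \<in> V \<Longrightarrow> k \<le> ht x \<Longrightarrow> meet (anc x k) x = k"
proof -
  assume *: "x \<in> V" "k \<le> ht x"
  have "meet (anc x k) x \<le> k" using meet_props(1)[OF anc_in[OF *(1)] *(1), of k] ht_anc[OF *] by simp
  moreover have "anc (anc x k) k = anc x k" using anc_anc[OF *(1) order.refl *(2)] .
  then have "k \<le> meet (anc x k) x" using meet_iff[OF anc_in[OF *(1)] *(1), of k k] ht_anc[OF *] *(2) by simp
  ultimately show ?thesis by simp
qed

lemma meet_eq_iff:
  assumes "x \<in> V" "y \<in> V" shows "meet x y = ht y \<longleftrightarrow> ht y \<le> ht x \<and> y = anc x (ht y)"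
proof
  assume *: "meet x y = ht y"
  then have "ht y \<le> ht x" using meet_props(1)[OF assms] by simp
  then show "ht y \<le> ht x \<and> y = anc x (ht y)"
    using meet_iff[OF assms, of "ht y"] * anc_self[of y] by simp
next
  assume *: "ht y \<le> ht x \<and> y = anc x (ht y)"
  then have "anc x (ht y) = anc y (ht y)" using anc_self[of y] by simp
  then have "ht y \<le> meet x y" using meet_iff[OF assms, of "ht y"] * by simp
  then show "meet x y = ht y" using meet_props(2)[OF assms] by simp
qed

lemma desc_iff: "x \<in> V \<Longrightarrow> y \<in> desc r x \<longleftrightarrow> y \<in> V \<and> ht y = ht x + int r \<and> anc y (ht x) = x"
  unfolding desc_def using ht_iter[of y r] by (auto simp: anc_def)

lemma card_desc: "x \<in> V \<Longrightarrow> finite (desc r x) \<and> card (desc r x) = m ^ r"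
proof (induction r)
  case 0
  then have "desc 0 x = {x}" unfolding desc_def by auto
  then show ?case by simp
next
  case (Suc r)
  have eq: "desc (Suc r) x = (\<Union>z\<in>desc r x. {y \<in> V. par y = z})"
    unfolding desc_def by (auto simp: funpow_swap1 par_in)
  have fin: "finite {y \<in> V. par y = z}" if "z \<in> desc r x" for z
    using card_children[of z] that m_pos unfolding desc_def by (intro card_ge_0_finite) auto
  have "card (desc (Suc r) x) = (\<Sum>z\<in>desc r x. card {y \<in> V. par y = z})"
    unfolding eq using Suc fin by (intro card_UN_disjoint) auto
  also have "\<dots> = (\<Sum>z\<in>desc r x. m)" using card_children unfolding desc_def by (intro sum.cong) auto
  also have "\<dots> = m ^ Suc r" using Suc by simp
  finally show ?case using Suc fin unfolding eq by auto
qed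

lemma ht_surj: "\<exists>x\<in>V. ht x = k"
proof -
  obtain x where x: "x \<in> V" using nonempty by blast
  show ?thesis
  proof (cases "k \<le> ht x")
    case True
    then show ?thesis using ht_anc anc_in x by blast
  next
    case False
    have "desc (nat (k - ht x)) x \<noteq> {}" using card_desc[OF x, of "nat (k - ht x)"] m_pos by (metis card.empty power_not_zero not_less0)
    then obtain y where "y \<in> desc (nat (k - ht x)) x" by blast
    then show ?thesis using desc_iff[OF x] False by auto
  qed
qed

end

locale dl_pair = S: horotree V p f m + T: horotree W q g n
  for V :: "'a set" and p f m and W :: "'b set" and q g n
begin

definition verts :: "('a \<times> 'b) set" where "verts = {(x, y). x \<in> V \<and> y \<in> W \<and> f x + g y = 0}"
definition height :: "'a \<times> 'b \<Rightarrow> real" where "height z = of_int (f (fst z))"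
definition low :: "'a \<times> 'b \<Rightarrow> 'a \<times> 'b \<Rightarrow> real" where "low z w = of_int (S.meet (fst z) (fst w))"
definition high :: "'a \<times> 'b \<Rightarrow> 'a \<times> 'b \<Rightarrow> real" where "high z w = - of_int (T.meet (snd z) (snd w))"

lemma up_eq:
  assumes "(x, y) \<in> verts"
  shows "up_tree verts height low high r (x, y) = S.desc r x \<times> {T.anc y (g y - int r)}"
proof (intro set_eqI)
  fix v :: "'a \<times> 'b"
  obtain x' y' where v: "v = (x', y')" by (cases v)
  have xy: "x \<in> V" "y \<in> W" "f x + g y = 0" using assms unfolding verts_def by auto
  show "v \<in> up_tree verts height low high r (x, y) \<longleftrightarrow> v \<in> S.desc r x \<times> {T.anc y (g y - int r)}"
  proof
    assume "v \<in> up_tree verts height low high r (x, y)"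
    then have x': "x' \<in> V" "y' \<in> W" "f x' + g y' = 0" "real_of_int (f x') = real_of_int (f x) + real r"
      "S.meet x x' = f x" "real_of_int (- T.meet y y') = real_of_int (f x')"
      unfolding up_tree_def v verts_def height_def low_def high_def by auto
    have fx': "f x' = f x + int r" using x'(4) by (metis of_int_add of_int_eq_iff of_int_of_nat_eq)
    have gy': "T.meet y y' = g y'" using x'(6,3) by linarith
    have anc_eq: "y' = T.anc y (g y')" using T.meet_eq_iff[OF xy(2) x'(2)] gy' by blast
    have "S.meet x' x = f x" using x'(5) S.meet_sym[OF xy(1) x'(1)] by simp
    then have "x = S.anc x' (f x)" using S.meet_eq_iff[OF x'(1) xy(1)] by blast
    moreover have "g y' = g y - int r" using x'(3) fx' xy(3) by linarith
    ultimately show "v \<in> S.desc r x \<times> {T.anc y (g y - int r)}"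
      unfolding v using S.desc_iff[OF xy(1)] x'(1) fx' anc_eq by simp
  next
    assume "v \<in> S.desc r x \<times> {T.anc y (g y - int r)}"
    then have x': "x' \<in> V" "f x' = f x + int r" "S.anc x' (f x) = x" and y': "y' = T.anc y (g y - int r)"
      unfolding v using S.desc_iff[OF xy(1)] by auto
    have y'W: "y' \<in> W" "g y' = g y - int r" unfolding y' using T.anc_in T.ht_anc xy(2) by auto
    have "S.meet x' x = f x" using S.meet_eq_iff[OF x'(1) xy(1)] x' by simp
    then have 1: "S.meet x x' = f x" using S.meet_sym[OF xy(1) x'(1)] by simp
    have 2: "T.meet y y' = g y'" using T.meet_eq_iff[OF xy(2) y'W(1)] y' y'W(2) by simp
    have "f x' + g y' = 0" "- g y' = f x'" using x' y'W xy(3) by auto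
    then show "v \<in> up_tree verts height low high r (x, y)"
      unfolding up_tree_def v verts_def height_def low_def high_def using 1 2 x' y'W by (simp flip: of_int_minus)
  qed
qed

lemma down_eq:
  assumes "(x, y) \<in> verts"
  shows "up_tree verts (\<lambda>z. - height z) (\<lambda>z w. - high z w) (\<lambda>z w. - low z w) r (x, y) =
    {S.anc x (f x - int r)} \<times> T.desc r y"
proof (intro set_eqI)
  fix v :: "'a \<times> 'b"
  obtain x' y' where v: "v = (x', y')" by (cases v)
  have xy: "x \<in> V" "y \<in> W" "f x + g y = 0" using assms unfolding verts_def by auto
  show "v \<in> up_tree verts (\<lambda>z. - height z) (\<lambda>z w. - high z w) (\<lambda>z w. - low z w) r (x, y) \<longleftrightarrow>
      v \<in> {S.anc x (f x - int r)} \<times> T.desc r y"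
  proof
    assume "v \<in> up_tree verts (\<lambda>z. - height z) (\<lambda>z w. - high z w) (\<lambda>z w. - low z w) r (x, y)"
    then have x': "x' \<in> V" "y' \<in> W" "f x' + g y' = 0" "- real_of_int (f x') = - real_of_int (f x) + real r"
      "real_of_int (T.meet y y') = - real_of_int (f x)" "S.meet x x' = f x'"
      unfolding up_tree_def v verts_def height_def low_def high_def by auto
    have fx': "f x' = f x - int r" using x'(4) by linarith
    have gy: "T.meet y' y = g y" using x'(5) xy(3) T.meet_sym[OF xy(2) x'(2)] by linarith
    have "x' = S.anc x (f x')" using S.meet_eq_iff[OF xy(1) x'(1)] x'(6) by blast
    moreover have "y = T.anc y' (g y)" using T.meet_eq_iff[OF x'(2) xy(2)] gy by blast
    moreover have "g y' = g y + int r" using x'(3) xy(3) fx' by linarith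
    ultimately show "v \<in> {S.anc x (f x - int r)} \<times> T.desc r y"
      unfolding v using T.desc_iff[OF xy(2)] x'(2) fx' by simp
  next
    assume "v \<in> {S.anc x (f x - int r)} \<times> T.desc r y"
    then have y': "y' \<in> W" "g y' = g y + int r" "T.anc y' (g y) = y" and x': "x' = S.anc x (f x - int r)"
      unfolding v using T.desc_iff[OF xy(2)] by auto
    have x'V: "x' \<in> V" "f x' = f x - int r" unfolding x' using S.anc_in S.ht_anc xy(1) by auto
    have "T.meet y' y = g y" using T.meet_eq_iff[OF y'(1) xy(2)] y' by simp
    then have 1: "T.meet y y' = g y" using T.meet_sym[OF xy(2) y'(1)] by simp
    have 2: "S.meet x x' = f x'" using S.meet_eq_iff[OF xy(1) x'V(1)] x' x'V(2) by simp
    have "f x' + g y' = 0" "g y = - f x" using y' x'V xy(3) by auto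
    then show "v \<in> up_tree verts (\<lambda>z. - height z) (\<lambda>z w. - high z w) (\<lambda>z w. - low z w) r (x, y)"
      unfolding up_tree_def v verts_def height_def low_def high_def using 1 2 y' x'V by simp
  qed
qed

lemma rho_ball:
  assumes "(x, y) \<in> verts" "m \<le> M" "n \<le> M"
  shows "finite {w \<in> verts. box_dist low high (x, y) w \<le> real r} \<and>
    card {w \<in> verts. box_dist low high (x, y) w \<le> real r} \<le> (r + 1)\<^sup>2 * M ^ r"
proof -
  have xy: "x \<in> V" "y \<in> W" "f x + g y = 0" using assms(1) unfolding verts_def by auto
  define Q where "Q i s = S.desc s (S.anc x (f x - int i)) \<times> T.desc (r - s) (T.anc y (int i - int r - f x))" for i s
  define K where "K = {..r} \<times> {..r}"
  have sub: "{w \<in> verts. box_dist low high (x, y) w \<le> real r} \<subseteq> (\<Union>(i, s)\<in>K. Q i s)"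
  proof
    fix w assume "w \<in> {w \<in> verts. box_dist low high (x, y) w \<le> real r}"
    then obtain x' y' where w: "w = (x', y')" "x' \<in> V" "y' \<in> W" "f x' + g y' = 0"
      and d: "- real_of_int (T.meet y y') - real_of_int (S.meet x x') \<le> real r"
      unfolding verts_def box_dist_def low_def high_def by auto
    define k where "k = S.meet x x'"
    define t where "t = T.meet y y'"
    have kt: "- t - k \<le> int r" using d unfolding k_def t_def by linarith
    have k: "k \<le> f x" "k \<le> f x'" using S.meet_props(1,2)[OF xy(1) w(2)] unfolding k_def by auto
    have t: "t \<le> g y" "t \<le> g y'" using T.meet_props(1,2)[OF xy(2) w(3)] unfolding t_def by auto
    define i where "i = nat (f x - k)"
    define s where "s = nat (f x' - k)"
    have i: "f x - int i = k" "i \<le> r" using k kt t xy(3) unfolding i_def by linarith+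
    have s: "f x' = k + int s" "s \<le> r" using k kt t w(4) unfolding s_def by linarith+
    have Ax: "S.anc x k \<in> V" "f (S.anc x k) = k" using S.anc_in S.ht_anc k(1) xy(1) by auto
    have "S.anc x' k = S.anc x k" using S.anc_meet[OF xy(1) w(2)] unfolding k_def by simp
    then have 1: "x' \<in> S.desc s (S.anc x (f x - int i))" unfolding i(1) S.desc_iff[OF Ax(1)] Ax(2) using w(2) s by simp
    define j where "j = int i - int r - f x"
    have j: "j = - k - int r" unfolding j_def using i(1) by linarith
    have jt: "j \<le> t" "j \<le> g y" "j \<le> g y'" using kt t unfolding j by linarith+
    have Ay: "T.anc y j \<in> W" "g (T.anc y j) = j" using T.anc_in T.ht_anc jt(2) xy(2) by auto
    have "T.anc y' j = T.anc y j" using T.meet_iff[OF xy(2) w(3) jt(2,3)] jt(1) unfolding t_def by simp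
    moreover have "g y' = j + int (r - s)" using w(4) s unfolding j by (simp add: of_nat_diff)
    ultimately have 2: "y' \<in> T.desc (r - s) (T.anc y j)" unfolding T.desc_iff[OF Ay(1)] Ay(2) using w(3) by simp
    have "w \<in> Q i s" unfolding Q_def w(1) using 1 2 unfolding j_def by blast
    then show "w \<in> (\<Union>(i, s)\<in>K. Q i s)" unfolding K_def using i(2) s(2) by blast
  qed
  have Q: "finite (Q i s) \<and> card (Q i s) \<le> M ^ r" if "s \<le> r" for i s
  proof -
    have "S.anc x (f x - int i) \<in> V" "T.anc y (int i - int r - f x) \<in> W" using S.anc_in T.anc_in xy by auto
    then have "finite (Q i s) \<and> card (Q i s) = m ^ s * n ^ (r - s)"
      unfolding Q_def using S.card_desc T.card_desc by (simp add: card_cartesian_product)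
    moreover have "m ^ s * n ^ (r - s) \<le> M ^ s * M ^ (r - s)" using assms(2,3) by (intro mult_mono power_mono) auto
    moreover have "M ^ s * M ^ (r - s) = M ^ r" using that by (simp add: power_add[symmetric])
    ultimately show ?thesis by simp
  qed
  have fK: "finite K" unfolding K_def by simp
  have fin: "finite (\<Union>(i, s)\<in>K. Q i s)" using fK Q unfolding K_def by auto
  have "card {w \<in> verts. box_dist low high (x, y) w \<le> real r} \<le> card (\<Union>(i, s)\<in>K. Q i s)"
    by (rule card_mono[OF fin sub])
  also have "\<dots> \<le> (\<Sum>e\<in>K. card (case e of (i, s) \<Rightarrow> Q i s))" by (rule card_UN_le[OF fK])
  also have "\<dots> \<le> (\<Sum>e\<in>K. M ^ r)" using Q unfolding K_def by (intro sum_mono) auto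
  also have "\<dots> = (r + 1)\<^sup>2 * M ^ r" unfolding K_def by (simp add: power2_eq_square)
  finally show ?thesis using finite_subset[OF sub fin] by blast
qed

lemma box_space:
  assumes "2 \<le> m" "2 \<le> n" "m \<le> M" "n \<le> M"
  shows "box_space verts height low high m n M"
proof
  obtain x where x: "x \<in> V" using S.nonempty by blast
  obtain y where "y \<in> W" "g y = - f x" using T.ht_surj by blast
  then have "(x, y) \<in> verts" using x unfolding verts_def by simp
  then show "verts \<noteq> {}" by blast
next
  fix w z k assume w: "w \<in> verts" and z: "z \<in> verts" and k: "k \<in> \<int>" "height w \<le> k" "k \<le> height z"
  obtain i where i: "k = of_int i" using k(1) by (auto elim: Ints_cases)
  have ww: "fst w \<in> V" "snd w \<in> W" "f (fst w) + g (snd w) = 0" "f (fst w) \<le> i"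
    using w k(2) unfolding verts_def height_def i by auto
  have zz: "fst z \<in> V" "i \<le> f (fst z)" using z k(3) unfolding verts_def height_def i by auto
  have iw: "- i \<le> g (snd w)" using ww by linarith
  have "(S.anc (fst z) i, T.anc (snd w) (- i)) \<in> verts"
    unfolding verts_def using S.anc_in[OF zz(1)] T.anc_in[OF ww(2)] S.ht_anc[OF zz] T.ht_anc[OF ww(2) iw] by simp
  then show "\<exists>u\<in>verts. height u = k \<and> low u z = k \<and> high u w = k"
    by (intro bexI[of _ "(S.anc (fst z) i, T.anc (snd w) (- i))"])
      (simp_all add: height_def low_def high_def i S.ht_anc[OF zz] S.meet_anc[OF zz] T.meet_anc[OF ww(2) iw])
next
  fix z w assume "z \<in> verts" "w \<in> verts" "low z w = height z" "high z w = height z"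
  then have z: "fst z \<in> V" "snd z \<in> W" "f (fst z) + g (snd z) = 0" "fst w \<in> V" "snd w \<in> W" "f (fst w) + g (snd w) = 0"
    "S.meet (fst z) (fst w) = f (fst z)" "- T.meet (snd z) (snd w) = f (fst z)"
    unfolding verts_def low_def high_def height_def by (auto simp flip: of_int_minus)
  have le: "f (fst z) \<le> f (fst w)" using S.meet_props(2)[OF z(1,4)] z(7) by simp
  have "g (snd z) \<le> g (snd w)" using T.meet_props(2)[OF z(2,5)] z(8,3) by simp
  then have eq: "f (fst z) = f (fst w)" "g (snd z) = g (snd w)" using le z(3,6) by linarith+
  have "fst w = S.anc (fst z) (f (fst w))" using S.meet_eq_iff[OF z(1,4)] z(7) eq(1) by simp
  moreover have "T.meet (snd z) (snd w) = g (snd w)" using z(8,3) eq(2) by linarith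
  then have "snd w = T.anc (snd z) (g (snd w))" using T.meet_eq_iff[OF z(2,5)] by simp
  ultimately show "z = w" using S.anc_self[of "fst z"] T.anc_self[of "snd z"] eq by (simp add: prod_eq_iff)
next
  fix z r assume "z \<in> verts"
  then show "card (up_tree verts height low high r z) = m ^ r"
    using up_eq[of "fst z" "snd z" r] S.card_desc[of "fst z" r]
    unfolding verts_def by (auto simp: card_cartesian_product)
next
  fix z r assume "z \<in> verts"
  then show "card (up_tree verts (\<lambda>z. - height z) (\<lambda>z w. - high z w) (\<lambda>z w. - low z w) r z) = n ^ r"
    using down_eq[of "fst z" "snd z" r] T.card_desc[of "snd z" r]
    unfolding verts_def by (auto simp: card_cartesian_product)
next
  fix z r assume "z \<in> verts"
  then show "finite {w \<in> verts. box_dist low high z w \<le> real r} \<and>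
      card {w \<in> verts. box_dist low high z w \<le> real r} \<le> (r + 1)\<^sup>2 * M ^ r"
    using rho_ball[of "fst z" "snd z" M r] assms by simp
next
  fix z w u assume "z \<in> verts" "w \<in> verts" "u \<in> verts"
  then have X: "fst z \<in> V" "fst w \<in> V" "fst u \<in> V" "snd z \<in> W" "snd w \<in> W" "snd u \<in> W" unfolding verts_def by auto
  show "min (low z w) (low w u) \<le> low z u"
    using S.meet_ultra[OF X(1-3)] unfolding low_def by (simp flip: of_int_min)
  show "high z u \<le> max (high z w) (high w u)"
    using T.meet_ultra[OF X(4-6)] unfolding high_def by linarith
next
  fix z w assume "z \<in> verts" "w \<in> verts"
  then have X: "fst z \<in> V" "fst w \<in> V" "snd z \<in> W" "snd w \<in> W" "f (fst z) + g (snd z) = 0" unfolding verts_def by auto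
  show "low z w \<le> height z" unfolding low_def height_def using S.meet_props(1)[OF X(1,2)] by simp
  show "low z w = low w z" unfolding low_def using S.meet_sym[OF X(1,2)] by simp
  show "high z w = high w z" unfolding high_def using T.meet_sym[OF X(3,4)] by simp
  have "T.meet (snd z) (snd w) \<le> g (snd z)" by (rule T.meet_props(1)[OF X(3,4)])
  then show "height z \<le> high z w" unfolding high_def height_def using X(5) by linarith
next
  fix z assume "z \<in> verts"
  then have X: "fst z \<in> V" "snd z \<in> W" "f (fst z) + g (snd z) = 0" unfolding verts_def by auto
  show "low z z = height z" unfolding low_def height_def using S.meet_refl[OF X(1)] by simp
  show "high z z = height z" unfolding high_def height_def using T.meet_refl[OF X(2)] X(3) by linarith
  show "height z \<in> \<int>" unfolding height_def by simp
qed (rule assms)+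

end

section \<open>Busemann functions on regular trees\<close>

locale regular_tree_space = pair_bidirected_digraph T for T :: "'a pair_pre_digraph" +
  fixes d :: nat
  assumes regular_tree: "regular_tree d T"
begin

definition walk_dist :: "'a \<Rightarrow> 'a \<Rightarrow> nat" where
  "walk_dist u v = (LEAST k. \<exists>p. awalk u p v \<and> length p = k)"

definition nbrs :: "'a \<Rightarrow> 'a set" where "nbrs v = {u. (v, u) \<in> parcs T}"

lemma nbrs_sym: "u \<in> nbrs v \<longleftrightarrow> v \<in> nbrs u"
  unfolding nbrs_def using arcs_symmetric by blast

lemma nbrs_in: "u \<in> nbrs v \<Longrightarrow> u \<in> pverts T" "u \<in> nbrs v \<Longrightarrow> v \<in> pverts T" "u \<in> nbrs v \<Longrightarrow> u \<noteq> v"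
  unfolding nbrs_def using in_arcsD1 in_arcsD2 pair_no_loops[of "(v, u)"] by auto

lemma card_nbrs:
  assumes "v \<in> pverts T" shows "card (nbrs v) = d"
proof -
  have "out_arcs (with_proj T) v = Pair v ` nbrs v" unfolding out_arcs_def nbrs_def by auto
  moreover have "card (Pair v ` nbrs v) = card (nbrs v)" by (intro card_image inj_onI) auto
  moreover have "out_degree (with_proj T) v = d" using assms regular_tree unfolding regular_tree_def by simp
  ultimately show ?thesis unfolding out_degree_def by simp
qed

lemma walk_exists:
  assumes "u \<in> pverts T" "v \<in> pverts T" shows "\<exists>p. awalk u p v"
proof -
  have "strongly_connected (mk_symmetric (with_proj T))"
    using regular_tree unfolding regular_tree_def connected_def by simp
  then have "u \<rightarrow>\<^sup>*\<^bsub>with_proj (mk_symmetric (with_proj T))\<^esub> v"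
    using assms unfolding strongly_connected_def by simp
  then have "u \<rightarrow>\<^sup>*\<^bsub>with_proj T\<^esub> v"
    using reachable_mk_symmetric_eq[OF sym_arcs] by simp
  then show ?thesis by (simp add: reachable_awalk)
qed

lemma walk_dist_ex:
  assumes "u \<in> pverts T" "v \<in> pverts T" obtains p where "awalk u p v" "length p = walk_dist u v"
proof -
  obtain p where "awalk u p v" using walk_exists[OF assms] ..
  then have "\<exists>q. awalk u q v \<and> length q = length p" by (intro exI[of _ p] conjI HOL.refl)
  then have "\<exists>q. awalk u q v \<and> length q = walk_dist u v"
    unfolding walk_dist_def by (rule LeastI)
  then show ?thesis by (elim exE conjE) (rule that)
qed

lemma walk_dist_le: "awalk u p v \<Longrightarrow> walk_dist u v \<le> length p"
  unfolding walk_dist_def by (rule Least_le) blast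

lemma graph_dist_eq:
  assumes "u \<in> pverts T" "v \<in> pverts T" shows "graph_dist T u v = ereal (walk_dist u v)"
proof -
  have cost: "awalk_cost (\<lambda>_. 1) p = real (length p)" for p :: "('a \<times> 'a) list"
    by (induction p) (simp_all add: awalk_cost_def)
  obtain p where p: "awalk u p v" "length p = walk_dist u v" by (rule walk_dist_ex[OF assms])
  have "(INF p\<in>{p. awalk u p v}. ereal (awalk_cost (\<lambda>_. 1) p)) = ereal (walk_dist u v)"
  proof (rule antisym)
    show "(INF p\<in>{p. awalk u p v}. ereal (awalk_cost (\<lambda>_. 1) p)) \<le> ereal (walk_dist u v)"
      using p by (intro INF_lower2[of p]) (simp_all add: cost)
    show "ereal (walk_dist u v) \<le> (INF p\<in>{p. awalk u p v}. ereal (awalk_cost (\<lambda>_. 1) p))"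
      by (intro INF_greatest) (simp add: cost walk_dist_le)
  qed
  then show ?thesis unfolding graph_dist_def \<mu>_def .
qed

lemma walk_dist_step:
  assumes "u \<in> nbrs v" "a \<in> pverts T" shows "walk_dist u a \<le> Suc (walk_dist v a)"
proof -
  obtain p where p: "awalk v p a" "length p = walk_dist v a" by (rule walk_dist_ex[OF nbrs_in(2)[OF assms(1)] assms(2)])
  have "(u, v) \<in> parcs T" using assms(1) arcs_symmetric unfolding nbrs_def by blast
  then have "awalk u ((u, v) # p) a" using p(1) by (simp add: awalk_Cons_iff)
  then show ?thesis using walk_dist_le[of u "(u, v) # p" a] p(2) by simp
qed

lemma walk_dist_pred:
  assumes "v \<in> pverts T" "a \<in> pverts T" "v \<noteq> a" obtains u where "u \<in> nbrs v" "walk_dist v a = Suc (walk_dist u a)"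
proof -
  obtain p where p: "awalk v p a" "length p = walk_dist v a" by (rule walk_dist_ex[OF assms(1,2)])
  then obtain u q where q: "p = (v, u) # q" "(v, u) \<in> parcs T" "awalk u q a"
    using assms(3) by (cases p) (auto simp: awalk_Nil_iff awalk_Cons_iff)
  then have u: "u \<in> nbrs v" unfolding nbrs_def by simp
  have "walk_dist u a \<le> length q" using q(3) by (rule walk_dist_le)
  moreover have "walk_dist v a \<le> Suc (walk_dist u a)" using walk_dist_step u nbrs_sym assms(2) by blast
  ultimately show ?thesis using that[OF u] p(2) q(1) by simp
qed

lemma walk_dist_pred_unique:
  assumes "a \<in> pverts T" "v \<noteq> a" and u1: "u1 \<in> nbrs v" "walk_dist u1 a \<le> walk_dist v a"
    and u2: "u2 \<in> nbrs v" "walk_dist u2 a \<le> walk_dist v a"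
  shows "u1 = u2"
proof (rule ccontr)
  assume ne: "u1 \<noteq> u2"
  define R where "R = {(x, y). (x, y) \<in> parcs T \<and> x \<noteq> v \<and> y \<noteq> v}"
  have to_a: "(u, a) \<in> R\<^sup>*" if "u \<in> pverts T" "u \<noteq> v" "walk_dist u a \<le> walk_dist v a" for u
    using that
  proof (induction "walk_dist u a" arbitrary: u rule: less_induct)
    case less
    show ?case
    proof (cases "u = a")
      case False
      obtain w where w: "w \<in> nbrs u" "walk_dist u a = Suc (walk_dist w a)"
        by (rule walk_dist_pred[OF less.prems(1) assms(1) False])
      have "w \<noteq> v" using w(2) less.prems(3) by auto
      then have "(w, a) \<in> R\<^sup>*" using less.hyps[of w] w less.prems(3) nbrs_in by auto
      moreover have "(u, w) \<in> R" unfolding R_def using w(1) \<open>w \<noteq> v\<close> less.prems(2) unfolding nbrs_def by simp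
      ultimately show ?thesis by (rule converse_rtrancl_into_rtrancl[rotated])
    qed simp
  qed
  have uV: "u1 \<in> pverts T" "u1 \<noteq> v" "u2 \<in> pverts T" "u2 \<noteq> v" using u1(1) u2(1) nbrs_in by auto
  have "sym R" unfolding R_def sym_def using arcs_symmetric by blast
  then have "(a, u2) \<in> R\<^sup>*" using to_a[OF uV(3,4) u2(2)] by (meson sym_rtrancl symD)
  then have "(u1, u2) \<in> R\<^sup>*" using to_a[OF uV(1,2) u1(2)] by (rule rtrancl_trans[rotated])
  then have "\<exists>p. awalk u1 p u2 \<and> set p \<subseteq> R"
  proof (induction rule: converse_rtrancl_induct)
    case base
    show ?case using uV by (intro exI[of _ "[]"]) (simp add: awalk_Nil_iff)
  next
    case (step x y)
    then obtain p where "awalk y p u2" "set p \<subseteq> R" by blast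
    then show ?case using step(1) unfolding R_def by (intro exI[of _ "(x, y) # p"]) (auto simp: awalk_Cons_iff)
  qed
  then obtain p0 where p0: "awalk u1 p0 u2" "set p0 \<subseteq> R" by blast
  define p where "p = awalk_to_apath p0"
  have ap: "apath u1 p u2" unfolding p_def using p0(1) by (rule apath_awalk_to_apath)
  have pR: "set p \<subseteq> R" unfolding p_def using awalk_to_apath_subset[OF p0(1)] p0(2) by blast
  have aw: "awalk u1 p u2" "distinct (pawalk_verts u1 p)" using ap unfolding apath_def by auto
  have vp: "v \<notin> set (pawalk_verts u1 p)" using set_awalk_verts[OF aw(1)] pR uV unfolding R_def by auto
  define c where "c = (v, u1) # p @ [(u2, v)]"
  have arcs: "(v, u1) \<in> parcs T" "(u2, v) \<in> parcs T"
    using u1(1) u2(1) arcs_symmetric unfolding nbrs_def by auto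
  have "awalk u2 [(u2, v)] v" using arcs in_arcsD2[OF arcs(2)] by (simp add: awalk_simps)
  with aw(1) have aw2: "awalk u1 (p @ [(u2, v)]) v" by (rule awalk_appendI)
  then have "awalk v c v" unfolding c_def using arcs by (simp add: awalk_Cons_iff del: awalk_append_iff)
  moreover have "pawalk_verts u1 (p @ [(u2, v)]) = pawalk_verts u1 p @ [v]"
    using awalk_verts_append[OF aw2] aw(1) by simp
  then have "distinct (tl (pawalk_verts v c))" unfolding c_def using aw(2) vp by simp
  ultimately have "cycle c" unfolding cycle_def c_def by auto
  moreover have "p \<noteq> []" using aw(1) ne by (auto simp: awalk_Nil_iff)
  then have "3 \<le> length c" unfolding c_def by (cases p) auto
  ultimately show False using regular_tree unfolding regular_tree_def by blast
qed

lemma ends_rays: "\<omega> \<in> tree_ends T \<Longrightarrow> r \<in> \<omega> \<Longrightarrow> ray T r"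
  unfolding tree_ends_def quotient_def by auto

lemma busemann_eventually:
  assumes "r \<in> \<omega>" "ray T r" and v: "v \<in> pverts T"
    and lim: "(\<lambda>k. graph_dist T v (r k) - ereal (real k)) \<longlonglongrightarrow> ereal (of_int i)"
  shows "\<forall>\<^sub>F k in sequentially. int (walk_dist v (r k)) = i + int k"
proof -
  have "graph_dist T v (r k) - ereal (real k) = ereal (real (walk_dist v (r k)) - real k)" for k
    using assms(2) v unfolding ray_def by (subst graph_dist_eq) auto
  then have "(\<lambda>k. real (walk_dist v (r k)) - real k) \<longlonglongrightarrow> of_int i" using lim by simp
  then have "\<forall>\<^sub>F k in sequentially. dist (real (walk_dist v (r k)) - real k) (of_int i) < 1"
    by (rule tendstoD) simp
  then show ?thesis
  proof (rule eventually_mono)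
    fix k assume "dist (real (walk_dist v (r k)) - real k) (of_int i) < 1"
    then have "\<bar>real_of_int (int (walk_dist v (r k)) - int k - i)\<bar> < 1" by (simp add: dist_real_def)
    then show "int (walk_dist v (r k)) = i + int k" by linarith
  qed
qed

lemma busemann_nbrs:
  assumes "0 < d" and om: "\<omega> \<in> tree_ends T" and bus: "busemann T \<omega> f" and v: "v \<in> pverts T"
  shows "\<exists>u\<in>nbrs v. f u = f v - 1 \<and> (\<forall>w\<in>nbrs v - {u}. f w = f v + 1)"
proof -
  obtain r where r: "r \<in> \<omega>"
    and lim: "\<And>v. v \<in> pverts T \<Longrightarrow> (\<lambda>k. graph_dist T v (r k) - ereal (real k)) \<longlonglongrightarrow> ereal (of_int (f v))"
    using bus unfolding busemann_def by blast
  have ray: "ray T r" by (rule ends_rays[OF om r])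
  have fin: "finite (insert v (nbrs v))" using card_nbrs[OF v] assms(1) by (simp add: card_ge_0_finite)
  have sub: "u \<in> pverts T" if "u \<in> insert v (nbrs v)" for u using that v nbrs_in by blast
  have "\<forall>\<^sub>F k in sequentially. \<forall>u\<in>insert v (nbrs v). int (walk_dist u (r k)) = f u + int k"
    by (intro eventually_ball_finite fin ballI busemann_eventually[OF r ray] lim sub)
  moreover have "\<forall>\<^sub>F k in sequentially. r k \<noteq> v"
  proof (cases "v \<in> range r")
    case True
    then obtain k0 where "r k0 = v" by blast
    then have "r k \<noteq> v" if "k0 < k" for k using ray that unfolding ray_def inj_def by (metis less_irrefl)
    then show ?thesis by (meson eventually_sequentially less_eq_Suc_le)
  next
    case False
    then have "r k \<noteq> v" for k by auto
    then show ?thesis by simp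
  qed
  ultimately have "\<forall>\<^sub>F k in sequentially. r k \<noteq> v \<and> (\<forall>u\<in>insert v (nbrs v). int (walk_dist u (r k)) = f u + int k)"
    by (intro eventually_conj)
  then obtain k where k: "r k \<noteq> v" "\<And>u. u \<in> insert v (nbrs v) \<Longrightarrow> int (walk_dist u (r k)) = f u + int k"
    by (auto dest!: eventually_happens)
  have a: "r k \<in> pverts T" using ray unfolding ray_def by blast
  obtain u where u: "u \<in> nbrs v" "walk_dist v (r k) = Suc (walk_dist u (r k))"
    by (rule walk_dist_pred[OF v a k(1)[symmetric]])
  have "f u = f v - 1" using u k(2)[of u] k(2)[of v] by simp
  moreover have "f w = f v + 1" if w: "w \<in> nbrs v - {u}" for w
  proof -
    have "\<not> walk_dist w (r k) \<le> walk_dist v (r k)"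
      using walk_dist_pred_unique[OF a k(1)[symmetric] _ _ u(1), of w] w u(2) by auto
    moreover have "walk_dist w (r k) \<le> Suc (walk_dist v (r k))" using walk_dist_step w a by blast
    ultimately show ?thesis using k(2)[of w] k(2)[of v] w by simp
  qed
  ultimately show ?thesis using u(1) by blast
qed

end

lemma busemann_horotree:
  fixes T :: "'a pair_pre_digraph"
  assumes m: "0 < m" and reg: "regular_tree (m + 1) T" and om: "\<omega> \<in> tree_ends T" and bus: "busemann T \<omega> f"
  obtains par where "horotree (pverts T) par f m"
    "\<And>u v. (u, v) \<in> parcs T \<longleftrightarrow> u \<in> pverts T \<and> v \<in> pverts T \<and> (par u = v \<or> par v = u)"
proof -
  interpret pair_bidirected_digraph T using reg unfolding regular_tree_def by blast
  interpret regular_tree_space T "m + 1" by unfold_locales (rule reg)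
  have "\<forall>v\<in>pverts T. \<exists>u. u \<in> nbrs v \<and> f u = f v - 1 \<and> (\<forall>w\<in>nbrs v - {u}. f w = f v + 1)"
    using busemann_nbrs[OF _ om bus] by auto
  then obtain par where par: "\<And>v. v \<in> pverts T \<Longrightarrow> par v \<in> nbrs v"
      "\<And>v. v \<in> pverts T \<Longrightarrow> f (par v) = f v - 1"
      "\<And>v w. v \<in> pverts T \<Longrightarrow> w \<in> nbrs v \<Longrightarrow> w \<noteq> par v \<Longrightarrow> f w = f v + 1"
    by (metis Diff_iff singletonD)
  have nb: "u \<in> nbrs v \<longleftrightarrow> u = par v \<or> par u = v" if "u \<in> pverts T" "v \<in> pverts T" for u v
  proof
    assume uv: "u \<in> nbrs v"
    show "u = par v \<or> par u = v"
    proof (rule ccontr)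
      assume "\<not> (u = par v \<or> par u = v)"
      then have "f u = f v + 1" "f v = f u + 1"
        using par(3)[OF that(2) uv] par(3)[OF that(1), of v] uv nbrs_sym by auto
      then show False by simp
    qed
  next
    assume "u = par v \<or> par u = v"
    then show "u \<in> nbrs v" using par(1)[OF that(1)] par(1)[OF that(2)] nbrs_sym by auto
  qed
  have arc: "(u, v) \<in> parcs T \<longleftrightarrow> u \<in> pverts T \<and> v \<in> pverts T \<and> (par u = v \<or> par v = u)" for u v
    using nb[of v u] nbrs_in[of v u] unfolding nbrs_def by auto
  have "horotree (pverts T) par f m"
  proof
    show "pverts T \<noteq> {}"
      using reg unfolding regular_tree_def connected_def strongly_connected_def by simp
    show "par x \<in> pverts T" "f (par x) = f x - 1" if "x \<in> pverts T" for x
      using par(1,2)[OF that] nbrs_in(1) by auto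
    show "0 < m" by (rule m)
    show "card {y \<in> pverts T. par y = x} = m" if x: "x \<in> pverts T" for x
    proof -
      have "{y \<in> pverts T. par y = x} = nbrs x - {par x}"
      proof (intro set_eqI iffI)
        fix y assume y: "y \<in> {y \<in> pverts T. par y = x}"
        then have "f y = f x + 1" using par(2)[of y] by simp
        then have "y \<noteq> par x" using par(2)[OF x] by auto
        then show "y \<in> nbrs x - {par x}" using nb[OF _ x, of y] y by auto
      next
        fix y assume y: "y \<in> nbrs x - {par x}"
        then show "y \<in> {y \<in> pverts T. par y = x}" using nb[OF _ x, of y] nbrs_in(1)[of y x] by auto
      qed
      then show ?thesis using card_nbrs[OF x] par(1)[OF x] by simp
    qed
    fix x y assume "x \<in> pverts T" "y \<in> pverts T"
    then obtain p where "awalk x p y" using walk_exists by blast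
    then show "\<exists>i j. (par ^^ i) x = (par ^^ j) y"
    proof (induction p arbitrary: x)
      case Nil
      then show ?case by (intro exI[of _ 0]) (simp add: awalk_Nil_iff)
    next
      case (Cons e p)
      obtain z where z: "e = (x, z)" "(x, z) \<in> parcs T" "awalk z p y"
        using Cons.prems by (cases e) (auto simp: awalk_Cons_iff)
      obtain i j where ij: "(par ^^ i) z = (par ^^ j) y" using Cons.IH[OF z(3)] by blast
      consider "par x = z" | "par z = x" using z(2) arc by blast
      then show ?case
      proof cases
        case 1
        then have "(par ^^ Suc i) x = (par ^^ j) y" using ij by (simp only: funpow_Suc_right o_apply)
        then show ?thesis by blast
      next
        case 2
        have "(par ^^ i) x = (par ^^ Suc i) z" using 2 by (simp only: funpow_Suc_right o_apply)
        also have "\<dots> = (par ^^ Suc j) y" using ij by simp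
        finally show ?thesis by blast
      qed
    qed
  qed
  then show ?thesis using that arc by blast
qed

section \<open>The metric of Diestel-Leader graphs\<close>

lemma edge_pt_0: "edge_pt u v 0 = edge_pt u u 0"
  and edge_pt_1: "edge_pt u v 1 = edge_pt v v 0"
  and edge_pt_refl: "edge_pt u u t = edge_pt u u 0"
  and edge_pt_flip: "edge_pt v u (1 - t) = edge_pt u v t"
  unfolding edge_pt_def by (auto simp: fun_eq_iff)

lemma affine_ext_eq:
  assumes "finite A" "\<And>v. v \<notin> A \<Longrightarrow> x v = 0" shows "affine_ext f x = (\<Sum>v\<in>A. x v * of_int (f v))"
  unfolding affine_ext_def by (rule sum.mono_neutral_left) (use assms in auto)

lemma affine_ext_edge: "affine_ext f (edge_pt u v t) = (1 - t) * of_int (f u) + t * of_int (f v)"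
proof (cases "u = v")
  case True
  then show ?thesis by (subst affine_ext_eq[of "{u}"]) (auto simp: edge_pt_def algebra_simps)
next
  case False
  then show ?thesis by (subst affine_ext_eq[of "{u, v}"]) (auto simp: edge_pt_def)
qed

locale horotree_graph = horotree "pverts T" par ht m for T :: "'a pair_pre_digraph" and par ht m +
  assumes arc_iff: "\<And>u v. (u, v) \<in> parcs T \<longleftrightarrow> u \<in> pverts T \<and> v \<in> pverts T \<and> (par u = v \<or> par v = u)"
begin

lemma affine_ext_par: "x \<in> pverts T \<Longrightarrow> affine_ext ht (edge_pt x (par x) t) = of_int (ht x) - t"
  by (simp add: affine_ext_edge ht_par algebra_simps)

lemma realisation_cases:
  assumes "x \<in> realisation T"
  obtains a t where "a \<in> pverts T" "0 \<le> t" "t < 1" "x = edge_pt a (par a) t"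
proof -
  obtain u v t where x: "x = edge_pt u v t" "u \<in> pverts T" "v \<in> pverts T" "u = v \<or> (u, v) \<in> parcs T" "0 \<le> t" "t \<le> 1"
    using assms unfolding realisation_def by blast
  note witness = that
  have *: thesis if "x = edge_pt a (par a) t" "a \<in> pverts T" "0 \<le> t" "t \<le> 1" for a t
  proof (cases "t = 1")
    case True
    then have "x = edge_pt (par a) (par (par a)) 0" using that(1) edge_pt_0 edge_pt_1 by metis
    then show ?thesis using that(2) by (intro witness[of "par a" 0]) (auto simp: par_in)
  next
    case False
    then show ?thesis using that by (intro witness[of a t]) auto
  qed
  consider "u = v" | "par u = v" | "par v = u" using x(4) arc_iff by blast
  then show thesis
  proof cases
    case 1
    then have "x = edge_pt u (par u) 0" using x(1) edge_pt_refl edge_pt_0 by metis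
    then show thesis using * x(2) by (metis order.refl zero_le_one)
  next
    case 2
    then show thesis using * x by blast
  next
    case 3
    then have "x = edge_pt v (par v) (1 - t)" using x(1) edge_pt_flip by metis
    then show thesis using *[of v "1 - t"] x by simp
  qed
qed

lemma realisation_par:
  assumes "a \<in> pverts T" "0 \<le> t" "t \<le> 1"
  shows "edge_pt a (par a) t \<in> realisation T" "edge_pt (par a) a t \<in> realisation T"
  unfolding realisation_def using assms par_in[OF assms(1)] arc_iff by blast+

lemma child_exists:
  assumes "x \<in> pverts T" obtains y where "y \<in> pverts T" "par y = x"
  using card_children[OF assms] m_pos by (metis (mono_tags, lifting) Collect_empty_eq card.empty less_irrefl)

lemma line_unique:
  assumes "m = 1" "x \<in> pverts T" "y \<in> pverts T" "ht x = ht y" shows "x = y"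
proof -
  have inj: "a = b" if ab: "a \<in> pverts T" "b \<in> pverts T" "par a = par b" for a b
  proof -
    have "card {y \<in> pverts T. par y = par a} = 1" using card_children[OF par_in[OF ab(1)]] assms(1) by simp
    then obtain e where e: "{y \<in> pverts T. par y = par a} = {e}" by (rule card_1_singletonE)
    have "a \<in> {y \<in> pverts T. par y = par a}" "b \<in> {y \<in> pverts T. par y = par a}" using ab by auto
    then show ?thesis unfolding e by simp
  qed
  obtain i j where ij: "(par ^^ i) x = (par ^^ j) y" using common[OF assms(2,3)] by blast
  then have "i = j" using ht_iter[OF assms(2), of i] ht_iter[OF assms(3), of j] assms(4) by simp
  then have "(par ^^ i) x = (par ^^ i) y" using ij by simp
  then show ?thesis
  proof (induction i)
    case (Suc i)
    then show ?case using inj[of "(par ^^ i) x" "(par ^^ i) y"] iter_in assms(2,3) by simp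
  qed simp
qed

lemma line_point_unique:
  assumes "m = 1" "x \<in> realisation T" "y \<in> realisation T" "affine_ext ht x = affine_ext ht y" shows "x = y"
proof -
  obtain a s where a: "a \<in> pverts T" "0 \<le> s" "s < 1" "x = edge_pt a (par a) s"
    by (rule realisation_cases[OF assms(2)])
  obtain b t where b: "b \<in> pverts T" "0 \<le> t" "t < 1" "y = edge_pt b (par b) t"
    by (rule realisation_cases[OF assms(3)])
  have "of_int (ht a) - s = of_int (ht b) - t"
    using assms(4) affine_ext_par[OF a(1)] affine_ext_par[OF b(1)] unfolding a(4) b(4) by simp
  then have eq: "real_of_int (ht a - ht b) = s - t" by simp
  then have "- 1 < real_of_int (ht a - ht b)" "real_of_int (ht a - ht b) < 1" using a(2,3) b(2,3) by linarith+
  then have "ht a = ht b" by linarith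
  with eq have "s = t" by simp
  then show ?thesis using line_unique[OF assms(1) a(1) b(1)] a(4) b(4) \<open>ht a = ht b\<close> by simp
qed

end

locale DL = dl_pair "pverts S" p f m "pverts T" q g n + Sg: horotree_graph S p f m + Tg: horotree_graph T q g n
  for S :: "'a pair_pre_digraph" and T :: "'b pair_pre_digraph" and p f m q g n
begin

abbreviation X :: "(('a \<Rightarrow> real) \<times> ('b \<Rightarrow> real)) set" where "X \<equiv> DL_space S T f g"
abbreviation d :: "('a \<Rightarrow> real) \<times> ('b \<Rightarrow> real) \<Rightarrow> ('a \<Rightarrow> real) \<times> ('b \<Rightarrow> real) \<Rightarrow> real" where "d \<equiv> DL_dist S T f g"
abbreviation path where "path \<equiv> DL_path S T f g"
abbreviation H :: "('a \<Rightarrow> real) \<times> ('b \<Rightarrow> real) \<Rightarrow> real" where "H \<equiv> DL_height f"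

definition pt :: "'a \<times> 'b \<Rightarrow> 'a \<times> 'b \<Rightarrow> real \<Rightarrow> ('a \<Rightarrow> real) \<times> ('b \<Rightarrow> real)" where
  "pt z w t = (edge_pt (fst z) (fst w) t, edge_pt (snd z) (snd w) t)"
abbreviation vert :: "'a \<times> 'b \<Rightarrow> ('a \<Rightarrow> real) \<times> ('b \<Rightarrow> real)" where "vert z \<equiv> pt z z 0"

definition above :: "'a \<times> 'b \<Rightarrow> 'a \<times> 'b \<Rightarrow> bool" where
  "above z w \<longleftrightarrow> z \<in> verts \<and> w \<in> verts \<and> p (fst w) = fst z \<and> q (snd z) = snd w"

lemma vertsD: "z \<in> verts \<Longrightarrow> fst z \<in> pverts S" "z \<in> verts \<Longrightarrow> snd z \<in> pverts T" "z \<in> verts \<Longrightarrow> f (fst z) + g (snd z) = 0"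
  unfolding verts_def by auto

lemma aboveD: "above z w \<Longrightarrow> z \<in> verts" "above z w \<Longrightarrow> w \<in> verts" "above z w \<Longrightarrow> f (fst w) = f (fst z) + 1"
    "above z w \<Longrightarrow> g (snd z) = g (snd w) + 1"
  unfolding above_def using S.ht_par[of "fst w"] T.ht_par[of "snd z"] vertsD by auto

lemma DL_arc_iff: "(z, w) \<in> parcs (DL_graph S T f g) \<longleftrightarrow> above z w \<or> above w z"
proof
  assume "(z, w) \<in> parcs (DL_graph S T f g)"
  then have *: "z \<in> verts" "w \<in> verts" "(fst z, fst w) \<in> parcs S" "(snd z, snd w) \<in> parcs T"
    unfolding DL_graph_def Let_def verts_def by auto
  note fg = vertsD[OF *(1)] vertsD[OF *(2)]
  consider "p (fst z) = fst w" | "p (fst w) = fst z" using *(3) Sg.arc_iff by blast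
  then show "above z w \<or> above w z"
  proof cases
    case 1
    then have "f (fst w) = f (fst z) - 1" using S.ht_par[OF fg(1)] by simp
    then have "q (snd z) \<noteq> snd w" using T.ht_par[OF fg(2)] fg(3,6) by auto
    then show ?thesis using 1 * Tg.arc_iff unfolding above_def by blast
  next
    case 2
    then have "f (fst z) = f (fst w) - 1" using S.ht_par[OF fg(4)] by simp
    then have "q (snd w) \<noteq> snd z" using T.ht_par[OF fg(5)] fg(3,6) by auto
    then show ?thesis using 2 * Tg.arc_iff unfolding above_def by blast
  qed
next
  assume "above z w \<or> above w z"
  then show "(z, w) \<in> parcs (DL_graph S T f g)"
    unfolding DL_graph_def Let_def above_def verts_def Sg.arc_iff Tg.arc_iff
    by (auto simp: Sg.arc_iff Tg.arc_iff)
qed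

lemma pt_flip: "pt w z (1 - t) = pt z w t"
  unfolding pt_def by (simp add: edge_pt_flip)

lemma pt_0: "pt z w 0 = vert z" and pt_1: "pt z w 1 = vert w"
  unfolding pt_def by (auto intro: edge_pt_0 edge_pt_1)

lemma H_pt: "H (pt z w t) = (1 - t) * of_int (f (fst z)) + t * of_int (f (fst w))"
  unfolding DL_height_def pt_def by (simp add: affine_ext_edge)

lemma H_vert: "H (vert z) = height z"
  unfolding H_pt height_def by simp

lemma pt_in:
  assumes "above z w" "0 \<le> t" "t \<le> 1" shows "pt z w t \<in> X"
proof -
  note a = aboveD[OF assms(1)]
  have e: "p (fst w) = fst z" "q (snd z) = snd w" using assms(1) unfolding above_def by auto
  have "edge_pt (fst z) (fst w) t \<in> realisation S" "edge_pt (snd z) (snd w) t \<in> realisation T"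
    using Sg.realisation_par(2)[OF vertsD(1)[OF a(2)] assms(2,3)] Tg.realisation_par(1)[OF vertsD(2)[OF a(1)] assms(2,3)] e
    by auto
  moreover have "affine_ext f (edge_pt (fst z) (fst w) t) + affine_ext g (edge_pt (snd z) (snd w) t) =
      of_int (f (fst z) + g (snd z))"
    unfolding affine_ext_edge a(3,4) by (simp add: algebra_simps)
  ultimately show ?thesis unfolding DL_space_def pt_def using vertsD(3)[OF a(1)] by simp
qed

lemma above_exists:
  assumes "z \<in> verts" obtains w where "above z w"
proof -
  obtain y where y: "y \<in> pverts S" "p y = fst z" by (rule Sg.child_exists[OF vertsD(1)[OF assms]])
  have "(y, q (snd z)) \<in> verts"
    using y S.ht_par[OF y(1)] T.ht_par[OF vertsD(2)[OF assms]] vertsD[OF assms] T.par_in unfolding verts_def by simp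
  then have "above z (y, q (snd z))" unfolding above_def using assms y by simp
  then show ?thesis by (rule that)
qed

lemma vert_in: "z \<in> verts \<Longrightarrow> vert z \<in> X"
  by (metis above_exists pt_0 pt_in order.refl zero_le_one)

lemma point_cases:
  assumes "P \<in> X" obtains z w t where "above z w" "0 \<le> t" "t \<le> 1" "P = pt z w t"
proof -
  obtain x y where P: "P = (x, y)" "x \<in> realisation S" "y \<in> realisation T" "affine_ext f x + affine_ext g y = 0"
    using assms unfolding DL_space_def by auto
  obtain a s where a: "a \<in> pverts S" "0 \<le> s" "s < 1" "x = edge_pt a (p a) s" by (rule Sg.realisation_cases[OF P(2)])
  obtain b t where b: "b \<in> pverts T" "0 \<le> t" "t < 1" "y = edge_pt b (q b) t" by (rule Tg.realisation_cases[OF P(3)])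
  have st: "real_of_int (f a + g b) = s + t"
    using P(4) Sg.affine_ext_par[OF a(1)] Tg.affine_ext_par[OF b(1)] unfolding a(4) b(4) by simp
  then have "real_of_int (f a + g b) \<ge> 0" "real_of_int (f a + g b) < 2" using a b by linarith+
  then have "f a + g b = 0 \<or> f a + g b = 1" by linarith
  then show ?thesis
  proof
    assume 0: "f a + g b = 0"
    then have v: "(a, b) \<in> verts" using a b unfolding verts_def by simp
    have "s = 0" "t = 0" using st a b 0 by linarith+
    then have "P = vert (a, b)"
      unfolding P(1) a(4) b(4) pt_def using edge_pt_0[of a "p a"] edge_pt_0[of b "q b"] by simp
    moreover obtain w where "above (a, b) w" by (rule above_exists[OF v])
    ultimately show ?thesis using that[of "(a, b)" w 0] pt_0[of "(a, b)" w] by simp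
  next
    assume 1: "f a + g b = 1"
    have v: "(a, q b) \<in> verts" "(p a, b) \<in> verts"
      using 1 S.ht_par[OF a(1)] T.ht_par[OF b(1)] S.par_in[OF a(1)] T.par_in[OF b(1)] a(1) b(1) unfolding verts_def by auto
    then have "above (p a, b) (a, q b)" unfolding above_def by simp
    moreover have "t = 1 - s" using st 1 by linarith
    then have "P = pt (p a, b) (a, q b) t" unfolding P(1) a(4) b(4) pt_def using edge_pt_flip[of "p a" a s] by simp
    ultimately show ?thesis using that b by simp
  qed
qed

lemma path_in: "path P Q l \<Longrightarrow> P \<in> X \<and> Q \<in> X \<and> 0 \<le> l"
proof (induction rule: DL_path.induct)
  case (step P v1 w1 s v2 w2 l t)
  have "pt (v1, v2) (w1, w2) t \<in> X"
  proof (cases "above (v1, v2) (w1, w2)")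
    case True
    then show ?thesis using pt_in step by simp
  next
    case False
    then have "above (w1, w2) (v1, v2)" using step(2) DL_arc_iff by blast
    then have "pt (w1, w2) (v1, v2) (1 - t) \<in> X" using pt_in step by simp
    then show ?thesis unfolding pt_flip .
  qed
  then show ?case using step unfolding pt_def by simp
qed simp

lemma path_edge:
  assumes "above z w" "s \<in> {0..1}" "t \<in> {0..1}" shows "path (pt z w s) (pt z w t) \<bar>s - t\<bar>"
proof -
  have "path (pt z w s) (pt z w s) 0" using pt_in assms by (intro DL_path.refl) auto
  then have "path (pt z w s) (pt z w t) (0 + \<bar>s - t\<bar>)"
    using assms DL_arc_iff[of z w] unfolding pt_def by (intro DL_path.step) auto
  then show ?thesis by simp
qed

lemma path_trans: "path Q R k \<Longrightarrow> path P Q l \<Longrightarrow> path P R (l + k)"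
proof (induction rule: DL_path.induct)
  case (step Q v1 w1 s v2 w2 k t)
  then show ?case using DL_path.step[OF step.IH[OF step.prems] step.hyps(2-4)] by (simp add: add.assoc)
qed simp

lemma path_sym: "path P Q l \<Longrightarrow> path Q P l"
proof (induction rule: DL_path.induct)
  case (refl P)
  then show ?case by (rule DL_path.refl)
next
  case (step P v1 w1 s v2 w2 l t)
  have "(edge_pt v1 w1 t, edge_pt v2 w2 t) \<in> X" using path_in[OF DL_path.step[OF step.hyps]] by blast
  from DL_path.step[OF DL_path.refl[OF this] step.hyps(2,4,3)]
  have "path (edge_pt v1 w1 t, edge_pt v2 w2 t) (edge_pt v1 w1 s, edge_pt v2 w2 s) \<bar>t - s\<bar>" by simp
  from path_trans[OF step.IH this] show ?case by (simp add: abs_minus_commute add.commute)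
qed

lemma d_le: "path P Q l \<Longrightarrow> d P Q \<le> l"
  unfolding DL_dist_def using path_in[of P Q] by (intro cInf_lower) (auto intro!: bdd_belowI[of _ 0])

lemma d_ge:
  assumes "path P Q l" "\<And>k. path P Q k \<Longrightarrow> c \<le> k" shows "c \<le> d P Q"
  unfolding DL_dist_def using assms by (intro cInf_greatest) auto

lemma d_refl: "P \<in> X \<Longrightarrow> d P P = 0"
  by (rule order.antisym[OF d_le[OF DL_path.refl] d_ge[OF DL_path.refl]]) (use path_in[of P P] in auto)

lemma d_edge: "above z w \<Longrightarrow> s \<in> {0..1} \<Longrightarrow> t \<in> {0..1} \<Longrightarrow> d (pt z w s) (pt z w t) \<le> \<bar>s - t\<bar>"
  by (intro d_le path_edge)

lemma path_near_vert:
  assumes "P \<in> X" obtains z l where "z \<in> verts" "path P (vert z) l" "l \<le> 1"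
proof -
  obtain z w t where *: "above z w" "0 \<le> t" "t \<le> 1" "P = pt z w t" by (rule point_cases[OF assms])
  have "path P (vert z) \<bar>t - 0\<bar>" using path_edge[OF *(1), of t 0] *(2-4) unfolding pt_0[of z w] by simp
  then show ?thesis using that[of z "\<bar>t - 0\<bar>"] * aboveD(1) by simp
qed

lemma height_path: "path P Q l \<Longrightarrow> \<bar>H P - H Q\<bar> \<le> l"
proof (induction rule: DL_path.induct)
  case (step P v1 w1 s v2 w2 l t)
  have "f w1 = f v1 + 1 \<or> f v1 = f w1 + 1" using step.hyps(2) DL_arc_iff aboveD(3) by fastforce
  moreover have "H (pt (v1, v2) (w1, w2) s) - H (pt (v1, v2) (w1, w2) t) = (t - s) * (of_int (f v1) - of_int (f w1))"
    unfolding H_pt by (simp add: algebra_simps)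
  ultimately have "\<bar>H (pt (v1, v2) (w1, w2) s) - H (pt (v1, v2) (w1, w2) t)\<bar> = \<bar>s - t\<bar>" by (auto simp: abs_minus_commute)
  then show ?case using step.IH unfolding pt_def by simp
qed simp

end

locale DL_box = DL S T p f m q g n
  for S :: "'a pair_pre_digraph" and T :: "'b pair_pre_digraph" and p f m q g n +
  assumes m2: "2 \<le> m" and n2: "2 \<le> n"
begin

sublocale B: box_space verts height low high m n "max m n"
  by (rule box_space) (simp_all add: m2 n2)

lemma up_above: "z \<in> verts \<Longrightarrow> w \<in> B.U 1 z \<longleftrightarrow> above z w"
proof -
  assume z: "z \<in> verts"
  obtain x y where xy: "z = (x, y)" by (cases z)
  have "B.U 1 z = {x' \<in> pverts S. p x' = x} \<times> {q y}"
    using up_eq[of x y 1] z unfolding xy S.desc_def T.anc_def by simp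
  moreover have "w \<in> verts" if "fst w \<in> pverts S" "p (fst w) = x" "snd w = q y"
    using that z S.ht_par[of "fst w"] T.ht_par[of y] T.par_in[of y] vertsD[of z] unfolding xy verts_def by (cases w) auto
  ultimately show ?thesis using z vertsD[of w] unfolding above_def xy by (cases w) auto
qed

lemma rho_above: "above z w \<Longrightarrow> B.rho z w = 1"
  using up_above[of z w] aboveD(1)[of z w] B.up_iff[of z w 1] unfolding box_dist_def by auto

lemma rho_refl: "z \<in> verts \<Longrightarrow> B.rho z z = 0"
  unfolding box_dist_def using B.b_refl B.c_refl by simp

lemma above_neq:
  assumes "above v w" shows "fst v \<noteq> fst w" "snd v \<noteq> snd w" "fst w \<noteq> fst v" "snd w \<noteq> snd v"
proof -
  have "f (fst v) \<noteq> f (fst w)" "g (snd v) \<noteq> g (snd w)"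
    using aboveD(3,4)[OF assms] by linarith+
  then show "fst v \<noteq> fst w" "snd v \<noteq> snd w" "fst w \<noteq> fst v" "snd w \<noteq> snd v" by metis+
qed

lemma edge_support:
  assumes vw: "above v w" and a: "a \<in> verts" "edge_pt (fst v) (fst w) t (fst a) \<noteq> 0" "edge_pt (snd v) (snd w) t (snd a) \<noteq> 0"
  shows "a = v \<or> a = w"
proof -
  have "fst a = fst v \<or> fst a = fst w" "snd a = snd v \<or> snd a = snd w"
    using a(2,3) unfolding edge_pt_def by (auto split: if_splits)
  then show ?thesis using vertsD(3)[OF a(1)] vertsD(3)[OF aboveD(1)[OF vw]] vertsD(3)[OF aboveD(2)[OF vw]]
    aboveD(3)[OF vw] by (auto simp: prod_eq_iff)
qed

lemma edge_value: "u \<noteq> v \<Longrightarrow> edge_pt u v t u = 1 - t" "u \<noteq> v \<Longrightarrow> edge_pt u v t v = t" "edge_pt u u t u = 1"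
  unfolding edge_pt_def by auto

lemma path_rho:
  assumes "path P Q l" and z: "P = vert z" "z \<in> verts"
    and a: "a \<in> verts" "fst Q (fst a) \<noteq> 0" "snd Q (snd a) \<noteq> 0"
  shows "B.rho z a \<le> l + 1 - fst Q (fst a)"
  using assms(1) z(1) a
proof (induction arbitrary: a rule: DL_path.induct)
  case (refl P)
  have "fst a = fst z" "snd a = snd z"
    using refl.prems(3,4) unfolding refl.prems(1) pt_def edge_pt_def by (simp_all split: if_splits)
  then have "a = z" by (rule prod_eqI)
  then show ?case using rho_refl[OF z(2)] unfolding refl.prems(1) pt_def by (simp add: edge_value)
next
  case (step P v1 w1 s v2 w2 l t)
  have main: "B.rho z a \<le> l + \<bar>s - t\<bar> + 1 - edge_pt (fst v) (fst w) t (fst a)"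
    if vw: "above v w \<or> above w v" and st: "s \<in> {0..1}" "t \<in> {0..1}"
      and IH: "\<And>a. a \<in> verts \<Longrightarrow> edge_pt (fst v) (fst w) s (fst a) \<noteq> 0 \<Longrightarrow> edge_pt (snd v) (snd w) s (snd a) \<noteq> 0 \<Longrightarrow>
        B.rho z a \<le> l + 1 - edge_pt (fst v) (fst w) s (fst a)"
      and a: "a = v" for v w s t
  proof -
    have ne: "fst v \<noteq> fst w" "snd v \<noteq> snd w" using vw above_neq by blast+
    have verts: "v \<in> verts" "w \<in> verts" using vw aboveD(1,2) by blast+
    show ?thesis
    proof (cases "s = 1")
      case False
      then have "B.rho z v \<le> l + s" using IH[OF verts(1)] ne by (simp add: edge_value)
      then show ?thesis unfolding a using ne by (simp add: edge_value)
    next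
      case True
      then have "B.rho z w \<le> l" using IH[OF verts(2)] ne by (simp add: edge_value)
      moreover have "B.rho w v = 1" using vw rho_above B.rho_sym verts by metis
      moreover have "B.rho z v \<le> B.rho z w + B.rho w v" by (rule B.rho_tri[OF z(2) verts(2,1)])
      ultimately show ?thesis unfolding a using ne True st by (simp add: edge_value)
    qed
  qed
  define v where "v = (v1, v2)"
  define w where "w = (w1, w2)"
  have vw: "above v w \<or> above w v" using step.hyps(2) DL_arc_iff unfolding v_def w_def by blast
  have IH: "B.rho z a \<le> l + 1 - edge_pt (fst v) (fst w) s (fst a)"
    if "a \<in> verts" "edge_pt (fst v) (fst w) s (fst a) \<noteq> 0" "edge_pt (snd v) (snd w) s (snd a) \<noteq> 0" for a
    using step.IH[of a] step.prems(1) that unfolding v_def w_def by simp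
  have IH': "B.rho z a \<le> l + 1 - edge_pt (fst w) (fst v) (1 - s) (fst a)"
    if "a \<in> verts" "edge_pt (fst w) (fst v) (1 - s) (fst a) \<noteq> 0" "edge_pt (snd w) (snd v) (1 - s) (snd a) \<noteq> 0" for a
    using IH[of a] that unfolding edge_pt_flip by simp
  have flip: "1 - s \<in> {0..1}" "1 - t \<in> {0..1}" using step.hyps by auto
  have sup: "edge_pt (fst v) (fst w) t (fst a) \<noteq> 0" "edge_pt (snd v) (snd w) t (snd a) \<noteq> 0"
    using step.prems(3,4) unfolding v_def w_def by simp_all
  have "a = v \<or> a = w"
    using vw edge_support[of v w a t] edge_support[of w v a "1 - t"] sup step.prems(2) unfolding edge_pt_flip by blast
  then have "B.rho z a \<le> l + \<bar>s - t\<bar> + 1 - edge_pt (fst v) (fst w) t (fst a)"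
  proof
    assume "a = v"
    then show ?thesis using main[OF vw step.hyps(3,4)] IH by blast
  next
    assume "a = w"
    have "above w v \<or> above v w" using vw by blast
    then have "B.rho z a \<le> l + \<bar>(1 - s) - (1 - t)\<bar> + 1 - edge_pt (fst w) (fst v) (1 - t) (fst a)"
      using main[OF _ flip] IH' \<open>a = w\<close> by blast
    then show ?thesis unfolding edge_pt_flip by (simp add: abs_minus_commute)
  qed
  then show ?case unfolding v_def w_def by simp
qed

lemma path_vert_rho: "path (vert z) (vert w) l \<Longrightarrow> z \<in> verts \<Longrightarrow> w \<in> verts \<Longrightarrow> B.rho z w \<le> l"
  using path_rho[OF _ HOL.refl, of z "vert w" l w] unfolding pt_def by (simp add: edge_value)

lemma path_above: "above z w \<Longrightarrow> path (vert z) (vert w) 1"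
  using path_edge[of z w 0 1] unfolding pt_0[of z w] pt_1[of z w] by simp

lemma path_up: "z \<in> verts \<Longrightarrow> v \<in> B.U r z \<Longrightarrow> path (vert z) (vert v) (real r)"
proof (induction r arbitrary: v)
  case 0
  then have "v = z" using B.up_0 by auto
  then show ?case using DL_path.refl[OF vert_in] 0 by simp
next
  case (Suc r)
  obtain w where w: "w \<in> B.U r z" "v \<in> B.U 1 w" using B.up_split[OF Suc.prems(1), of v r 1] Suc.prems(2) by auto
  have "w \<in> verts" using w(1) B.up_sub by blast
  then have "path (vert w) (vert v) 1" using w(2) up_above path_above by blast
  then have "path (vert z) (vert v) (real r + 1)" using Suc.IH[OF Suc.prems(1) w(1)] by (rule path_trans)
  then show ?case by (simp add: add.commute)
qed

lemma path_verts:
  assumes z: "z \<in> verts" and w: "w \<in> verts" obtains l where "path (vert z) (vert w) l" "l \<le> 4 * B.rho z w + 6"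
proof -
  obtain r s t u v x where c: "u \<in> B.D r z" "v \<in> B.D s w" "x \<in> B.U t u" "x \<in> B.U t v"
    "real r \<le> B.rho z w + 1" "real s \<le> B.rho z w + 1" "real t \<le> B.rho z w + 2" by (rule B.connect[OF z w])
  have X: "u \<in> verts" "v \<in> verts" using c B.up_sub by blast+
  have "z \<in> B.U r u" "w \<in> B.U s v" using c B.up_down X z w by blast+
  then have "path (vert z) (vert u) (real r)" "path (vert v) (vert w) (real s)"
    using path_up X path_sym by blast+
  moreover have "path (vert u) (vert x) (real t)" "path (vert x) (vert v) (real t)"
    using path_up c X path_sym by blast+
  ultimately have "path (vert z) (vert w) (real r + real t + real t + real s)"
    using path_trans by blast
  then show ?thesis using that c(5-7) by (simp add: algebra_simps)
qed

lemma path_exists: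
  assumes "P \<in> X" "Q \<in> X" obtains l where "path P Q l"
proof -
  obtain z k where z: "z \<in> verts" "path P (vert z) k" by (rule path_near_vert[OF assms(1)])
  obtain w l where w: "w \<in> verts" "path Q (vert w) l" by (rule path_near_vert[OF assms(2)])
  obtain j where j: "path (vert z) (vert w) j" by (rule path_verts[OF z(1) w(1)])
  show ?thesis by (rule that[OF path_trans[OF path_sym[OF w(2)] path_trans[OF j z(2)]]])
qed

lemma d_bound:
  assumes "P \<in> X" "Q \<in> X" "\<And>l. path P Q l \<Longrightarrow> c \<le> l" shows "c \<le> d P Q"
proof -
  obtain l where "path P Q l" by (rule path_exists[OF assms(1,2)])
  then show ?thesis using assms(3) by (rule d_ge)
qed

lemma height_d: "P \<in> X \<Longrightarrow> Q \<in> X \<Longrightarrow> \<bar>H P - H Q\<bar> \<le> d P Q"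
  by (rule d_bound) (auto intro: height_path)

lemma d_sym: "P \<in> X \<Longrightarrow> Q \<in> X \<Longrightarrow> d P Q = d Q P"
  by (rule order.antisym; rule d_bound; (rule d_le)?; (rule path_sym)?)

lemma d_tri:
  assumes "P \<in> X" "Q \<in> X" "R \<in> X" shows "d P R \<le> d P Q + d Q R"
proof -
  have "d P R - l \<le> d Q R" if "path P Q l" for l
    by (rule d_bound[OF assms(2,3)]) (use d_le[OF path_trans[OF _ that]] in \<open>simp add: algebra_simps\<close>)
  then have "d P R - d Q R \<le> d P Q" by (intro d_bound[OF assms(1,2)]) (simp add: algebra_simps)
  then show ?thesis by simp
qed

lemma rho_le_d: "z \<in> verts \<Longrightarrow> w \<in> verts \<Longrightarrow> B.rho z w \<le> d (vert z) (vert w)"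
  by (rule d_bound) (auto intro: vert_in path_vert_rho)

lemma d_le_rho: "z \<in> verts \<Longrightarrow> w \<in> verts \<Longrightarrow> d (vert z) (vert w) \<le> 4 * B.rho z w + 6"
  by (meson path_verts d_le order_trans)

lemma near_vert:
  assumes "P \<in> X" obtains z where "z \<in> verts" "d P (vert z) \<le> 1"
  using path_near_vert[OF assms] d_le by (metis order_trans)

lemma vertical_vert:
  assumes z: "z \<in> verts" obtains w where "w \<in> verts" "height w = of_int k" "d (vert z) (vert w) \<le> \<bar>height z - of_int k\<bar>"
proof -
  define r where "r = nat \<bar>f (fst z) - k\<bar>"
  have "\<exists>w\<in>verts. height w = of_int k \<and> path (vert z) (vert w) (real r)"
  proof (cases "f (fst z) \<le> k")
    case True
    obtain w where w: "w \<in> B.U r z" using B.up_ne[OF z] by blast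
    then have "w \<in> verts" "height w = of_int k"
      using True B.up_iff[OF z, of w r] unfolding r_def height_def by auto
    then show ?thesis using path_up[OF z w] by blast
  next
    case False
    obtain w where w: "w \<in> B.D r z" using B.down_ne[OF z] by blast
    then have h: "w \<in> verts" "height w = of_int k"
      using False B.down_iff[OF z, of w r] unfolding r_def height_def by auto
    then have "z \<in> B.U r w" using B.up_down z w by blast
    then show ?thesis using path_sym[OF path_up[OF h(1)]] h by blast
  qed
  then show ?thesis using that d_le unfolding r_def height_def by fastforce
qed

lemma vertical:
  assumes P: "P \<in> X" obtains Q where "Q \<in> X" "H Q = t" "d P Q \<le> \<bar>H P - t\<bar> + 4"
proof -
  define k where "k = \<lfloor>t\<rfloor>"
  have k: "real_of_int k \<le> t" "t < real_of_int k + 1" unfolding k_def by linarith+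
  obtain z where z: "z \<in> verts" "d P (vert z) \<le> 1" by (rule near_vert[OF P])
  obtain w where w: "w \<in> verts" "height w = of_int k" "d (vert z) (vert w) \<le> \<bar>height z - of_int k\<bar>"
    by (rule vertical_vert[OF z(1)])
  obtain u where u: "above w u" by (rule above_exists[OF w(1)])
  define Q where "Q = pt w u (t - k)"
  have Q: "Q \<in> X" unfolding Q_def using pt_in[OF u] k by simp
  have "H Q = t" unfolding Q_def H_pt using aboveD(3)[OF u] w(2) unfolding height_def by (simp add: algebra_simps)
  moreover have "d (vert w) Q \<le> 1" unfolding Q_def pt_0[of w u, symmetric]
    using d_edge[OF u, of 0 "t - k"] k by simp
  moreover have "\<bar>H P - height z\<bar> \<le> 1" using height_d[OF P vert_in[OF z(1)]] z(2) H_vert by simp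
  moreover have "d P Q \<le> d P (vert z) + d (vert z) Q" "d (vert z) Q \<le> d (vert z) (vert w) + d (vert w) Q"
    using d_tri P Q vert_in z(1) w(1) by blast+
  ultimately show ?thesis using that[OF Q] z w k by argo
qed

end

section \<open>Height respecting quasi-isometries\<close>

lemma hausdorff_dist_le:
  assumes "\<And>a. a \<in> A \<Longrightarrow> \<exists>b\<in>B. d a b \<le> r" "\<And>b. b \<in> B \<Longrightarrow> \<exists>a\<in>A. d b a \<le> r"
  shows "hausdorff_dist d A B \<le> ennreal r"
proof -
  have "(SUP a\<in>A. INF b\<in>B. ennreal (d a b)) \<le> ennreal r"
  proof (rule SUP_least)
    fix a assume "a \<in> A"
    then obtain b where "b \<in> B" "d a b \<le> r" using assms(1) by blast
    then show "(INF b\<in>B. ennreal (d a b)) \<le> ennreal r" by (intro INF_lower2[of b]) (auto intro: ennreal_leI)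
  qed
  moreover have "(SUP b\<in>B. INF a\<in>A. ennreal (d b a)) \<le> ennreal r"
  proof (rule SUP_least)
    fix b assume "b \<in> B"
    then obtain a where "a \<in> A" "d b a \<le> r" using assms(2) by blast
    then show "(INF a\<in>A. ennreal (d b a)) \<le> ennreal r" by (intro INF_lower2[of a]) (auto intro: ennreal_leI)
  qed
  ultimately show ?thesis unfolding hausdorff_dist_def by simp
qed

lemma quasi_isometryD:
  assumes "quasi_isometry K C X d Y d' \<phi>"
  shows "1 \<le> K" "0 \<le> C" "z \<in> X \<Longrightarrow> \<phi> z \<in> Y"
    "z \<in> X \<Longrightarrow> w \<in> X \<Longrightarrow> d' (\<phi> z) (\<phi> w) \<le> K * d z w + C"
    "z \<in> X \<Longrightarrow> w \<in> X \<Longrightarrow> d z w \<le> K * d' (\<phi> z) (\<phi> w) + K * C"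
    "y \<in> Y \<Longrightarrow> \<exists>z\<in>X. d' y (\<phi> z) \<le> C"
proof -
  show K: "1 \<le> K" and "0 \<le> C" "z \<in> X \<Longrightarrow> \<phi> z \<in> Y" "y \<in> Y \<Longrightarrow> \<exists>z\<in>X. d' y (\<phi> z) \<le> C"
    "z \<in> X \<Longrightarrow> w \<in> X \<Longrightarrow> d' (\<phi> z) (\<phi> w) \<le> K * d z w + C"
    using assms unfolding quasi_isometry_def by auto
  assume "z \<in> X" "w \<in> X"
  then have "1 / K * d z w - C \<le> d' (\<phi> z) (\<phi> w)" using assms unfolding quasi_isometry_def by blast
  then have "K * (1 / K * d z w - C) \<le> K * d' (\<phi> z) (\<phi> w)" using K by (intro mult_left_mono) auto
  then show "d z w \<le> K * d' (\<phi> z) (\<phi> w) + K * C" using K by (simp add: algebra_simps)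
qed

lemma (in DL) height_surj: obtains P where "P \<in> X" "H P = t"
proof -
  define k where "k = \<lfloor>t\<rfloor>"
  have k: "real_of_int k \<le> t" "t < real_of_int k + 1" unfolding k_def by linarith+
  obtain x where x: "x \<in> pverts S" "f x = k" using S.ht_surj by blast
  obtain y where y: "y \<in> pverts T" "g y = - k" using T.ht_surj by blast
  have z: "(x, y) \<in> verts" using x y unfolding verts_def by simp
  obtain w where w: "above (x, y) w" by (rule above_exists[OF z])
  have "pt (x, y) w (t - k) \<in> X" using pt_in[OF w] k by simp
  moreover have "H (pt (x, y) w (t - k)) = t"
    unfolding H_pt using aboveD(3)[OF w] x(2) by (simp add: algebra_simps)
  ultimately show ?thesis by (rule that)
qed

context DL_box
begin

lemma height_respecting_if:
  assumes qi: "quasi_isometry K C X d X d \<phi>"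
    and level: "\<And>P Q. P \<in> X \<Longrightarrow> Q \<in> X \<Longrightarrow> H P = H Q \<Longrightarrow> \<bar>H (\<phi> P) - H (\<phi> Q)\<bar> \<le> E"
    and spread: "\<And>P Q. P \<in> X \<Longrightarrow> Q \<in> X \<Longrightarrow> \<bar>H (\<phi> P) - H (\<phi> Q)\<bar> \<le> C \<Longrightarrow> \<bar>H P - H Q\<bar> \<le> F"
  shows "height_respecting X d H \<phi>"
proof -
  note q = quasi_isometryD[OF qi]
  define r where "r = max (E + 4) (C + (K * (F + 4) + C))"
  have "\<exists>s. hausdorff_dist d (\<phi> ` level_set X H t) (level_set X H s) \<le> ennreal r" for t
  proof -
    obtain P0 where P0: "P0 \<in> X" "H P0 = t" by (rule height_surj)
    have "hausdorff_dist d (\<phi> ` level_set X H t) (level_set X H (H (\<phi> P0))) \<le> ennreal r"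
    proof (rule hausdorff_dist_le)
      fix a assume "a \<in> \<phi> ` level_set X H t"
      then obtain P where P: "a = \<phi> P" "P \<in> X" "H P = t" unfolding level_set_def by blast
      obtain Q where Q: "Q \<in> X" "H Q = H (\<phi> P0)" "d (\<phi> P) Q \<le> \<bar>H (\<phi> P) - H (\<phi> P0)\<bar> + 4"
        by (rule vertical[OF q(3)[OF P(2)]])
      have "d (\<phi> P) Q \<le> r" using Q(3) level[OF P(2) P0(1)] P(3) P0(2) unfolding r_def by simp
      then show "\<exists>b\<in>level_set X H (H (\<phi> P0)). d a b \<le> r" using Q unfolding level_set_def P(1) by blast
    next
      fix b assume "b \<in> level_set X H (H (\<phi> P0))"
      then have b: "b \<in> X" "H b = H (\<phi> P0)" unfolding level_set_def by auto
      obtain P where P: "P \<in> X" "d b (\<phi> P) \<le> C" using q(6)[OF b(1)] by blast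
      have "\<bar>H (\<phi> P) - H (\<phi> P0)\<bar> \<le> C" using height_d[OF b(1) q(3)[OF P(1)]] P(2) b(2) by linarith
      then have F: "\<bar>H P - t\<bar> \<le> F" using spread[OF P(1) P0(1)] P0(2) by simp
      obtain Q where Q: "Q \<in> X" "H Q = t" "d P Q \<le> \<bar>H P - t\<bar> + 4" by (rule vertical[OF P(1)])
      have "d (\<phi> P) (\<phi> Q) \<le> K * d P Q + C" by (rule q(4)[OF P(1) Q(1)])
      moreover have "K * d P Q \<le> K * (F + 4)" using Q(3) F q(1) by (intro mult_left_mono) linarith+
      moreover have "d b (\<phi> Q) \<le> d b (\<phi> P) + d (\<phi> P) (\<phi> Q)" using d_tri b(1) q(3) P(1) Q(1) by blast
      ultimately have "d b (\<phi> Q) \<le> r" using P(2) unfolding r_def by linarith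
      moreover have "\<phi> Q \<in> \<phi> ` level_set X H t" using Q unfolding level_set_def by blast
      ultimately show "\<exists>a\<in>\<phi> ` level_set X H t. d b a \<le> r" by blast
    qed
    then show ?thesis by blast
  qed
  then show ?thesis unfolding height_respecting_def by blast
qed

theorem quasi_isometry_height_respecting:
  assumes qi: "quasi_isometry K C X d X d \<phi>"
  shows "height_respecting X d H \<phi>"
proof -
  note q = quasi_isometryD[OF qi]
  have "\<exists>w\<in>verts. d (\<phi> (vert z)) (vert w) \<le> 1" if "z \<in> verts" for z
    by (rule near_vert[OF q(3)[OF vert_in[OF that]]]) blast
  then obtain \<Phi> where \<Phi>: "\<And>z. z \<in> verts \<Longrightarrow> \<Phi> z \<in> verts" "\<And>z. z \<in> verts \<Longrightarrow> d (\<phi> (vert z)) (vert (\<Phi> z)) \<le> 1"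
    by metis
  define A where "A z w = d (vert z) (vert w)" for z w
  define A' where "A' z w = d (\<phi> (vert z)) (\<phi> (vert w))" for z w
  have \<Phi>_le: "A (\<Phi> z) (\<Phi> w) \<le> A' z w + 2" and \<Phi>_ge: "A' z w \<le> A (\<Phi> z) (\<Phi> w) + 2"
    if z: "z \<in> verts" and w: "w \<in> verts" for z w
  proof -
    note X = vert_in[OF \<Phi>(1)[OF z]] vert_in[OF \<Phi>(1)[OF w]] q(3)[OF vert_in[OF z]] q(3)[OF vert_in[OF w]]
    show "A (\<Phi> z) (\<Phi> w) \<le> A' z w + 2"
      using d_tri[OF X(1,3,2)] d_tri[OF X(3,4,2)] d_sym[OF X(1,3)] \<Phi>(2)[OF z] \<Phi>(2)[OF w]
      unfolding A_def A'_def by linarith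
    show "A' z w \<le> A (\<Phi> z) (\<Phi> w) + 2"
      using d_tri[OF X(3,1,4)] d_tri[OF X(1,2,4)] d_sym[OF X(2,4)] \<Phi>(2)[OF z] \<Phi>(2)[OF w]
      unfolding A_def A'_def by linarith
  qed
  have height_\<Phi>: "\<bar>H (\<phi> (vert z)) - height (\<Phi> z)\<bar> \<le> 1" if "z \<in> verts" for z
    using height_d[OF q(3)[OF vert_in[OF that]] vert_in[OF \<Phi>(1)[OF that]]] \<Phi>(2)[OF that] unfolding H_vert by linarith
  have height_\<phi>: "\<bar>H (\<phi> P) - H (\<phi> Q)\<bar> \<le> K * c + C" if "P \<in> X" "Q \<in> X" "d P Q \<le> c" for P Q c
  proof -
    have "K * d P Q \<le> K * c" using that(3) q(1) by (intro mult_left_mono) auto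
    then show ?thesis using height_d[OF q(3)[OF that(1)] q(3)[OF that(2)]] q(4)[OF that(1,2)] by linarith
  qed
  define L where "L = 8 * K + 2 * C + K * C + 2"
  have KC: "0 \<le> K * C" using q(1,2) by simp
  have L: "1 \<le> L" unfolding L_def using q(1,2) KC by linarith
  have qL: "quasi_iso L verts B.rho verts B.rho \<Phi>"
    unfolding quasi_iso_def
  proof (intro conjI ballI L)
    show "\<Phi> \<in> verts \<rightarrow> verts" using \<Phi>(1) by blast
  next
    fix z w assume z: "z \<in> verts" and w: "w \<in> verts"
    note X = vert_in[OF z] vert_in[OF w]
    have rho: "0 \<le> B.rho z w" "0 \<le> B.rho (\<Phi> z) (\<Phi> w)"
      using B.rho_ge[OF z w] B.rho_ge[OF \<Phi>(1)[OF z] \<Phi>(1)[OF w]] by linarith+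
    have "A' z w \<le> K * A z w + C" unfolding A_def A'_def by (rule q(4)[OF X])
    moreover have "K * A z w \<le> K * (4 * B.rho z w + 6)"
      unfolding A_def using d_le_rho[OF z w] q(1) by (intro mult_left_mono) auto
    moreover have "B.rho (\<Phi> z) (\<Phi> w) \<le> A (\<Phi> z) (\<Phi> w)" unfolding A_def by (rule rho_le_d[OF \<Phi>(1)[OF z] \<Phi>(1)[OF w]])
    ultimately have "B.rho (\<Phi> z) (\<Phi> w) \<le> 4 * K * B.rho z w + 6 * K + C + 2"
      using \<Phi>_le[OF z w] by (simp add: algebra_simps)
    moreover have "4 * K * B.rho z w \<le> L * B.rho z w"
      unfolding L_def using q(1,2) KC rho by (intro mult_right_mono) auto
    moreover have "6 * K + C + 2 \<le> L" unfolding L_def using q(1,2) KC by linarith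
    ultimately show "B.rho (\<Phi> z) (\<Phi> w) \<le> L * B.rho z w + L" by linarith
  next
    fix z w assume z: "z \<in> verts" and w: "w \<in> verts"
    note X = vert_in[OF z] vert_in[OF w]
    have "A z w \<le> K * A' z w + K * C" unfolding A_def A'_def by (rule q(5)[OF X])
    moreover have "K * A' z w \<le> K * (4 * B.rho (\<Phi> z) (\<Phi> w) + 8)"
      using \<Phi>_ge[OF z w] d_le_rho[OF \<Phi>(1)[OF z] \<Phi>(1)[OF w]] q(1) unfolding A_def by (intro mult_left_mono) auto
    moreover have "B.rho z w \<le> A z w" unfolding A_def by (rule rho_le_d[OF z w])
    ultimately have "B.rho z w \<le> 4 * K * B.rho (\<Phi> z) (\<Phi> w) + 8 * K + K * C" by (simp add: algebra_simps)
    moreover have "0 \<le> B.rho (\<Phi> z) (\<Phi> w)" using B.rho_ge[OF \<Phi>(1)[OF z] \<Phi>(1)[OF w]] by linarith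
    then have "4 * K * B.rho (\<Phi> z) (\<Phi> w) \<le> L * B.rho (\<Phi> z) (\<Phi> w)"
      unfolding L_def using q(1,2) KC by (intro mult_right_mono) auto
    moreover have "8 * K + K * C \<le> L" unfolding L_def using q(2) by linarith
    ultimately show "B.rho z w \<le> L * B.rho (\<Phi> z) (\<Phi> w) + L" by linarith
  next
    fix y assume y: "y \<in> verts"
    obtain P where P: "P \<in> X" "d (vert y) (\<phi> P) \<le> C" using q(6)[OF vert_in[OF y]] by blast
    obtain z where z: "z \<in> verts" "d P (vert z) \<le> 1" by (rule near_vert[OF P(1)])
    note X = vert_in[OF y] q(3)[OF P(1)] q(3)[OF vert_in[OF z(1)]] vert_in[OF \<Phi>(1)[OF z(1)]]
    have "K * d P (vert z) \<le> K * 1" using z(2) q(1) by (intro mult_left_mono) auto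
    then have "d (\<phi> P) (\<phi> (vert z)) \<le> K + C" using q(4)[OF P(1) vert_in[OF z(1)]] by linarith
    then have "d (vert y) (vert (\<Phi> z)) \<le> L"
      using d_tri[OF X(1,2,4)] d_tri[OF X(2,3,4)] \<Phi>(2)[OF z(1)] P(2) q(1,2) KC unfolding L_def by linarith
    then show "\<exists>z\<in>verts. B.rho y (\<Phi> z) \<le> L" using rho_le_d[OF y \<Phi>(1)[OF z(1)]] z(1) by force
  qed
  interpret BP: box_pair verts height low high m n verts height low high m n "max m n" by unfold_locales
  have mM: "max m n = m \<or> max m n = n" by linarith
  obtain C0 l0 where core: "\<And>\<phi>. BP.qi L \<phi> \<Longrightarrow>
      (\<forall>z\<in>verts. \<forall>w\<in>verts. height z = height w \<longrightarrow> \<bar>height (\<phi> z) - height (\<phi> w)\<bar> \<le> C0) \<and>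
      (\<forall>w\<in>verts. \<forall>l\<ge>l0. \<forall>v\<in>B.U l w. real l / 2 \<le> \<bar>height (\<phi> v) - height (\<phi> w)\<bar>)"
    using BP.levels_respected[OF L mM mM] by (elim exE conjE) (rule that, blast)
  have level: "\<bar>height (\<Phi> z) - height (\<Phi> w)\<bar> \<le> C0" if "z \<in> verts" "w \<in> verts" "height z = height w" for z w
    using core[OF qL] that by blast
  have grow: "real l / 2 \<le> \<bar>height (\<Phi> v) - height (\<Phi> w)\<bar>" if "w \<in> verts" "l0 \<le> l" "v \<in> B.U l w" for w l v
    using core[OF qL] that by blast
  have spread1: "height z - height w \<le> real l0 + 2 * (C0 + \<bar>height (\<Phi> z) - height (\<Phi> w)\<bar>)"
    if zw: "z \<in> verts" "w \<in> verts" for z w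
  proof (cases "height z - height w \<le> real l0")
    case True
    have "0 \<le> C0 + \<bar>height (\<Phi> z) - height (\<Phi> w)\<bar>" using level[OF zw(1) zw(1)] by simp
    then show ?thesis using True by argo
  next
    case False
    define l where "l = nat (f (fst z) - f (fst w))"
    have l: "real l = height z - height w" "l0 \<le> l" using False unfolding l_def height_def by linarith+
    obtain v where v: "v \<in> B.U l w" using B.up_ne[OF zw(2)] by blast
    then have v2: "v \<in> verts" "height v = height z" using B.up_iff[OF zw(2)] l by auto
    show ?thesis using grow[OF zw(2) l(2) v] level[OF v2(1) zw(1) v2(2)] l(1) of_nat_0_le_iff[where 'a = real, of l0] by argo
  qed
  show ?thesis
  proof (rule height_respecting_if[OF qi])
    fix P Q assume P: "P \<in> X" and Q: "Q \<in> X" and PQ: "H P = H Q"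
    obtain z where z: "z \<in> verts" "d P (vert z) \<le> 1" by (rule near_vert[OF P])
    obtain w where w: "w \<in> verts" "d Q (vert w) \<le> 1" by (rule near_vert[OF Q])
    obtain v where v: "v \<in> verts" "height v = height z" "d (vert w) (vert v) \<le> \<bar>height w - height z\<bar>"
      using vertical_vert[OF w(1), of "f (fst z)"] unfolding height_def by blast
    have "\<bar>height w - height z\<bar> \<le> 2"
      using height_d[OF P vert_in[OF z(1)]] height_d[OF Q vert_in[OF w(1)]] z(2) w(2) PQ unfolding H_vert by linarith
    then have "\<bar>H (\<phi> (vert w)) - H (\<phi> (vert v))\<bar> \<le> K * 2 + C"
      using v(3) by (intro height_\<phi>[OF vert_in[OF w(1)] vert_in[OF v(1)]]) linarith
    then show "\<bar>H (\<phi> P) - H (\<phi> Q)\<bar> \<le> 4 * K + 3 * C + C0 + 2"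
      using height_\<phi>[OF P vert_in[OF z(1)] z(2)] height_\<phi>[OF Q vert_in[OF w(1)] w(2)]
        height_\<Phi>[OF z(1)] height_\<Phi>[OF v(1)] level[OF v(1) z(1) v(2)] by argo
  next
    fix P Q assume P: "P \<in> X" and Q: "Q \<in> X" and PQ: "\<bar>H (\<phi> P) - H (\<phi> Q)\<bar> \<le> C"
    obtain z where z: "z \<in> verts" "d P (vert z) \<le> 1" by (rule near_vert[OF P])
    obtain w where w: "w \<in> verts" "d Q (vert w) \<le> 1" by (rule near_vert[OF Q])
    have "\<bar>height (\<Phi> z) - height (\<Phi> w)\<bar> \<le> 2 * K + 3 * C + 2"
      using height_\<phi>[OF P vert_in[OF z(1)] z(2)] height_\<phi>[OF Q vert_in[OF w(1)] w(2)]
        height_\<Phi>[OF z(1)] height_\<Phi>[OF w(1)] PQ by argo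
    then have "\<bar>height z - height w\<bar> \<le> real l0 + 2 * (C0 + (2 * K + 3 * C + 2))"
      using spread1[OF z(1) w(1)] spread1[OF w(1) z(1)] by argo
    then show "\<bar>H P - H Q\<bar> \<le> real l0 + 2 * (C0 + (2 * K + 3 * C + 2)) + 2"
      using height_d[OF P vert_in[OF z(1)]] height_d[OF Q vert_in[OF w(1)]] z(2) w(2) unfolding H_vert by argo
  qed
qed

end

lemma (in DL) line_height_respecting:
  assumes m: "m = 1" "n = 1" and qi: "quasi_isometry K C X d X d \<phi>"
  shows "height_respecting X d H \<phi>"
proof -
  have unique: "P = Q" if "P \<in> X" "Q \<in> X" "H P = H Q" for P Q
  proof (rule prod_eqI)
    have *: "fst P \<in> realisation S" "snd P \<in> realisation T" "affine_ext f (fst P) + affine_ext g (snd P) = 0"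
      "fst Q \<in> realisation S" "snd Q \<in> realisation T" "affine_ext f (fst Q) + affine_ext g (snd Q) = 0"
      using that unfolding DL_space_def by auto
    show "fst P = fst Q" using that(3) unfolding DL_height_def by (rule Sg.line_point_unique[OF m(1) *(1,4)])
    have "affine_ext g (snd P) = affine_ext g (snd Q)" using that(3) *(3,6) unfolding DL_height_def by linarith
    then show "snd P = snd Q" by (rule Tg.line_point_unique[OF m(2) *(2,5)])
  qed
  note q = quasi_isometryD[OF qi]
  have "\<exists>s. hausdorff_dist d (\<phi> ` level_set X H t) (level_set X H s) \<le> ennreal 0" for t
  proof -
    obtain P where P: "P \<in> X" "H P = t" by (rule height_surj)
    have single: "level_set X H (H Q) = {Q}" if "Q \<in> X" for Q unfolding level_set_def using unique that by blast
    have "level_set X H t = {P}" "level_set X H (H (\<phi> P)) = {\<phi> P}"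
      using single[OF P(1)] single[OF q(3)[OF P(1)]] P(2) by simp_all
    then show ?thesis using d_refl[OF q(3)[OF P(1)]]
      by (intro exI[of _ "H (\<phi> P)"] hausdorff_dist_le) auto
  qed
  then show ?thesis unfolding height_respecting_def by blast
qed

(* The hypothesis "m = 1 \<longleftrightarrow> n = 1" excludes only the case where exactly one of m, n is 1.
   Then the Diestel-Leader graph is a regular tree of valence at least 3, and an isometry of
   that tree moving the chosen end is at infinite distance from every height respecting map. *)

theorem theorem2p3:
  fixes m n :: nat
    and S :: "'a pair_pre_digraph" and T :: "'b pair_pre_digraph"
    and \<omega> :: "(nat \<Rightarrow> 'a) set" and \<eta> :: "(nat \<Rightarrow> 'b) set"
    and f :: "'a \<Rightarrow> int" and g :: "'b \<Rightarrow> int"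
  assumes "m \<ge> 1" and "n \<ge> 1" and "m = 1 \<longleftrightarrow> n = 1"
    and "regular_tree (m + 1) S" and "regular_tree (n + 1) T"
    and "\<omega> \<in> tree_ends S" and "\<eta> \<in> tree_ends T"
    and "busemann S \<omega> f" and "busemann T \<eta> g"
  defines "X \<equiv> DL_space S T f g" and "d \<equiv> DL_dist S T f g"
    and "h \<equiv> (DL_height f :: ('a \<Rightarrow> real) \<times> ('b \<Rightarrow> real) \<Rightarrow> real)"
  shows "\<forall>K C :: real. K \<ge> 1 \<and> C \<ge> 0 \<longrightarrow>
    (\<exists>D :: real. \<forall>\<phi>. quasi_isometry K C X d X d \<phi> \<longrightarrow>
      (\<exists>\<phi>'. (\<exists>K' C'. quasi_isometry K' C' X d X d \<phi>') \<and>
            height_respecting X d h \<phi>' \<and>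
            (\<forall>p\<in>X. d (\<phi> p) (\<phi>' p) \<le> D)))"
proof -
  obtain p where p: "horotree (pverts S) p f m"
    "\<And>u v. (u, v) \<in> parcs S \<longleftrightarrow> u \<in> pverts S \<and> v \<in> pverts S \<and> (p u = v \<or> p v = u)"
    using busemann_horotree[of m S \<omega> f] assms(1,4,6,8) by auto
  obtain q where q: "horotree (pverts T) q g n"
    "\<And>u v. (u, v) \<in> parcs T \<longleftrightarrow> u \<in> pverts T \<and> v \<in> pverts T \<and> (q u = v \<or> q v = u)"
    using busemann_horotree[of n T \<eta> g] assms(2,5,7,9) by auto
  interpret S: horotree_graph S p f m using p by (intro horotree_graph.intro horotree_graph_axioms.intro)
  interpret T: horotree_graph T q g n using q by (intro horotree_graph.intro horotree_graph_axioms.intro)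
  interpret DL S T p f m q g n by unfold_locales
  have respecting: "height_respecting X d h \<phi>" if qi: "quasi_isometry K C X d X d \<phi>" for K C \<phi>
  proof (cases "m = 1")
    case True
    then show ?thesis using line_height_respecting[OF _ _ qi[unfolded X_def d_def]] assms(3) unfolding X_def d_def h_def by simp
  next
    case False
    interpret DL_box S T p f m q g n using False assms(1-3) by unfold_locales linarith+
    show ?thesis using quasi_isometry_height_respecting[OF qi[unfolded X_def d_def]] unfolding X_def d_def h_def .
  qed
  have zero: "d (\<phi> x) (\<phi> x) \<le> 0" if "quasi_isometry K C X d X d \<phi>" "x \<in> X" for K C \<phi> x
    using d_refl quasi_isometryD(3)[OF that] unfolding X_def d_def by simp
  show ?thesis using respecting zero by (intro allI impI exI[of _ 0]) blast
qed

end
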